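(* Let $d\ge 1$ and let $B$ be a two-parameter Brownian sheet in $\mathbf{R}^d$. Define $\mathcal{Z}_d:=\{s\ge 0:\ B(s,t)=0\text{ for some }t>0\}$. Then for every non-random compact set $F\subset(0,\infty)$, \[ \mathrm{P}\{\mathcal{Z}_d\cap F\neq\varnothing\}>0 \iff \mathrm{Cap}_{(d-2)/2}(F)>0 . \]
   Context: A two-parameter Brownian sheet in $\mathbf{R}^d$ is a continuous centered Gaussian process $\{B(s,t)\}_{s,t\ge0}$ with values in $\mathbf{R}^d$ and $\mathrm{Cov}(B_i(s,t),B_j(u,v))=\min(s,u)\min(t,v)\delta_{i,j}$. Riesz capacity: for $\beta\in\mathbf{R}$ and $x\neq 0$ let $U_\beta(x)=1$ if $\beta<0$, $U_\beta(x)=\log_+(1/|x|)$ if $\beta=0$, $U_\beta(x)=|x|^{-\beta}$ if $\beta>0$, extended continuously to $x=0$ as a $[0,\infty]$-valued function. For a probability measure $\mu$, $I_\beta(\mu)=\iint U_\beta(x-y)\,\mu(dx)\mu(dy)$, and for a Borel set $F$, $\mathrm{Cap}_\beta(F)=[\inf_{\mu\in\mathcal{P}(F)}I_\beta(\mu)]^{-1}$, where $\mathcal{P}(F)$ is the set of Borel probability measures on $F$, $\inf\varnothing=\infty$, $1/\infty=0$. *)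

theory Defs
  imports "HOL-Probability.Probability"
begin

definition centered_normal :: "real \<Rightarrow> real measure" where
  "centered_normal v =
     (if v = 0 then return borel 0 else density lborel (normal_density 0 (sqrt v)))"

text \<open>A continuous centered Gaussian process indexed by s, t \<ge> 0 with
  Cov(B_i(s,t), B_j(u,v)) = min s u * min t v * delta_ij.  Gaussianity is expressed
  by requiring every finite real linear combination of coordinates to be centered
  normal with the variance dictated by the covariance.\<close>

definition sheet_cov :: "real \<times> real \<times> 'd \<Rightarrow> real \<times> real \<times> 'd \<Rightarrow> real" where
  "sheet_cov p q = (case p of (s, t, i) \<Rightarrow> case q of (u, v, j) \<Rightarrow>
       min s u * min t v * (if i = j then 1 else 0))"

definition brownian_sheet ::
    "'a measure \<Rightarrow> (real \<Rightarrow> real \<Rightarrow> 'a \<Rightarrow> real ^ 'd::finite) \<Rightarrow> bool" where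
  "brownian_sheet M B \<longleftrightarrow>
     prob_space M \<and>
     (\<forall>s\<ge>0. \<forall>t\<ge>0. B s t \<in> borel_measurable M) \<and>
     (\<forall>\<omega>\<in>space M. continuous_on ({0..} \<times> {0..}) (\<lambda>p. B (fst p) (snd p) \<omega>)) \<and>
     (\<forall>ps :: ((real \<times> real \<times> 'd) \<times> real) list.
        (\<forall>((s, t, i), c) \<in> set ps. s \<ge> 0 \<and> t \<ge> 0) \<longrightarrow>
        distr M borel (\<lambda>\<omega>. \<Sum>((s, t, i), c) \<leftarrow> ps. c * (B s t \<omega> $ i)) =
        centered_normal (\<Sum>(p, c) \<leftarrow> ps. \<Sum>(q, c') \<leftarrow> ps. c * c' * sheet_cov p q))"

definition riesz_kernel :: "real \<Rightarrow> 'v::real_normed_vector \<Rightarrow> ennreal" where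
  "riesz_kernel \<beta> x =
     (if \<beta> < 0 then 1
      else if x = 0 then \<top>
      else if \<beta> = 0 then ennreal (max 0 (ln (1 / norm x)))
      else ennreal (norm x powr (- \<beta>)))"

definition riesz_energy :: "real \<Rightarrow> 'v::real_normed_vector measure \<Rightarrow> ennreal" where
  "riesz_energy \<beta> \<mu> = (\<integral>\<^sup>+ x. (\<integral>\<^sup>+ y. riesz_kernel \<beta> (x - y) \<partial>\<mu>) \<partial>\<mu>)"

definition prob_measures_on :: "'v::real_normed_vector set \<Rightarrow> 'v measure set" where
  "prob_measures_on F = {\<mu>. sets \<mu> = sets borel \<and> prob_space \<mu> \<and> emeasure \<mu> F = 1}"

text \<open>In ennreal: Inf of the empty set is top and inverse top = 0.\<close>
definition riesz_capacity :: "real \<Rightarrow> 'v::real_normed_vector set \<Rightarrow> ennreal" where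
  "riesz_capacity \<beta> F = inverse (INF \<mu> \<in> prob_measures_on F. riesz_energy \<beta> \<mu>)"

end

theory Submission
  imports Defs
begin

text \<open>
  A mollified local time J of the sheet at 0, taken along a measure \<open>\<mu>\<close> on F times Lebesgue measure in t,
  has second moment comparable to the Riesz energy of \<open>\<mu>\<close>: the covariance structure gives the kernel
  \<open>(|s - u| + |t - v|) powr (- d / 2)\<close>, and integrating out t and v leaves the kernel of order (d - 2) / 2.

  If some \<open>\<mu>\<close> has finite energy, the Paley-Zygmund inequality bounds the probability that J is large
  from below, uniformly in the mollification, and J tends to 0 wherever the sheet has no zero.

  Conversely, if zeros occur with positive probability, let \<open>\<mu>\<close> be the conditional law of the first
  s in F for which B(s, t) = 0 for some t in a fixed interval.  At such a zero the iterated conditional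
  expectation of J, first given the past in s and then the past in t, is at least the one-sided
  potential of \<open>\<mu>\<close> at s.  Applying Doob's inequality in each parameter (Cairoli's inequality) gives
  P (energy)^2 \<open>\<le>\<close> const (energy), so the energy is bounded uniformly in the mollification.

  All conditional expectations are of heat kernels evaluated at the sheet, for which they are
  explicit; they are identified through characteristic functions.
\<close>

section \<open>Weights determined by characteristic functions\<close>

text \<open>The law of the sheet is prescribed only through finite linear combinations, so neither
  independence nor a conditional law is directly available. One device supplies both: a normal
  density is a superposition of \<open>iexp\<close>, hence an expectation containing it is an
  integral of joint characteristic functions, which the covariance makes explicit.

  A zero in the plane admits no stopping argument in both parameters at once; a maximal inequality
  over all corners of a grid covers whichever corner lies near the random zero. From a corner only
  the quadrant above it is visible. In time this is cured by letting the local time run one unit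
  past the interval that contains the zero, in s by the symmetry of the energy, which costs a factor
  2.

  The mollification e serves twice more: it bounds every kernel, so that the energy is finite before
  a quadratic inequality is divided by it, and it absorbs both the distance from the zero to the
  grid and the value of the sheet at the grid point.\<close>

lemma weighted_law_eq_if_char_eq:
  fixes M :: "'a measure" and Y G1 G2 :: "'a \<Rightarrow> real"
  assumes "finite_measure M"
    and Y [measurable]: "Y \<in> borel_measurable M"
    and G1 [measurable]: "G1 \<in> borel_measurable M" and G1b: "\<And>\<omega>. 0 \<le> G1 \<omega>" "\<And>\<omega>. G1 \<omega> \<le> c"
    and G2 [measurable]: "G2 \<in> borel_measurable M" and G2b: "\<And>\<omega>. 0 \<le> G2 \<omega>" "\<And>\<omega>. G2 \<omega> \<le> c"
    and eq: "\<And>\<xi>. (CLINT \<omega>|M. of_real (G1 \<omega>) * iexp (\<xi> * Y \<omega>)) = (CLINT \<omega>|M. of_real (G2 \<omega>) * iexp (\<xi> * Y \<omega>))"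
    and E [measurable]: "E \<in> sets borel"
  shows "(\<integral>\<omega>. G1 \<omega> * indicator E (Y \<omega>) \<partial>M) = (\<integral>\<omega>. G2 \<omega> * indicator E (Y \<omega>) \<partial>M)"
proof -
  interpret finite_measure M by fact
  define m where "m = (\<integral>\<omega>. G1 \<omega> \<partial>M)"
  have int: "integrable M G" if "G \<in> borel_measurable M" "\<And>\<omega>. 0 \<le> G \<omega>" "\<And>\<omega>. G \<omega> \<le> c" for G :: "'a \<Rightarrow> real"
    using that by (intro integrable_const_bound[where B=c]) auto
  \<comment> \<open>The frequency 0 equates the total masses, so one constant \<open>m\<close>
    normalises both weights.\<close>
  have "complex_of_real m = of_real (\<integral>\<omega>. G2 \<omega> \<partial>M)"
    using eq[of 0] by (simp add: m_def)
  then have m2: "(\<integral>\<omega>. G2 \<omega> \<partial>M) = m" by simp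
  have m0: "m \<ge> 0" unfolding m_def using G1b by simp
  have sm: "(\<integral>\<omega>. G \<omega> * indicator E (Y \<omega>) \<partial>M) = 0"
    if "G \<in> borel_measurable M" "\<And>\<omega>. 0 \<le> G \<omega>" "\<And>\<omega>. G \<omega> \<le> c" "(\<integral>\<omega>. G \<omega> \<partial>M) = 0" for G
  proof -
    note [measurable] = that(1)
    have "AE \<omega> in M. G \<omega> = 0"
      using that int[OF that(1-3)] by (subst integral_nonneg_eq_0_iff_AE[symmetric]) auto
    then show ?thesis by (intro integral_eq_zero_AE) auto
  qed
  show ?thesis
  proof (cases "m = 0")
    case True
    then show ?thesis using sm[of G1] sm[of G2] G1b G2b m2 by (simp add: m_def)
  next
    case False
    with m0 have mp: "m > 0" by simp
    \<comment> \<open>Division by \<open>m\<close> turns a weight into the density of a probability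
      measure; \<open>D G\<close> is the law of \<open>Y\<close> under it. The two laws have the
      same characteristic function. Mass zero was split off because it cannot be normalised.\<close>
    define D where "D G = distr (density M (\<lambda>\<omega>. ennreal (G \<omega> / m))) borel Y" for G
    have rd: "real_distribution (D G)"
      and ch: "char (D G) \<xi> = (CLINT \<omega>|M. of_real (G \<omega>) * iexp (\<xi> * Y \<omega>)) / of_real m"
      and ms: "measure (D G) E = (\<integral>\<omega>. G \<omega> * indicator E (Y \<omega>) \<partial>M) / m"
      if [measurable]: "G \<in> borel_measurable M" and b: "\<And>\<omega>. 0 \<le> G \<omega>" "\<And>\<omega>. G \<omega> \<le> c" and m: "(\<integral>\<omega>. G \<omega> \<partial>M) = m" for G \<xi>
    proof -
      have "(\<integral>\<^sup>+ \<omega>. ennreal (G \<omega> / m) \<partial>M) = ennreal (\<integral>\<omega>. G \<omega> / m \<partial>M)"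
        using b mp int[of G] by (intro nn_integral_eq_integral) auto
      also have "(\<integral>\<omega>. G \<omega> / m \<partial>M) = 1" using m mp by simp
      finally have 1: "(\<integral>\<^sup>+ \<omega>. ennreal (G \<omega> / m) \<partial>M) = 1" by simp
      have P: "prob_space (density M (\<lambda>\<omega>. ennreal (G \<omega> / m)))"
        by (rule prob_spaceI) (simp add: emeasure_density 1 cong: nn_integral_cong)
      then interpret P: prob_space "density M (\<lambda>\<omega>. ennreal (G \<omega> / m))" .
      interpret D: prob_space "D G" unfolding D_def by (rule P.prob_space_distr) simp
      show "real_distribution (D G)" by unfold_locales (simp_all add: D_def)
      show "char (D G) \<xi> = (CLINT \<omega>|M. of_real (G \<omega>) * iexp (\<xi> * Y \<omega>)) / of_real m"
        unfolding char_def D_def using b mp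
        by (simp add: integral_distr integral_density scaleR_conv_of_real)
      have "measure (D G) E = (\<integral>x. indicator E x \<partial>D G)" by (simp add: D_def)
      also have "\<dots> = (\<integral>\<omega>. (G \<omega> / m) *\<^sub>R indicator E (Y \<omega>) \<partial>M)"
        unfolding D_def using b mp
        by (subst integral_distr) (auto simp: integral_density)
      finally show "measure (D G) E = (\<integral>\<omega>. G \<omega> * indicator E (Y \<omega>) \<partial>M) / m" by simp
    qed
    have "D G1 = D G2"
      using rd[of G1] rd[of G2] ch[of G1] ch[of G2] G1b G2b m2 eq
      by (intro Levy_uniqueness) (auto simp: m_def)
    then show ?thesis using ms[of G1] ms[of G2] G1b G2b m2 mp by (simp add: m_def)
  qed
qed

text \<open>With \<open>V\<close> the linear functionals of the past and \<open>W2\<close> a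
  function of the past, this is the tested form of the claim that \<open>W2\<close> is the
  conditional expectation of \<open>W1\<close>.\<close>

definition char_equiv :: "'a measure \<Rightarrow> ('a \<Rightarrow> real) set \<Rightarrow> ('a \<Rightarrow> real) \<Rightarrow> ('a \<Rightarrow> real) \<Rightarrow> bool" where
  "char_equiv M V W1 W2 \<longleftrightarrow>
     (\<forall>L\<in>V. (CLINT \<omega>|M. of_real (W1 \<omega>) * iexp (L \<omega>)) = (CLINT \<omega>|M. of_real (W2 \<omega>) * iexp (L \<omega>)))"

lemma cos_conv_iexp: "complex_of_real (cos x) = (iexp x + iexp (- x)) / 2"
  using cos_exp_eq[of "complex_of_real x"] by (simp add: cos_of_real)

text \<open>The nonnegative weight 1 + cos (L + \<phi>) carries the factor exp (i L) through the
  one-dimensional uniqueness theorem for positive measures.\<close>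

lemma char_equiv_times_indicator:
  fixes M :: "'a measure"
  assumes "finite_measure M"
    and V: "\<And>L. L \<in> V \<Longrightarrow> L \<in> borel_measurable M"
    and lin: "\<And>L L' a b. L \<in> V \<Longrightarrow> L' \<in> V \<Longrightarrow> (\<lambda>\<omega>. a * L \<omega> + b * L' \<omega>) \<in> V"
    and W1 [measurable]: "W1 \<in> borel_measurable M" and W1b: "\<And>\<omega>. 0 \<le> W1 \<omega>" "\<And>\<omega>. W1 \<omega> \<le> c"
    and W2 [measurable]: "W2 \<in> borel_measurable M" and W2b: "\<And>\<omega>. 0 \<le> W2 \<omega>" "\<And>\<omega>. W2 \<omega> \<le> c"
    and eq: "char_equiv M V W1 W2"
    and Y: "Y \<in> V" and E [measurable]: "E \<in> sets borel"
  shows "char_equiv M V (\<lambda>\<omega>. W1 \<omega> * indicator E (Y \<omega>)) (\<lambda>\<omega>. W2 \<omega> * indicator E (Y \<omega>))"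
proof -
  interpret finite_measure M by fact
  note [measurable] = V[OF Y]
  have c0: "c \<ge> 0" using W1b by (meson order_trans)
  have eqL: "(CLINT \<omega>|M. of_real (W1 \<omega>) * iexp (L \<omega>)) = (CLINT \<omega>|M. of_real (W2 \<omega>) * iexp (L \<omega>))"
    if "L \<in> V" for L
    using eq that by (auto simp: char_equiv_def)
  {
    fix L assume L: "L \<in> V"
    note [measurable] = V[OF L]
    have intc: "complex_integrable M (\<lambda>\<omega>. of_real (W \<omega>) * iexp (h \<omega>))"
      if "W \<in> borel_measurable M" "\<And>\<omega>. 0 \<le> W \<omega>" "\<And>\<omega>. W \<omega> \<le> c" "h \<in> borel_measurable M" for W h
      using that by (intro integrable_const_bound[where B=c]) (auto simp: norm_mult)
    have intr: "integrable M (\<lambda>\<omega>. W \<omega> * h \<omega>)"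
      if "W \<in> borel_measurable M" "\<And>\<omega>. 0 \<le> W \<omega>" "\<And>\<omega>. W \<omega> \<le> c" "h \<in> borel_measurable M"
        "\<And>\<omega>. \<bar>h \<omega>\<bar> \<le> 1" for W h :: "'a \<Rightarrow> real"
      using that by (intro integrable_const_bound[where B=c])
        (auto simp: abs_mult intro!: AE_I2 mult_left_le order_trans[OF mult_left_le])
    \<comment> \<open>Writing the cosine through exponentials leaves the transforms at \<xi> Y,
      \<xi> Y + L and \<xi> Y - L, whose arguments all lie in \<open>V\<close>. The factors 0, 1 and
      -1 keep the shape in which \<open>lin\<close> delivers them.\<close>
    have ex: "(CLINT \<omega>|M. of_real (W \<omega> * (1 + cos (L \<omega> + \<phi>))) * iexp (\<xi> * Y \<omega>)) =
        (CLINT \<omega>|M. of_real (W \<omega>) * iexp (\<xi> * Y \<omega> + 0 * Y \<omega>))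
        + (iexp \<phi> / 2) * (CLINT \<omega>|M. of_real (W \<omega>) * iexp (\<xi> * Y \<omega> + 1 * L \<omega>))
        + (iexp (- \<phi>) / 2) * (CLINT \<omega>|M. of_real (W \<omega>) * iexp (\<xi> * Y \<omega> + (-1) * L \<omega>))"
      if [measurable]: "W \<in> borel_measurable M" and b: "\<And>\<omega>. 0 \<le> W \<omega>" "\<And>\<omega>. W \<omega> \<le> c" for W \<xi> \<phi>
    proof -
      have "of_real (W \<omega> * (1 + cos (L \<omega> + \<phi>))) * iexp (\<xi> * Y \<omega>) =
         of_real (W \<omega>) * iexp (\<xi> * Y \<omega> + 0 * Y \<omega>)
        + (iexp \<phi> / 2) * (of_real (W \<omega>) * iexp (\<xi> * Y \<omega> + 1 * L \<omega>))
        + (iexp (- \<phi>) / 2) * (of_real (W \<omega>) * iexp (\<xi> * Y \<omega> + (-1) * L \<omega>))" for \<omega>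
        by (simp add: cos_conv_iexp algebra_simps exp_add exp_diff exp_minus add_divide_distrib)
      moreover have "complex_integrable M (\<lambda>\<omega>. of_real (W \<omega>) * iexp (\<xi> * Y \<omega> + a * h \<omega>))"
        if [measurable]: "h \<in> borel_measurable M" for a h
        by (intro intc b) measurable
      ultimately show ?thesis
        by (simp only: Bochner_Integration.integral_add Bochner_Integration.integrable_add
            integrable_mult_right integral_mult_right_zero V[OF Y] V[OF L])
    qed
    have I0: "(\<integral>\<omega>. W1 \<omega> * indicator E (Y \<omega>) \<partial>M) = (\<integral>\<omega>. W2 \<omega> * indicator E (Y \<omega>) \<partial>M)"
    proof (rule weighted_law_eq_if_char_eq[where c=c])
      show "(CLINT \<omega>|M. of_real (W1 \<omega>) * iexp (\<xi> * Y \<omega>)) = (CLINT \<omega>|M. of_real (W2 \<omega>) * iexp (\<xi> * Y \<omega>))" for \<xi>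
        using eqL[OF lin[OF Y Y, of \<xi> 0]] by simp
    qed (use W1b W2b \<open>finite_measure M\<close> in auto)
    have I1: "(\<integral>\<omega>. (W1 \<omega> * (1 + cos (L \<omega> + \<phi>))) * indicator E (Y \<omega>) \<partial>M)
        = (\<integral>\<omega>. (W2 \<omega> * (1 + cos (L \<omega> + \<phi>))) * indicator E (Y \<omega>) \<partial>M)" for \<phi>
    proof (rule weighted_law_eq_if_char_eq[where c="c * 2"])
      fix \<xi>
      show "(CLINT \<omega>|M. of_real (W1 \<omega> * (1 + cos (L \<omega> + \<phi>))) * iexp (\<xi> * Y \<omega>))
          = (CLINT \<omega>|M. of_real (W2 \<omega> * (1 + cos (L \<omega> + \<phi>))) * iexp (\<xi> * Y \<omega>))"
        unfolding ex[OF W1 W1b] ex[OF W2 W2b]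
        using eqL[OF lin[OF Y Y, of \<xi> 0]] eqL[OF lin[OF Y L, of \<xi> 1]] eqL[OF lin[OF Y L, of \<xi> "-1"]] by simp
    next
      fix \<omega>
      have "0 \<le> 1 + cos (L \<omega> + \<phi>)" "1 + cos (L \<omega> + \<phi>) \<le> 2"
        using cos_ge_minus_one[of "L \<omega> + \<phi>"] cos_le_one[of "L \<omega> + \<phi>"] by linarith+
      then show "0 \<le> W1 \<omega> * (1 + cos (L \<omega> + \<phi>))" "0 \<le> W2 \<omega> * (1 + cos (L \<omega> + \<phi>))"
         "W1 \<omega> * (1 + cos (L \<omega> + \<phi>)) \<le> c * 2" "W2 \<omega> * (1 + cos (L \<omega> + \<phi>)) \<le> c * 2"
        using W1b[of \<omega>] W2b[of \<omega>] c0 by (auto intro!: mult_mono)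
    qed (use \<open>finite_measure M\<close> in auto)
    have I2: "(\<integral>\<omega>. W1 \<omega> * (indicator E (Y \<omega>) * cos (L \<omega> + \<phi>)) \<partial>M)
        = (\<integral>\<omega>. W2 \<omega> * (indicator E (Y \<omega>) * cos (L \<omega> + \<phi>)) \<partial>M)" for \<phi>
    proof -
      have "(\<integral>\<omega>. (W \<omega> * (1 + cos (L \<omega> + \<phi>))) * indicator E (Y \<omega>) \<partial>M)
        = (\<integral>\<omega>. W \<omega> * indicator E (Y \<omega>) \<partial>M) + (\<integral>\<omega>. W \<omega> * (indicator E (Y \<omega>) * cos (L \<omega> + \<phi>)) \<partial>M)"
        if [measurable]: "W \<in> borel_measurable M" and b: "\<And>\<omega>. 0 \<le> W \<omega>" "\<And>\<omega>. W \<omega> \<le> c" for W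
        by (subst Bochner_Integration.integral_add[symmetric])
          (auto intro!: intr b Bochner_Integration.integral_cong simp: algebra_simps abs_mult indicator_def)
      from this[OF W1 W1b] this[OF W2 W2b] show ?thesis using I0 I1[of \<phi>] by simp
    qed
    \<comment> \<open>The phases 0 and -pi/2 turn the shifted cosine into the real and the imaginary
      part of \<open>iexp (L \<omega>)\<close>.\<close>
    have I3: "(CLINT \<omega>|M. of_real (W \<omega> * indicator E (Y \<omega>)) * iexp (L \<omega>)) =
        of_real (\<integral>\<omega>. W \<omega> * (indicator E (Y \<omega>) * cos (L \<omega> + 0)) \<partial>M)
        + \<i> * of_real (\<integral>\<omega>. W \<omega> * (indicator E (Y \<omega>) * cos (L \<omega> + (-(pi/2)))) \<partial>M)"
      if [measurable]: "W \<in> borel_measurable M" and b: "\<And>\<omega>. 0 \<le> W \<omega>" "\<And>\<omega>. W \<omega> \<le> c" for W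
    proof -
      have i1: "integrable M (\<lambda>\<omega>. W \<omega> * (indicator E (Y \<omega>) * cos (L \<omega> + \<phi>)))" for \<phi>
        by (intro intr b) (auto simp: abs_mult indicator_def)
      have "of_real (W \<omega> * indicator E (Y \<omega>)) * iexp (L \<omega>) =
        of_real (W \<omega> * (indicator E (Y \<omega>) * cos (L \<omega> + 0)))
        + \<i> * of_real (W \<omega> * (indicator E (Y \<omega>) * cos (L \<omega> + (-(pi/2)))))" for \<omega>
        by (simp add: exp_Euler cos_of_real sin_of_real cos_diff algebra_simps)
      moreover have "complex_integrable M (\<lambda>\<omega>. of_real (W \<omega> * (indicator E (Y \<omega>) * cos (L \<omega> + \<phi>))))" for \<phi>
        using i1[of \<phi>] by (rule integrable_of_real)
      ultimately show ?thesis
        by (simp only: Bochner_Integration.integral_add integrable_mult_right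
            integral_mult_right_zero integral_complex_of_real)
    qed
    have "(CLINT \<omega>|M. of_real (W1 \<omega> * indicator E (Y \<omega>)) * iexp (L \<omega>)) =
       (CLINT \<omega>|M. of_real (W2 \<omega> * indicator E (Y \<omega>)) * iexp (L \<omega>))"
      unfolding I3[OF W1 W1b] I3[OF W2 W2b] I2 ..
  }
  then show ?thesis unfolding char_equiv_def by blast
qed

section \<open>Weights tested on a generated sigma-algebra\<close>

text \<open>Encoded as a pullback of the product sigma-algebra, so that equality of two measures on
  the product space carries over to every set of the algebra.\<close>

definition generated_algebra :: "'a measure \<Rightarrow> 'k set \<Rightarrow> ('k \<Rightarrow> 'a \<Rightarrow> real) \<Rightarrow> 'a measure" where
  "generated_algebra M I Y =
     vimage_algebra (space M) (\<lambda>\<omega>. \<lambda>k\<in>I. Y k \<omega>) (PiM I (\<lambda>_. borel))"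

lemma space_generated_algebra [simp]: "space (generated_algebra M I Y) = space M"
  by (simp add: generated_algebra_def)

lemma measurable_generated_algebra:
  assumes "k \<in> I" shows "Y k \<in> borel_measurable (generated_algebra M I Y)"
proof -
  have "(\<lambda>\<omega>. \<lambda>k\<in>I. Y k \<omega>) \<in> measurable (generated_algebra M I Y) (PiM I (\<lambda>_. borel))"
    unfolding generated_algebra_def by (rule measurable_vimage_algebra1) (auto simp: space_PiM)
  then have "(\<lambda>\<omega>. (\<lambda>k\<in>I. Y k \<omega>) k) \<in> borel_measurable (generated_algebra M I Y)"
    by (rule measurable_compose) (rule measurable_component_singleton[OF assms])
  then show ?thesis using assms by simp
qed

lemma sets_generated_algebra_le:
  assumes "space N = space M" "\<And>k. k \<in> I \<Longrightarrow> Y k \<in> borel_measurable N"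
  shows "sets (generated_algebra M I Y) \<subseteq> sets N"
proof -
  have "(\<lambda>\<omega>. \<lambda>k\<in>I. Y k \<omega>) \<in> measurable N (PiM I (\<lambda>_. borel))"
    by (intro measurable_restrict assms)
  from measurable_sets[OF this] show ?thesis
    unfolding generated_algebra_def assms(1)[symmetric]
    by (subst sets_vimage_algebra2) (auto simp: space_PiM)
qed

text \<open>Indicators of single variables are attached to the weights one at a time by
  \<open>char_equiv_times_indicator\<close>; the functional 0 in \<open>V\<close> then turns
  equivalence into equality of integrals over finite-dimensional boxes. Boxes determine a finite
  measure on the product, hence on the generated algebra, hence the integral of every nonnegative
  \<open>X\<close>.\<close>

lemma char_equiv_nn_integral_eq:
  fixes M :: "'a measure" and X :: "'a \<Rightarrow> ennreal"
  assumes "finite_measure M"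
    and V: "\<And>L. L \<in> V \<Longrightarrow> L \<in> borel_measurable M"
    and lin: "\<And>L L' a b. L \<in> V \<Longrightarrow> L' \<in> V \<Longrightarrow> (\<lambda>\<omega>. a * L \<omega> + b * L' \<omega>) \<in> V"
    and zero: "(\<lambda>_. 0) \<in> V"
    and W1 [measurable]: "W1 \<in> borel_measurable M" and W1b: "\<And>\<omega>. 0 \<le> W1 \<omega>" "\<And>\<omega>. W1 \<omega> \<le> c"
    and W2 [measurable]: "W2 \<in> borel_measurable M" and W2b: "\<And>\<omega>. 0 \<le> W2 \<omega>" "\<And>\<omega>. W2 \<omega> \<le> c"
    and eq: "char_equiv M V W1 W2"
    and Y: "\<And>k. k \<in> I \<Longrightarrow> Y k \<in> V"
    and X: "X \<in> borel_measurable (generated_algebra M I Y)"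
  shows "(\<integral>\<^sup>+\<omega>. W1 \<omega> * X \<omega> \<partial>M) = (\<integral>\<^sup>+\<omega>. W2 \<omega> * X \<omega> \<partial>M)"
proof -
  interpret finite_measure M by fact
  let ?F = "generated_algebra M I Y" and ?P = "PiM I (\<lambda>_. borel :: real measure)"
  define Z where "Z = (\<lambda>\<omega>. \<lambda>k\<in>I. Y k \<omega>)"
  note YM = V[OF Y]
  have Z [measurable]: "Z \<in> measurable M ?P"
    unfolding Z_def by (intro measurable_restrict YM)
  have sub: "sets ?F \<subseteq> sets M" by (intro sets_generated_algebra_le YM) auto
  have prod_b: "0 \<le> (\<Prod>k\<in>J. indicator (A k) (Y k \<omega>) :: real)" "(\<Prod>k\<in>J. indicator (A k) (Y k \<omega>) :: real) \<le> 1" for J A \<omega>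
    by (auto intro!: prod_nonneg prod_le_1 simp: indicator_def)
  have prod_m: "(\<lambda>\<omega>. \<Prod>k\<in>J. indicator (A k) (Y k \<omega>) :: real) \<in> borel_measurable M"
    if "J \<subseteq> I" "\<And>k. k \<in> J \<Longrightarrow> A k \<in> sets borel" for J A
    using that YM by (intro borel_measurable_prod) (auto intro!: measurable_compose[OF _ borel_measurable_indicator])
  have bd: "0 \<le> W \<omega> * (\<Prod>k\<in>J. indicator (A k) (Y k \<omega>))" "W \<omega> * (\<Prod>k\<in>J. indicator (A k) (Y k \<omega>)) \<le> c"
    if "\<And>\<omega>. 0 \<le> W \<omega>" "\<And>\<omega>. W \<omega> \<le> c" for W J A \<omega>
    using that[of \<omega>] prod_b[of A \<omega> J] by (auto intro: order_trans[OF mult_left_le])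
  have equiv: "char_equiv M V (\<lambda>\<omega>. W1 \<omega> * (\<Prod>k\<in>J. indicator (A k) (Y k \<omega>)))
      (\<lambda>\<omega>. W2 \<omega> * (\<Prod>k\<in>J. indicator (A k) (Y k \<omega>)))"
    if "finite J" "J \<subseteq> I" "\<And>k. k \<in> J \<Longrightarrow> A k \<in> sets borel" for J A
    using that
  proof (induction J rule: finite_induct)
    case empty
    then show ?case using eq by simp
  next
    case (insert j J)
    have "char_equiv M V (\<lambda>\<omega>. W1 \<omega> * (\<Prod>k\<in>J. indicator (A k) (Y k \<omega>)) * indicator (A j) (Y j \<omega>))
      (\<lambda>\<omega>. W2 \<omega> * (\<Prod>k\<in>J. indicator (A k) (Y k \<omega>)) * indicator (A j) (Y j \<omega>))"
      using insert W1b W2b by (intro char_equiv_times_indicator[where c=c] assms bd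
          borel_measurable_times prod_m) auto
    then show ?case using insert by (simp add: mult_ac)
  qed
  define N where "N W = distr (density M (\<lambda>\<omega>. ennreal (W \<omega>))) ?P Z" for W
  have fin: "finite_measure (N W)"
    and box: "emeasure (N W) (prod_emb I (\<lambda>_. borel) J (Pi\<^sub>E J A))
      = ennreal (\<integral>\<omega>. W \<omega> * (\<Prod>k\<in>J. indicator (A k) (Y k \<omega>)) \<partial>M)"
    if [measurable]: "W \<in> borel_measurable M" and b: "\<And>\<omega>. 0 \<le> W \<omega>" "\<And>\<omega>. W \<omega> \<le> c"
      and J: "finite J" "J \<subseteq> I" "\<And>k. k \<in> J \<Longrightarrow> A k \<in> sets borel" for W J A
  proof -
    have "(\<integral>\<^sup>+\<omega>. ennreal (W \<omega>) \<partial>M) \<le> (\<integral>\<^sup>+\<omega>. ennreal c \<partial>M)"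
      using b by (intro nn_integral_mono ennreal_leI) auto
    also have "\<dots> < \<infinity>" by (simp add: ennreal_mult_eq_top_iff less_top[symmetric])
    finally have f: "finite_measure (density M (\<lambda>\<omega>. ennreal (W \<omega>)))"
      by (intro finite_measureI) (simp add: emeasure_density cong: nn_integral_cong)
    show "finite_measure (N W)"
      unfolding N_def by (rule finite_measure.finite_measure_distr[OF f]) simp
    have [measurable]: "prod_emb I (\<lambda>_. borel) J (Pi\<^sub>E J A) \<in> sets ?P"
      using J by (intro sets_PiM_I) auto
    have "emeasure (N W) (prod_emb I (\<lambda>_. borel) J (Pi\<^sub>E J A))
       = emeasure (density M (\<lambda>\<omega>. ennreal (W \<omega>))) (Z -` prod_emb I (\<lambda>_. borel) J (Pi\<^sub>E J A) \<inter> space M)"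
      unfolding N_def by (subst emeasure_distr) auto
    also have "\<dots> = (\<integral>\<^sup>+\<omega>. ennreal (W \<omega>) * indicator (Z -` prod_emb I (\<lambda>_. borel) J (Pi\<^sub>E J A) \<inter> space M) \<omega> \<partial>M)"
      by (rule emeasure_density) measurable
    also have "\<dots> = (\<integral>\<^sup>+\<omega>. ennreal (W \<omega> * (\<Prod>k\<in>J. indicator (A k) (Y k \<omega>))) \<partial>M)"
    proof (rule nn_integral_cong)
      fix \<omega> assume \<omega>: "\<omega> \<in> space M"
      have "Z \<omega> \<in> prod_emb I (\<lambda>_. borel) J (Pi\<^sub>E J A) \<longleftrightarrow> (\<forall>k\<in>J. Y k \<omega> \<in> A k)"
        using J by (auto simp: prod_emb_def Z_def PiE_iff subset_eq)
      moreover have "(\<Prod>k\<in>J. indicator (A k) (Y k \<omega>) :: real) = (if \<forall>k\<in>J. Y k \<omega> \<in> A k then 1 else 0)"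
        using J by (auto simp: indicator_def)
      ultimately show "ennreal (W \<omega>) * indicator (Z -` prod_emb I (\<lambda>_. borel) J (Pi\<^sub>E J A) \<inter> space M) \<omega>
          = ennreal (W \<omega> * (\<Prod>k\<in>J. indicator (A k) (Y k \<omega>)))"
        using \<omega> by (auto simp: indicator_def)
    qed
    also have "\<dots> = ennreal (\<integral>\<omega>. W \<omega> * (\<Prod>k\<in>J. indicator (A k) (Y k \<omega>)) \<partial>M)"
      using J bd[of W] b prod_m[of J A]
      by (intro nn_integral_eq_integral integrable_const_bound[where B=c]) auto
    finally show "emeasure (N W) (prod_emb I (\<lambda>_. borel) J (Pi\<^sub>E J A))
      = ennreal (\<integral>\<omega>. W \<omega> * (\<Prod>k\<in>J. indicator (A k) (Y k \<omega>)) \<partial>M)" .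
  qed
  have NN: "N W1 = N W2"
  proof (rule measure_eqI_PiM_infinite)
    fix A J assume J: "finite J" "J \<subseteq> I" "\<And>k. k \<in> J \<Longrightarrow> A k \<in> sets (borel :: real measure)"
    have "complex_of_real (\<integral>\<omega>. W1 \<omega> * (\<Prod>k\<in>J. indicator (A k) (Y k \<omega>)) \<partial>M)
        = complex_of_real (\<integral>\<omega>. W2 \<omega> * (\<Prod>k\<in>J. indicator (A k) (Y k \<omega>)) \<partial>M)"
      using equiv[OF J] zero unfolding char_equiv_def
      by (subst (1 2) integral_complex_of_real[symmetric]) force
    then show "emeasure (N W1) (prod_emb I (\<lambda>_. borel) J (Pi\<^sub>E J A)) =
        emeasure (N W2) (prod_emb I (\<lambda>_. borel) J (Pi\<^sub>E J A))"
      using box[OF W1 W1b J] box[OF W2 W2b J] by simp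
  next
    show "finite_measure (N W1)" using fin[of W1 "{}"] W1b by auto
  qed (auto simp: N_def)
  have em: "emeasure (density M (\<lambda>\<omega>. ennreal (W1 \<omega>))) A = emeasure (density M (\<lambda>\<omega>. ennreal (W2 \<omega>))) A"
    if A: "A \<in> sets ?F" for A
  proof -
    obtain A' where A': "A = Z -` A' \<inter> space M" "A' \<in> sets ?P"
      using A unfolding generated_algebra_def Z_def
      by (subst (asm) sets_vimage_algebra2) (auto simp: space_PiM)
    then show ?thesis
      using arg_cong[OF NN, of "\<lambda>N. emeasure N A'"] unfolding N_def by (simp add: emeasure_distr)
  qed
  \<comment> \<open>The two weighted measures are known to agree only on \<open>?F\<close>.
    Restricted to this subalgebra they are equal as measures, and integrals of \<open>X\<close>
    survive the restriction.\<close>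
  have red: "(\<integral>\<^sup>+\<omega>. W \<omega> * X \<omega> \<partial>M) = (\<integral>\<^sup>+\<omega>. X \<omega> \<partial>restr_to_subalg (density M (\<lambda>\<omega>. ennreal (W \<omega>))) ?F)"
    if [measurable]: "W \<in> borel_measurable M" for W
  proof -
    have s: "subalgebra (density M (\<lambda>\<omega>. ennreal (W \<omega>))) ?F" using sub by (simp add: subalgebra_def)
    have "X \<in> borel_measurable M"
      using X sub measurable_mono[of borel borel ?F M] by auto
    then have "(\<integral>\<^sup>+\<omega>. W \<omega> * X \<omega> \<partial>M) = (\<integral>\<^sup>+\<omega>. X \<omega> \<partial>density M (\<lambda>\<omega>. ennreal (W \<omega>)))"
      by (simp add: nn_integral_density)
    also have "\<dots> = (\<integral>\<^sup>+\<omega>. X \<omega> \<partial>restr_to_subalg (density M (\<lambda>\<omega>. ennreal (W \<omega>))) ?F)"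
      by (rule nn_integral_subalgebra2[OF s X, symmetric])
    finally show ?thesis .
  qed
  have "restr_to_subalg (density M (\<lambda>\<omega>. ennreal (W1 \<omega>))) ?F = restr_to_subalg (density M (\<lambda>\<omega>. ennreal (W2 \<omega>))) ?F"
  proof (rule measure_eqI)
    have s: "subalgebra (density M f) ?F" for f using sub by (simp add: subalgebra_def)
    show "sets (restr_to_subalg (density M (\<lambda>\<omega>. ennreal (W1 \<omega>))) ?F)
        = sets (restr_to_subalg (density M (\<lambda>\<omega>. ennreal (W2 \<omega>))) ?F)"
      by (simp add: sets_restr_to_subalg[OF s])
    show "emeasure (restr_to_subalg (density M (\<lambda>\<omega>. ennreal (W1 \<omega>))) ?F) A
        = emeasure (restr_to_subalg (density M (\<lambda>\<omega>. ennreal (W2 \<omega>))) ?F) A"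
      if "A \<in> sets (restr_to_subalg (density M (\<lambda>\<omega>. ennreal (W1 \<omega>))) ?F)" for A
      using that em by (simp add: sets_restr_to_subalg[OF s] emeasure_restr_to_subalg[OF s])
  qed
  then show ?thesis using red by simp
qed

section \<open>Conditioning heat kernels on the past\<close>

text \<open>Rescaling \<xi> by \<open>sqrt e\<close> reduces the integral to the characteristic
  function of the standard normal law. Read from right to left, it writes a normal density as a
  superposition of \<open>iexp\<close>.\<close>

lemma Fourier_gaussian:
  assumes e: "0 < e"
  shows "(CLINT \<xi>|lborel. of_real (exp (- e * \<xi>\<^sup>2 / 2)) * iexp (\<xi> * x)) = of_real (2 * pi * normal_density 0 (sqrt e) x)"
proof -
  have s: "sqrt e > 0" using e by simp
  have "(CLINT \<xi>|lborel. of_real (exp (- e * \<xi>\<^sup>2 / 2)) * iexp (\<xi> * x))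
      = \<bar>1 / sqrt e\<bar> *\<^sub>R (CLINT y|lborel. of_real (exp (- e * (0 + (1 / sqrt e) * y)\<^sup>2 / 2)) * iexp ((0 + (1 / sqrt e) * y) * x))"
    using s by (intro lborel_integral_real_affine) simp
  also have "(CLINT y|lborel. of_real (exp (- e * (0 + (1 / sqrt e) * y)\<^sup>2 / 2)) * iexp ((0 + (1 / sqrt e) * y) * x))
     = (CLINT y|lborel. of_real (sqrt (2 * pi)) * (std_normal_density y *\<^sub>R iexp ((x / sqrt e) * y)))"
    using e by (intro Bochner_Integration.integral_cong)
      (auto simp: std_normal_density_def scaleR_conv_of_real power_mult_distrib power_divide mult_ac)
  also have "\<dots> = of_real (sqrt (2 * pi)) * (CLINT y|lborel. std_normal_density y *\<^sub>R iexp ((x / sqrt e) * y))"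
    by (rule integral_mult_right_zero)
  also have "(CLINT y|lborel. std_normal_density y *\<^sub>R iexp ((x / sqrt e) * y)) = char std_normal_distribution (x / sqrt e)"
    unfolding char_def by (subst integral_density) auto
  also have "\<dots> = of_real (exp (- x\<^sup>2 / (2 * e)))"
    using e by (simp add: char_std_normal_distribution power_divide)
  finally have "(CLINT \<xi>|lborel. of_real (exp (- e * \<xi>\<^sup>2 / 2)) * iexp (\<xi> * x))
     = of_real (sqrt (2 * pi) / sqrt e * exp (- x\<^sup>2 / (2 * e)))"
    using s by (simp add: scaleR_conv_of_real)
  also have "sqrt (2 * pi) / sqrt e * exp (- x\<^sup>2 / (2 * e)) = 2 * pi * normal_density 0 (sqrt e) x"
    using e real_sqrt_mult_self[of "2 * pi"] by (simp add: normal_density_def real_sqrt_mult field_simps)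
  finally show ?thesis .
qed

lemma integrable_gaussian: "0 < e \<Longrightarrow> integrable lborel (\<lambda>\<xi>::real. exp (- e * \<xi>\<^sup>2 / 2))"
proof -
  assume e: "0 < e"
  have "integrable lborel (\<lambda>x. sqrt (2 * pi / e) * normal_density 0 (sqrt (1 / e)) x)"
    using e by (intro integrable_mult_right integrable_normal_density) simp
  also have "(\<lambda>x. sqrt (2 * pi / e) * normal_density 0 (sqrt (1 / e)) x) = (\<lambda>\<xi>. exp (- e * \<xi>\<^sup>2 / 2))"
    using e by (auto simp: normal_density_def real_sqrt_divide field_simps)
  finally show ?thesis .
qed

lemma char_centered_normal:
  assumes "0 \<le> v"
  shows "(CLINT x|centered_normal v. iexp x) = of_real (exp (- v / 2))"
proof (cases "v = 0")
  case True
  then show ?thesis by (simp add: centered_normal_def integral_return)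
next
  case False
  then have v: "v > 0" using assms by simp
  have "(CLINT x|centered_normal v. iexp x) = (CLINT x|lborel. normal_density 0 (sqrt v) x *\<^sub>R iexp x)"
    using False by (simp add: centered_normal_def integral_density)
  \<comment> \<open>Prepares \<open>Fourier_gaussian\<close> with parameter \<open>1 / v\<close>,
    evaluated at the point 1.\<close>
  also have "\<dots> = (CLINT x|lborel. of_real (1 / sqrt (2 * pi * v)) * (of_real (exp (- (1 / v) * x\<^sup>2 / 2)) * iexp (x * 1)))"
    using v by (intro Bochner_Integration.integral_cong)
      (auto simp: normal_density_def scaleR_conv_of_real)
  also have "\<dots> = of_real (1 / sqrt (2 * pi * v)) * of_real (2 * pi * normal_density 0 (sqrt (1 / v)) 1)"
    using v by (simp only: integral_mult_right_zero Fourier_gaussian zero_less_divide_1_iff)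
  also have "\<dots> = of_real (1 / sqrt (2 * pi * v) * (2 * pi * normal_density 0 (sqrt (1 / v)) 1))"
    by (simp only: of_real_mult)
  also have "1 / sqrt (2 * pi * v) * (2 * pi * normal_density 0 (sqrt (1 / v)) 1) = exp (- v / 2)"
    using v real_sqrt_mult_self[of "2 * pi"]
    by (simp add: normal_density_def real_sqrt_mult real_sqrt_divide field_simps)
  finally show ?thesis .
qed

text \<open>Fourier inversion under the expectation; Fubini applies because \<open>W\<close> is
  bounded and the Gaussian in \<xi> is integrable. The density of \<open>X\<close> reappears as an
  extra summand \<open>\<xi> * X\<close> in the exponent, which an induction over coordinates can
  absorb.\<close>

lemma integral_normal_density_weight:
  fixes M :: "'a measure" and W X L :: "'a \<Rightarrow> real"
  assumes "prob_space M" and e: "0 < e"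
    and [measurable]: "W \<in> borel_measurable M" "X \<in> borel_measurable M" "L \<in> borel_measurable M"
    and b: "\<And>\<omega>. 0 \<le> W \<omega>" "\<And>\<omega>. W \<omega> \<le> c"
  shows "(CLINT \<omega>|M. of_real (W \<omega> * normal_density 0 (sqrt e) (X \<omega>)) * iexp (L \<omega>)) =
    (1 / (2 * pi)) * (CLINT \<xi>|lborel. of_real (exp (- e * \<xi>\<^sup>2 / 2)) * (CLINT \<omega>|M. of_real (W \<omega>) * iexp (\<xi> * X \<omega> + L \<omega>)))"
proof -
  interpret prob_space M by fact
  interpret P: pair_sigma_finite lborel M ..
  define f where "f = (\<lambda>(\<xi>, \<omega>). complex_of_real (exp (- e * \<xi>\<^sup>2 / 2)) * (of_real (W \<omega>) * iexp (\<xi> * X \<omega> + L \<omega>)))"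
  have [measurable]: "f \<in> borel_measurable (lborel \<Otimes>\<^sub>M M)" unfolding f_def by measurable
  have nf: "norm (f (\<xi>, \<omega>)) = exp (- e * \<xi>\<^sup>2 / 2) * W \<omega>" for \<xi> \<omega>
    using b by (simp add: f_def norm_mult)
  have W: "integrable M W" using b by (intro integrable_const_bound[where B=c]) auto
  have "integrable (lborel \<Otimes>\<^sub>M M) f"
  proof (rule P.Fubini_integrable)
    show "integrable lborel (\<lambda>\<xi>. LINT \<omega>|M. norm (f (\<xi>, \<omega>)))"
      unfolding nf using integrable_gaussian[OF e] by simp
    show "AE \<xi> in lborel. integrable M (\<lambda>\<omega>. f (\<xi>, \<omega>))"
    proof (rule AE_I2)
      fix \<xi> :: real
      show "integrable M (\<lambda>\<omega>. f (\<xi>, \<omega>))"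
        by (rule Bochner_Integration.integrable_bound[where f="\<lambda>\<omega>. exp (- e * \<xi>\<^sup>2 / 2) * W \<omega>"])
          (use W b in \<open>auto simp: nf\<close>)
    qed
  qed simp
  then have F: "(CLINT \<omega>|M. CLINT \<xi>|lborel. f (\<xi>, \<omega>)) = (CLINT \<xi>|lborel. CLINT \<omega>|M. f (\<xi>, \<omega>))"
    by (intro P.Fubini_integral) (simp add: case_prod_beta')
  have "(CLINT \<xi>|lborel. f (\<xi>, \<omega>)) = of_real (W \<omega>) * iexp (L \<omega>) * (CLINT \<xi>|lborel. of_real (exp (- e * \<xi>\<^sup>2 / 2)) * iexp (\<xi> * X \<omega>))" for \<omega>
    by (subst integral_mult_right_zero[symmetric])
      (auto simp: f_def exp_add algebra_simps intro!: Bochner_Integration.integral_cong)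
  then have 1: "(CLINT \<xi>|lborel. f (\<xi>, \<omega>)) = of_real (2 * pi) * (of_real (W \<omega> * normal_density 0 (sqrt e) (X \<omega>)) * iexp (L \<omega>))" for \<omega>
    using Fourier_gaussian[OF e] by simp
  have 2: "(CLINT \<omega>|M. f (\<xi>, \<omega>)) = of_real (exp (- e * \<xi>\<^sup>2 / 2)) * (CLINT \<omega>|M. of_real (W \<omega>) * iexp (\<xi> * X \<omega> + L \<omega>))" for \<xi>
    unfolding f_def by simp
  show ?thesis using F unfolding 1 2 by (simp add: field_simps)
qed

section \<open>Positivity of the sheet covariance and laws of linear combinations\<close>

text \<open>The white noise picture: \<open>min s u * min t v\<close> is the L2 inner product of the
  indicators of two rectangles with a corner at the origin.\<close>

lemma integral_indicator_Icc_times: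
  fixes s t u v :: real
  assumes "0 \<le> s" "0 \<le> t" "0 \<le> u" "0 \<le> v"
  shows "integrable lborel (\<lambda>z::real \<times> real. indicator ({0..s} \<times> {0..t}) z * indicator ({0..u} \<times> {0..v}) z :: real)"
    and "(\<integral>z. indicator ({0..s} \<times> {0..t}) z * indicator ({0..u} \<times> {0..v}) z \<partial>lborel) = min s u * min t v"
proof -
  have eq: "(\<lambda>z::real \<times> real. indicator ({0..s} \<times> {0..t}) z * indicator ({0..u} \<times> {0..v}) z :: real)
      = indicator ({0..min s u} \<times> {0..min t v})"
    by (auto simp: indicator_def fun_eq_iff)
  have em: "emeasure lborel ({0..min s u} \<times> {0..min t v}) = ennreal (min s u * min t v)"
    using assms unfolding lborel_prod[symmetric]
    by (subst lborel.emeasure_pair_measure_Times) (auto simp: ennreal_mult)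
  have [simp]: "{0..min s u} \<times> {0..min t v} \<in> sets borel"
    by (intro borel_closed closed_Times) auto
  show "integrable lborel (\<lambda>z::real \<times> real. indicator ({0..s} \<times> {0..t}) z * indicator ({0..u} \<times> {0..v}) z :: real)"
    unfolding eq by (rule integrable_real_indicator) (auto simp: em)
  show "(\<integral>z. indicator ({0..s} \<times> {0..t}) z * indicator ({0..u} \<times> {0..v}) z \<partial>lborel) = min s u * min t v"
    unfolding eq using assms by (simp add: measure_def em)
qed

definition sheet_var :: "((real \<times> real \<times> 'd) \<times> real) list \<Rightarrow> real" where
  "sheet_var ps = (\<Sum>(p, c) \<leftarrow> ps. \<Sum>(q, c') \<leftarrow> ps. c * c' * sheet_cov p q)"

definition lin_comb :: "(real \<Rightarrow> real \<Rightarrow> 'a \<Rightarrow> real ^ 'd::finite) \<Rightarrow> ((real \<times> real \<times> 'd) \<times> real) list \<Rightarrow> 'a \<Rightarrow> real" where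
  "lin_comb B ps \<omega> = (\<Sum>((s, t, i), c) \<leftarrow> ps. c * (B s t \<omega> $ i))"

lemma sheet_cov_commute: "sheet_cov p q = sheet_cov q p"
  by (cases p; cases q) (auto simp: sheet_cov_def min.commute)

lemma sum_list_prod_mult:
  "(\<Sum>x\<leftarrow>xs. f x) * (\<Sum>y\<leftarrow>ys. g y) = (\<Sum>x\<leftarrow>xs. \<Sum>y\<leftarrow>ys. f x * g y :: real)"
  by (induction xs) (auto simp: algebra_simps sum_list_const_mult)

lemma has_bochner_integral_sum_list:
  fixes f :: "'k \<Rightarrow> 'a \<Rightarrow> real"
  assumes "\<And>x. x \<in> set xs \<Longrightarrow> has_bochner_integral M (f x) (I x)"
  shows "has_bochner_integral M (\<lambda>z. \<Sum>x\<leftarrow>xs. f x z) (\<Sum>x\<leftarrow>xs. I x)"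
  using assms by (induction xs) (auto intro: has_bochner_integral_add)

text \<open>Coordinate by coordinate, the quadratic form is the squared L2 norm of a combination of
  rectangle indicators. The sign is what \<open>char_centered_normal\<close> asks for.\<close>

lemma sheet_var_nonneg:
  fixes ps :: "((real \<times> real \<times> 'd::finite) \<times> real) list"
  assumes "\<forall>((s, t, i), c) \<in> set ps. s \<ge> 0 \<and> t \<ge> 0"
  shows "0 \<le> sheet_var ps"
proof -
  define \<phi> where "\<phi> i x z = (case x of ((s, t, k), c) \<Rightarrow>
     c * indicator ({0..s} \<times> {0..t}) z * (if k = i then 1 else 0 :: real))"
    for i :: 'd and x and z :: "real \<times> real"
  define I where "I i x y = (case x of (((s, t, k), c)) \<Rightarrow> case y of ((u, v, k'), c') \<Rightarrow>
     c * c' * (min s u * min t v) * ((if k = i then 1 else 0) * (if k' = i then 1 else 0 :: real)))"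
    for i :: 'd and x y :: "(real \<times> real \<times> 'd) \<times> real"
  have "has_bochner_integral lborel (\<lambda>z. \<phi> i x z * \<phi> i y z) (I i x y)" if "x \<in> set ps" "y \<in> set ps" for i x y
  proof -
    obtain s t k c where x: "x = ((s, t, k), c)" by (metis surj_pair)
    obtain u v k' c' where y: "y = ((u, v, k'), c')" by (metis surj_pair)
    have pos: "0 \<le> s" "0 \<le> t" "0 \<le> u" "0 \<le> v" using that assms unfolding x y by auto
    have "has_bochner_integral lborel (\<lambda>z. (c * c' * ((if k = i then 1 else 0) * (if k' = i then 1 else 0))) *
        (indicator ({0..s} \<times> {0..t}) z * indicator ({0..u} \<times> {0..v}) z :: real))
      ((c * c' * ((if k = i then 1 else 0) * (if k' = i then 1 else 0))) * (min s u * min t v))"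
      using integral_indicator_Icc_times[OF pos]
      by (intro has_bochner_integral_mult_right) (simp add: has_bochner_integral_iff)
    then show ?thesis by (simp add: \<phi>_def I_def x y mult_ac cong: if_cong)
  qed
  then have hb: "has_bochner_integral lborel (\<lambda>z. (\<Sum>x\<leftarrow>ps. \<phi> i x z) * (\<Sum>x\<leftarrow>ps. \<phi> i x z)) (\<Sum>x\<leftarrow>ps. \<Sum>y\<leftarrow>ps. I i x y)" for i
    unfolding sum_list_prod_mult by (intro has_bochner_integral_sum_list) auto
  have nn: "0 \<le> (\<Sum>x\<leftarrow>ps. \<Sum>y\<leftarrow>ps. I i x y)" for i
    using has_bochner_integral_integral_eq[OF hb[of i], symmetric] by (simp add: integral_nonneg_AE)
  have "(\<Sum>i\<in>UNIV. I i x y) = snd x * snd y * sheet_cov (fst x) (fst y)" for x y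
  proof -
    obtain s t k c where x: "x = ((s, t, k), c)" by (metis surj_pair)
    obtain u v k' c' where y: "y = ((u, v, k'), c')" by (metis surj_pair)
    have "(\<Sum>i\<in>UNIV. I i x y) = c * c' * (min s u * min t v) * (\<Sum>i\<in>UNIV. if k = i then (if k' = i then 1 else 0) else 0)"
      unfolding sum_distrib_left by (intro sum.cong) (auto simp: I_def x y)
    also have "(\<Sum>i\<in>UNIV. if k = i then (if k' = i then 1 else 0 :: real) else 0) = (if k = k' then 1 else 0)"
      by (subst sum.delta') auto
    finally show ?thesis by (simp add: x y sheet_cov_def)
  qed
  then have "sheet_var ps = (\<Sum>x\<leftarrow>ps. \<Sum>y\<leftarrow>ps. \<Sum>i\<in>UNIV. I i x y)"
    by (simp add: sheet_var_def case_prod_beta')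
  also have "\<dots> = (\<Sum>i\<in>UNIV. \<Sum>x\<leftarrow>ps. \<Sum>y\<leftarrow>ps. I i x y)"
  proof -
    have sw: "(\<Sum>x\<leftarrow>xs. \<Sum>i\<in>UNIV. f i x) = (\<Sum>i\<in>UNIV. \<Sum>x\<leftarrow>xs. f i x :: real)" for f :: "'d \<Rightarrow> _ \<Rightarrow> real" and xs :: "((real \<times> real \<times> 'd) \<times> real) list"
      by (induction xs) (auto simp: sum.distrib)
    show ?thesis by (simp add: sw)
  qed
  finally show ?thesis using nn by (simp add: sum_nonneg)
qed

lemma lin_comb_Cons: "lin_comb B (((s, t, i), c) # ps) \<omega> = c * (B s t \<omega> $ i) + lin_comb B ps \<omega>"
  by (simp add: lin_comb_def)

lemma lin_comb_append: "lin_comb B (ps @ qs) \<omega> = lin_comb B ps \<omega> + lin_comb B qs \<omega>"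
  by (simp add: lin_comb_def)

lemma lin_comb_scale: "lin_comb B (map (\<lambda>(p, c). (p, a * c)) ps) \<omega> = a * lin_comb B ps \<omega>"
  by (induction ps) (auto simp: lin_comb_def algebra_simps)

lemma sheet_var_Cons:
  "sheet_var ((p, c) # ps) = c\<^sup>2 * sheet_cov p p + 2 * c * (\<Sum>(q, c') \<leftarrow> ps. c' * sheet_cov p q) + sheet_var ps"
proof -
  have "(\<Sum>(q, c') \<leftarrow> ps. c * c' * sheet_cov p q) = c * (\<Sum>(q, c') \<leftarrow> ps. c' * sheet_cov p q)"
    by (subst sum_list_const_mult[symmetric]) (simp add: case_prod_beta' mult_ac)
  moreover have "(\<Sum>(q, c') \<leftarrow> ps. c' * c * sheet_cov q p) = c * (\<Sum>(q, c') \<leftarrow> ps. c' * sheet_cov p q)"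
    by (subst sum_list_const_mult[symmetric]) (simp add: case_prod_beta' mult_ac sheet_cov_commute)
  ultimately show ?thesis
    by (simp add: sheet_var_def case_prod_beta' sum_list_addf power2_eq_square algebra_simps)
qed

locale sheet =
  fixes M :: "'a measure" and B :: "real \<Rightarrow> real \<Rightarrow> 'a \<Rightarrow> real ^ 'd::finite"
  assumes sheet: "brownian_sheet M B"
begin

sublocale prob_space M
  using sheet by (simp add: brownian_sheet_def)

lemma B_measurable: "0 \<le> s \<Longrightarrow> 0 \<le> t \<Longrightarrow> B s t \<in> borel_measurable M"
  using sheet by (simp add: brownian_sheet_def)

lemma B_continuous: "\<omega> \<in> space M \<Longrightarrow> continuous_on ({0..} \<times> {0..}) (\<lambda>p. B (fst p) (snd p) \<omega>)"
  using sheet by (simp add: brownian_sheet_def)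

lemma component_measurable: "0 \<le> s \<Longrightarrow> 0 \<le> t \<Longrightarrow> (\<lambda>\<omega>. B s t \<omega> $ i) \<in> borel_measurable M"
  by (rule measurable_compose[OF B_measurable]) measurable

lemma lin_comb_measurable:
  "\<forall>((s, t, i), c) \<in> set ps. s \<ge> 0 \<and> t \<ge> 0 \<Longrightarrow> lin_comb B ps \<in> borel_measurable M"
proof (induction ps)
  case Nil
  then show ?case by (simp add: lin_comb_def[abs_def])
next
  case (Cons x ps)
  obtain s t i c where x: "x = ((s, t, i), c)" by (metis surj_pair)
  have "(\<lambda>\<omega>. c * (B s t \<omega> $ i) + lin_comb B ps \<omega>) \<in> borel_measurable M"
    using Cons x by (intro borel_measurable_add borel_measurable_times component_measurable) auto
  then show ?case unfolding x lin_comb_Cons[abs_def] .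
qed

lemma char_lin_comb:
  assumes ps: "\<forall>((s, t, i), c) \<in> set ps. s \<ge> 0 \<and> t \<ge> 0"
  shows "(CLINT \<omega>|M. iexp (lin_comb B ps \<omega>)) = of_real (exp (- sheet_var ps / 2))"
proof -
  note [measurable] = lin_comb_measurable[OF ps]
  have "distr M borel (lin_comb B ps) = centered_normal (sheet_var ps)"
    using sheet ps unfolding brownian_sheet_def lin_comb_def[abs_def] sheet_var_def by blast
  then have "(CLINT x|distr M borel (lin_comb B ps). iexp x) = of_real (exp (- sheet_var ps / 2))"
    using char_centered_normal sheet_var_nonneg[OF ps] by simp
  then show ?thesis by (subst (asm) integral_distr) auto
qed

end

section \<open>Gaussian kernels in several dimensions\<close>

text \<open>The product form, rather than an exponential of the norm, allows conditioning one
  coordinate at a time. The first argument is the variance, not the standard deviation.\<close>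

definition heat :: "real \<Rightarrow> real ^ 'd::finite \<Rightarrow> real" where
  "heat e x = (\<Prod>i\<in>UNIV. normal_density 0 (sqrt e) (x $ i))"

lemma norm_vec_square: "(norm x)\<^sup>2 = (\<Sum>i\<in>UNIV. (x $ i)\<^sup>2)" for x :: "real ^ 'd::finite"
  by (simp add: norm_vec_def L2_set_def sum_nonneg)

lemma heat_eq:
  fixes x :: "real ^ 'd::finite"
  assumes "0 < e"
  shows "heat e x = (2 * pi * e) powr (- real CARD('d) / 2) * exp (- (norm x)\<^sup>2 / (2 * e))"
proof -
  have "heat e x = (\<Prod>i\<in>(UNIV::'d set). 1 / sqrt (2 * pi * e)) * (\<Prod>i\<in>UNIV. exp (- (x $ i)\<^sup>2 / (2 * e)))"
    using assms unfolding heat_def prod.distrib[symmetric] by (intro prod.cong) (auto simp: normal_density_def)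
  also have "(\<Prod>i\<in>UNIV. exp (- (x $ i)\<^sup>2 / (2 * e))) = exp (- (norm x)\<^sup>2 / (2 * e))"
    by (simp add: exp_sum[symmetric] norm_vec_square sum_negf sum_divide_distrib)
  also have "(\<Prod>i\<in>(UNIV::'d set). 1 / sqrt (2 * pi * e)) = (2 * pi * e) powr (- real CARD('d) / 2)"
    using assms by (simp add: powr_half_sqrt[symmetric] powr_minus_divide[symmetric] powr_power mult_ac)
  finally show ?thesis .
qed

lemma heat_zero: "0 < e \<Longrightarrow> heat e (0 :: real ^ 'd::finite) = (2 * pi * e) powr (- real CARD('d) / 2)"
  by (simp add: heat_eq)

lemma heat_nonneg: "0 \<le> heat e x"
  unfolding heat_def by (intro prod_nonneg) auto

lemma heat_le_zero: "0 < e \<Longrightarrow> heat e x \<le> heat e (0 :: real ^ 'd)" for x :: "real ^ 'd::finite"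
  by (simp add: heat_eq mult_left_le)

lemma heat_zero_antimono: "0 < e \<Longrightarrow> e \<le> e' \<Longrightarrow> heat e' (0 :: real ^ 'd::finite) \<le> heat e (0 :: real ^ 'd)"
  by (simp add: heat_zero powr_mono2')

lemma heat_measurable [measurable]: "heat e \<in> borel_measurable borel"
  unfolding heat_def[abs_def] by measurable

text \<open>Exponents add, so inverse variances add: 1/a + 1/c = (a + c)/(a c). The normalising
  constants leave the kernel of variance a + c at 0. A product of two kernels at one point of the
  sheet thus reduces to a single kernel.\<close>

lemma heat_times_heat:
  fixes x :: "real ^ 'd::finite"
  assumes "0 < a" "0 < c"
  shows "heat a x * heat c x = heat (a + c) (0 :: real ^ 'd) * heat (a * c / (a + c)) x"
proof -
  have p: "(2 * pi * a) * (2 * pi * c) = (2 * pi * (a + c)) * (2 * pi * (a * c / (a + c)))"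
    using assms by (simp add: field_simps)
  have e: "- (norm x)\<^sup>2 / (2 * a) + - (norm x)\<^sup>2 / (2 * c) = - (norm x)\<^sup>2 / (2 * (a * c / (a + c)))"
    using assms by (simp add: field_simps)
  have 1: "(2 * pi * a) powr r * (2 * pi * c) powr r = (2 * pi * (a + c)) powr r * (2 * pi * (a * c / (a + c))) powr r" for r
  proof -
    have "(2 * pi * a) powr r * (2 * pi * c) powr r = ((2 * pi * a) * (2 * pi * c)) powr r"
      using assms by (intro powr_mult[symmetric])
    also have "\<dots> = (2 * pi * (a + c)) powr r * (2 * pi * (a * c / (a + c))) powr r"
      unfolding p using assms by (intro powr_mult)
    finally show ?thesis .
  qed
  have 2: "exp (- (norm x)\<^sup>2 / (2 * a)) * exp (- (norm x)\<^sup>2 / (2 * c)) = exp (- (norm x)\<^sup>2 / (2 * (a * c / (a + c))))"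
    unfolding exp_add[symmetric] e ..
  have ac: "0 < a + c" "0 < a * c / (a + c)" using assms by auto
  have comb: "a1 * b1 * (a2 * b2) = r1 * (r2 * q)" if "a1 * a2 = r1 * r2" "b1 * b2 = q" for a1 a2 b1 b2 r1 r2 q :: real
    using that by algebra
  show ?thesis
    unfolding heat_eq[OF assms(1)] heat_eq[OF assms(2)] heat_eq[OF ac(2)] heat_zero[OF ac(1)]
    by (rule comb[OF 1 2])
qed

text \<open>Replaces B(u, w) by B(min u s0, w), its conditional expectation given the past up to s0.\<close>

definition down :: "real \<Rightarrow> ((real \<times> real \<times> 'd) \<times> real) list \<Rightarrow> ((real \<times> real \<times> 'd) \<times> real) list" where
  "down s0 ps = map (\<lambda>((u, w, i), c). ((min u s0, w, i), c)) ps"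

lemma down_Cons: "down s0 (((u, w, i), c) # ps) = ((min u s0, w, i), c) # down s0 ps"
  by (simp add: down_def)

lemma down_nonneg:
  assumes "0 \<le> s0" "\<forall>((u, w, i), c) \<in> set ps. 0 \<le> u \<and> 0 \<le> w"
  shows "\<forall>((u, w, i), c) \<in> set (down s0 ps). 0 \<le> u \<and> 0 \<le> w"
  using assms by (fastforce simp: down_def)

context sheet
begin

lemma heat_B_measurable: "0 \<le> s \<Longrightarrow> 0 \<le> t \<Longrightarrow> (\<lambda>\<omega>. heat e (B s t \<omega>)) \<in> borel_measurable M"
  by (rule measurable_compose[OF B_measurable heat_measurable])

text \<open>Induction over the coordinates in \<open>D\<close>. Fourier inversion trades a new
  coordinate \<open>j\<close> for a term \<open>\<xi> * (B s t \<omega> $ j)\<close> of the linear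
  combination, which is why \<open>ps\<close> may contain terms at (s, t) in coordinates outside
  \<open>D\<close>. Moving that term to \<open>s0\<close> costs
  \<open>exp (- (s - s0) * t * \<xi>\<^sup>2 / 2)\<close>, exactly the change of variance from
  \<open>e\<close> to \<open>e + (s - s0) * t\<close>.\<close>

lemma char_heat_factor:
  assumes s: "0 \<le> s0" "s0 \<le> s" "0 \<le> t" and e: "0 < e" and "finite D"
    and "\<forall>((u, w, i), c) \<in> set ps. 0 \<le> u \<and> 0 \<le> w \<and> (u \<le> s0 \<or> (u = s \<and> w = t \<and> i \<notin> D))"
  shows "(CLINT \<omega>|M. of_real (\<Prod>i\<in>D. normal_density 0 (sqrt e) (B s t \<omega> $ i)) * iexp (lin_comb B ps \<omega>)) =
    of_real (exp (- (sheet_var ps - sheet_var (down s0 ps)) / 2)) *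
    (CLINT \<omega>|M. of_real (\<Prod>i\<in>D. normal_density 0 (sqrt (e + (s - s0) * t)) (B s0 t \<omega> $ i)) * iexp (lin_comb B (down s0 ps) \<omega>))"
  using assms(5,6)
proof (induction D arbitrary: ps rule: finite_induct)
  case empty
  have 1: "\<forall>((u, w, i), c) \<in> set ps. 0 \<le> u \<and> 0 \<le> w" using empty by fastforce
  have 2: "\<forall>((u, w, i), c) \<in> set (down s0 ps). 0 \<le> u \<and> 0 \<le> w" by (rule down_nonneg[OF s(1) 1])
  have "exp (- sheet_var ps / 2) = exp (- (sheet_var ps - sheet_var (down s0 ps)) / 2) * exp (- sheet_var (down s0 ps) / 2)"
    unfolding exp_add[symmetric] by (simp add: field_simps)
  then show ?case
    by (simp only: prod.empty of_real_1 mult_1 char_lin_comb[OF 1] char_lin_comb[OF 2] of_real_mult[symmetric])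
next
  case (insert j D)
  let ?v = "(s - s0) * t"
  have v: "0 \<le> ?v" using s by simp
  have ev: "0 < e + ?v" using e v by linarith
  define W where "W e s \<omega> = (\<Prod>i\<in>D. normal_density 0 (sqrt e) (B s t \<omega> $ i))" for e s \<omega>
  have Wm: "W e s \<in> borel_measurable M" if "0 \<le> s" for e s
    unfolding W_def[abs_def] using s that
    by (intro borel_measurable_prod measurable_compose[OF component_measurable]) auto
  have W0: "0 \<le> W e s \<omega>" for e s \<omega> unfolding W_def by (intro prod_nonneg) auto
  have W1: "W e s \<omega> \<le> (\<Prod>i\<in>D. normal_density 0 (sqrt e) 0)" for e s \<omega>
    unfolding W_def by (intro prod_mono) (auto simp: normal_density_def intro!: divide_right_mono)
  have 1: "\<forall>((u, w, i), c) \<in> set ps. 0 \<le> u \<and> 0 \<le> w" using insert.prems by fastforce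
  have 2: "\<forall>((u, w, i), c) \<in> set (down s0 ps). 0 \<le> u \<and> 0 \<le> w" by (rule down_nonneg[OF s(1) 1])
  let ?ps = "\<lambda>\<xi>. ((s, t, j), \<xi>) # ps"
  \<comment> \<open>Cross terms cancel: a term of \<open>ps\<close> either has first parameter at
    most \<open>s0\<close>, and then its covariances with (s, t, j) and (s0, t, j) coincide, or it
    belongs to another coordinate, and then both vanish.\<close>
  have cov: "sheet_var (?ps \<xi>) - sheet_var (down s0 (?ps \<xi>)) = ?v * \<xi>\<^sup>2 + (sheet_var ps - sheet_var (down s0 ps))" for \<xi>
  proof -
    have "(\<Sum>(q, c') \<leftarrow> ps. c' * sheet_cov (s, t, j) q) = (\<Sum>(q, c') \<leftarrow> down s0 ps. c' * sheet_cov (s0, t, j) q)"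
      unfolding down_def map_map
    proof (intro arg_cong[where f=sum_list] map_cong refl)
      fix x assume x: "x \<in> set ps"
      obtain u w i c where [simp]: "x = ((u, w, i), c)" by (metis surj_pair)
      have "u \<le> s0 \<or> (u = s \<and> w = t \<and> i \<noteq> j)" using insert.prems x by fastforce
      then show "(case x of (q, c') \<Rightarrow> c' * sheet_cov (s, t, j) q) =
          ((\<lambda>(q, c'). c' * sheet_cov (s0, t, j) q) \<circ> (\<lambda>((u, w, i), c). ((min u s0, w, i), c))) x"
        using s by (auto simp: sheet_cov_def)
    qed
    then show ?thesis
      using s by (simp add: down_Cons sheet_var_Cons sheet_cov_def algebra_simps)
  qed
  have IH: "(CLINT \<omega>|M. of_real (W e s \<omega>) * iexp (\<xi> * (B s t \<omega> $ j) + lin_comb B ps \<omega>)) =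
     of_real (exp (- (sheet_var ps - sheet_var (down s0 ps)) / 2)) * (of_real (exp (- ?v * \<xi>\<^sup>2 / 2)) *
      (CLINT \<omega>|M. of_real (W (e + ?v) s0 \<omega>) * iexp (\<xi> * (B s0 t \<omega> $ j) + lin_comb B (down s0 ps) \<omega>)))" for \<xi>
  proof -
    have "\<forall>((u, w, i), c)\<in>set (?ps \<xi>). 0 \<le> u \<and> 0 \<le> w \<and> (u \<le> s0 \<or> u = s \<and> w = t \<and> i \<notin> D)"
      using insert.prems insert.hyps s by fastforce
    note IH = insert.IH[OF this]
    have ex: "exp (- (?v * \<xi>\<^sup>2 + (sheet_var ps - sheet_var (down s0 ps))) / 2) =
        exp (- (sheet_var ps - sheet_var (down s0 ps)) / 2) * exp (- ?v * \<xi>\<^sup>2 / 2)"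
      unfolding exp_add[symmetric] by (rule arg_cong[where f=exp]) (simp add: field_simps)
    have m: "min s s0 = s0" using s by simp
    show ?thesis
      using IH[unfolded cov, unfolded down_Cons lin_comb_Cons m ex of_real_mult]
      unfolding W_def by (simp only: mult.assoc)
  qed
  have pr: "(\<Prod>i\<in>insert j D. normal_density 0 (sqrt e) (B s t \<omega> $ i)) = W e s \<omega> * normal_density 0 (sqrt e) (B s t \<omega> $ j)" for e s \<omega>
    unfolding W_def prod.insert[OF insert.hyps] by (rule mult.commute)
  have "(CLINT \<omega>|M. of_real (\<Prod>i\<in>insert j D. normal_density 0 (sqrt e) (B s t \<omega> $ i)) * iexp (lin_comb B ps \<omega>))
     = (CLINT \<omega>|M. of_real (W e s \<omega> * normal_density 0 (sqrt e) (B s t \<omega> $ j)) * iexp (lin_comb B ps \<omega>))"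
    unfolding pr ..
  also have "\<dots> = (1 / (2 * pi)) * (CLINT \<xi>|lborel. of_real (exp (- e * \<xi>\<^sup>2 / 2)) *
       (CLINT \<omega>|M. of_real (W e s \<omega>) * iexp (\<xi> * (B s t \<omega> $ j) + lin_comb B ps \<omega>)))"
    using s by (intro integral_normal_density_weight[OF prob_space_axioms e, where c="\<Prod>i\<in>D. normal_density 0 (sqrt e) 0"] Wm component_measurable lin_comb_measurable 1 W0 W1) auto
  also have "\<dots> = (1 / (2 * pi)) * (CLINT \<xi>|lborel. of_real (exp (- (sheet_var ps - sheet_var (down s0 ps)) / 2)) *
       (of_real (exp (- (e + ?v) * \<xi>\<^sup>2 / 2)) *
       (CLINT \<omega>|M. of_real (W (e + ?v) s0 \<omega>) * iexp (\<xi> * (B s0 t \<omega> $ j) + lin_comb B (down s0 ps) \<omega>))))"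
  proof -
    have x: "complex_of_real (exp (- e * \<xi>\<^sup>2 / 2)) * (a * (of_real (exp (- ?v * \<xi>\<^sup>2 / 2)) * b)) =
       a * (of_real (exp (- (e + ?v) * \<xi>\<^sup>2 / 2)) * b)" for \<xi> a b
    proof -
      have "exp (- (e + ?v) * \<xi>\<^sup>2 / 2) = exp (- e * \<xi>\<^sup>2 / 2) * exp (- ?v * \<xi>\<^sup>2 / 2)"
        unfolding exp_add[symmetric] by (simp add: algebra_simps add_divide_distrib diff_divide_distrib)
      then show ?thesis by (simp only: of_real_mult mult_ac)
    qed
    show ?thesis unfolding IH x ..
  qed
  also have "\<dots> = of_real (exp (- (sheet_var ps - sheet_var (down s0 ps)) / 2)) *
      ((1 / (2 * pi)) * (CLINT \<xi>|lborel. (of_real (exp (- (e + ?v) * \<xi>\<^sup>2 / 2)) *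
       (CLINT \<omega>|M. of_real (W (e + ?v) s0 \<omega>) * iexp (\<xi> * (B s0 t \<omega> $ j) + lin_comb B (down s0 ps) \<omega>)))))"
    unfolding integral_mult_right_zero by (rule mult.left_commute)
  also have "(1 / (2 * pi)) * (CLINT \<xi>|lborel. (of_real (exp (- (e + ?v) * \<xi>\<^sup>2 / 2)) *
       (CLINT \<omega>|M. of_real (W (e + ?v) s0 \<omega>) * iexp (\<xi> * (B s0 t \<omega> $ j) + lin_comb B (down s0 ps) \<omega>))))
     = (CLINT \<omega>|M. of_real (W (e + ?v) s0 \<omega> * normal_density 0 (sqrt (e + ?v)) (B s0 t \<omega> $ j)) * iexp (lin_comb B (down s0 ps) \<omega>))"
    using s by (intro integral_normal_density_weight[OF prob_space_axioms ev, symmetric,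
        where c="\<Prod>i\<in>D. normal_density 0 (sqrt (e + ?v)) 0"] Wm component_measurable lin_comb_measurable 2 W0 W1) auto
  also have "\<dots> = (CLINT \<omega>|M. of_real (\<Prod>i\<in>insert j D. normal_density 0 (sqrt (e + ?v)) (B s0 t \<omega> $ i)) * iexp (lin_comb B (down s0 ps) \<omega>))"
    unfolding pr ..
  finally show ?case .
qed

text \<open>Only the first parameter is bounded; all times \<open>w\<close> are included. The
  filtration in the second parameter is this one, taken for the sheet with exchanged
  arguments.\<close>

definition past :: "real \<Rightarrow> 'a measure" where
  "past s0 = generated_algebra M {(u, w, i). 0 \<le> u \<and> u \<le> s0 \<and> 0 \<le> w} (\<lambda>(u, w, i) \<omega>. B u w \<omega> $ i)"

lemma space_past [simp]: "space (past s0) = space M"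
  by (simp add: past_def)

lemma B_past_measurable:
  assumes "0 \<le> u" "u \<le> s0" "0 \<le> w" shows "B u w \<in> borel_measurable (past s0)"
proof -
  have "(\<lambda>\<omega>. B u w \<omega> $ i) \<in> borel_measurable (past s0)" for i
    using measurable_generated_algebra[of "(u, w, i)" "{(u, w, i). 0 \<le> u \<and> u \<le> s0 \<and> 0 \<le> w}" "\<lambda>(u, w, i) \<omega>. B u w \<omega> $ i" M] assms
    by (simp add: past_def)
  then have "(\<lambda>\<omega>. \<chi> i. B u w \<omega> $ i) \<in> borel_measurable (past s0)"
    by (intro borel_measurable_euclidean_space[THEN iffD2]) (auto simp: Basis_vec_def inner_axis)
  then show ?thesis by simp
qed

lemma sets_past_le:
  assumes "space N = space M" "\<And>u w. 0 \<le> u \<Longrightarrow> u \<le> s0 \<Longrightarrow> 0 \<le> w \<Longrightarrow> B u w \<in> borel_measurable N"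
  shows "sets (past s0) \<subseteq> sets N"
  unfolding past_def
proof (rule sets_generated_algebra_le)
  fix k :: "real \<times> real \<times> 'd" assume k: "k \<in> {(u, w, i). 0 \<le> u \<and> u \<le> s0 \<and> 0 \<le> w}"
  obtain u w i where [simp]: "k = (u, w, i)" by (metis surj_pair)
  have "(\<lambda>\<omega>. B u w \<omega> $ i) \<in> borel_measurable N"
    using k by (intro measurable_compose[OF assms(2)]) auto
  then show "(\<lambda>(u, w, i) \<omega>. B u w \<omega> $ i) k \<in> borel_measurable N" by simp
qed fact

lemma sets_past_subset: "sets (past s0) \<subseteq> sets M"
  by (intro sets_past_le B_measurable) auto

lemma sets_past_mono: "s0 \<le> s1 \<Longrightarrow> sets (past s0) \<subseteq> sets (past s1)"
  by (intro sets_past_le B_past_measurable) auto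

text \<open>Conditionally on the past up to s0, the value at (s, t) is the value at (s0, t) plus an
  independent centred Gaussian of variance (s - s0) t.\<close>

lemma heat_past:
  fixes X :: "'a \<Rightarrow> ennreal"
  assumes s: "0 \<le> s0" "s0 \<le> s" "0 \<le> t" and e: "0 < e"
    and X: "X \<in> borel_measurable (past s0)"
  shows "(\<integral>\<^sup>+\<omega>. heat e (B s t \<omega>) * X \<omega> \<partial>M) = (\<integral>\<^sup>+\<omega>. heat (e + (s - s0) * t) (B s0 t \<omega>) * X \<omega> \<partial>M)"
proof -
  define ok where "ok ps \<longleftrightarrow> (\<forall>((u, w, i), c) \<in> set ps. 0 \<le> u \<and> 0 \<le> w \<and> u \<le> s0)"
    for ps :: "((real \<times> real \<times> 'd) \<times> real) list"
  define V where "V = {lin_comb B ps | ps. ok ps}"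
  have v: "0 < e + (s - s0) * t" using s e by (auto intro: add_pos_nonneg)
  let ?c = "max (heat e (0::real^'d)) (heat (e + (s - s0) * t) (0::real^'d))"
  show ?thesis
  proof (rule char_equiv_nn_integral_eq[where V=V and c="?c"])
    show "finite_measure M" by unfold_locales
    show "L \<in> borel_measurable M" if L: "L \<in> V" for L
    proof -
      obtain ps where ps: "L = lin_comb B ps" "ok ps" using L by (auto simp: V_def)
      show ?thesis unfolding ps(1) by (rule lin_comb_measurable) (use ps(2) in \<open>fastforce simp: ok_def\<close>)
    qed
    show "(\<lambda>\<omega>. a * L \<omega> + b * L' \<omega>) \<in> V" if L: "L \<in> V" "L' \<in> V" for L L' a b
    proof -
      obtain ps qs where p: "L = lin_comb B ps" "ok ps" "L' = lin_comb B qs" "ok qs" using L by (auto simp: V_def)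
      have "(\<lambda>\<omega>. a * L \<omega> + b * L' \<omega>) = lin_comb B (map (\<lambda>(p, c). (p, a * c)) ps @ map (\<lambda>(p, c). (p, b * c)) qs)"
        unfolding p by (simp add: fun_eq_iff lin_comb_append lin_comb_scale)
      moreover have "ok (map (\<lambda>(p, c). (p, a * c)) ps @ map (\<lambda>(p, c). (p, b * c)) qs)"
        using p unfolding ok_def by fastforce
      ultimately show ?thesis unfolding V_def by blast
    qed
    show "(\<lambda>_. 0) \<in> V"
      unfolding V_def by (intro CollectI exI[of _ "[]"]) (auto simp: lin_comb_def ok_def)
    show "(case k of (u, w, i) \<Rightarrow> \<lambda>\<omega>. B u w \<omega> $ i) \<in> V" if k: "k \<in> {(u, w, i). 0 \<le> u \<and> u \<le> s0 \<and> 0 \<le> w}" for k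
    proof -
      obtain u w i where [simp]: "k = (u, w, i)" by (metis surj_pair)
      show ?thesis
        unfolding V_def using k by (intro CollectI exI[of _ "[((u, w, i), 1)]"]) (auto simp: lin_comb_def ok_def)
    qed
    show "X \<in> borel_measurable (generated_algebra M {(u, w, i). 0 \<le> u \<and> u \<le> s0 \<and> 0 \<le> w} (\<lambda>(u, w, i) \<omega>. B u w \<omega> $ i))"
      using X by (simp add: past_def)
    show "char_equiv M V (\<lambda>\<omega>. heat e (B s t \<omega>)) (\<lambda>\<omega>. heat (e + (s - s0) * t) (B s0 t \<omega>))"
      unfolding char_equiv_def
    proof
      fix L assume "L \<in> V"
      then obtain ps where ps: "L = lin_comb B ps" "ok ps" by (auto simp: V_def)
      \<comment> \<open>On combinations of past values \<open>down\<close> is the identity, so the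
        prefactor in \<open>char_heat_factor\<close> is 1 and that lemma becomes equality of the two
        transforms.\<close>
      have d: "down s0 ps = ps"
        unfolding down_def
      proof (rule map_idI)
        fix x assume x: "x \<in> set ps"
        obtain u w i c where [simp]: "x = ((u, w, i), c)" by (metis surj_pair)
        have "u \<le> s0" using x ps(2) by (fastforce simp: ok_def)
        then show "(case x of (p, c) \<Rightarrow> (case p of (u, w, i) \<Rightarrow> \<lambda>c. ((min u s0, w, i), c)) c) = x"
          by simp
      qed
      have p: "\<forall>((u, w, i), c) \<in> set ps. 0 \<le> u \<and> 0 \<le> w \<and> (u \<le> s0 \<or> (u = s \<and> w = t \<and> i \<notin> UNIV))"
        using ps(2) unfolding ok_def by fastforce
      show "(CLINT \<omega>|M. of_real (heat e (B s t \<omega>)) * iexp (L \<omega>)) =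
          (CLINT \<omega>|M. of_real (heat (e + (s - s0) * t) (B s0 t \<omega>)) * iexp (L \<omega>))"
        using char_heat_factor[OF s e finite_class.finite_UNIV p]
        unfolding d ps heat_def diff_self minus_zero div_0 exp_zero of_real_1 mult_1 .
    qed
    show "heat e (B s t \<omega>) \<le> ?c" for \<omega>
      by (rule max.coboundedI1) (rule heat_le_zero[OF e])
    show "heat (e + (s - s0) * t) (B s0 t \<omega>) \<le> ?c" for \<omega>
      by (rule max.coboundedI2) (rule heat_le_zero[OF v])
    show "(\<lambda>\<omega>. heat e (B s t \<omega>)) \<in> borel_measurable M"
      "(\<lambda>\<omega>. heat (e + (s - s0) * t) (B s0 t \<omega>)) \<in> borel_measurable M"
      using s by (intro heat_B_measurable; linarith)+
  qed (rule heat_nonneg)+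
qed

end

section \<open>Measurability and moments\<close>

lemma floor_grid_LIMSEQ: "(\<lambda>n. real_of_int \<lfloor>real (Suc n) * r\<rfloor> / real (Suc n)) \<longlonglongrightarrow> r" for r :: real
proof (rule real_tendsto_sandwich)
  show "\<forall>\<^sub>F n in sequentially. r - 1 / real (Suc n) \<le> \<lfloor>real (Suc n) * r\<rfloor> / real (Suc n)"
  proof (intro always_eventually allI)
    fix n
    have "real (Suc n) * r - 1 \<le> \<lfloor>real (Suc n) * r\<rfloor>" by linarith
    then have "(real (Suc n) * r - 1) / real (Suc n) \<le> \<lfloor>real (Suc n) * r\<rfloor> / real (Suc n)"
      by (rule divide_right_mono) simp
    then show "r - 1 / real (Suc n) \<le> \<lfloor>real (Suc n) * r\<rfloor> / real (Suc n)" by (simp add: diff_divide_distrib)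
  qed
  show "\<forall>\<^sub>F n in sequentially. \<lfloor>real (Suc n) * r\<rfloor> / real (Suc n) \<le> r"
  proof (intro always_eventually allI)
    fix n
    have "\<lfloor>real (Suc n) * r\<rfloor> / real (Suc n) \<le> (real (Suc n) * r) / real (Suc n)"
      by (rule divide_right_mono) (auto simp del: of_nat_Suc)
    then show "\<lfloor>real (Suc n) * r\<rfloor> / real (Suc n) \<le> r" by simp
  qed
  have "(\<lambda>n. r - 1 / real (Suc n)) \<longlonglongrightarrow> r - 0"
    using LIMSEQ_inverse_real_of_nat by (intro tendsto_diff tendsto_const) (simp add: inverse_eq_divide)
  then show "(\<lambda>n. r - 1 / real (Suc n)) \<longlonglongrightarrow> r" by simp
qed simp

text \<open>Rounding p down to a lattice of mesh 1/(n+1) leaves a dependence on countably many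
  lattice points, which is jointly measurable; continuity in p makes the roundings converge.\<close>

lemma borel_measurable_caratheodory:
  fixes f :: "real \<times> real \<Rightarrow> 'a \<Rightarrow> 'b::metric_space"
  assumes m: "\<And>p. f p \<in> borel_measurable N"
    and c: "\<And>\<omega>. \<omega> \<in> space N \<Longrightarrow> continuous_on UNIV (\<lambda>p. f p \<omega>)"
  shows "(\<lambda>(p, \<omega>). f p \<omega>) \<in> borel_measurable (borel \<Otimes>\<^sub>M N)"
proof -
  define \<phi> where "\<phi> n p = (\<lfloor>real n * fst p\<rfloor> / real n, \<lfloor>real n * snd p\<rfloor> / real n)" for n :: nat and p :: "real \<times> real"
  have m\<phi>: "(\<lambda>(p, \<omega>). f (\<phi> (Suc n) p) \<omega>) \<in> borel_measurable (borel \<Otimes>\<^sub>M N)" for n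
  proof -
    define h where "h i x = f (real_of_int (fst i) / real (Suc n), real_of_int (snd i) / real (Suc n)) (snd x)"
      for i :: "int \<times> int" and x :: "(real \<times> real) \<times> 'a"
    define g where "g x = (\<lfloor>real (Suc n) * fst (fst x)\<rfloor>, \<lfloor>real (Suc n) * snd (fst x)\<rfloor>)"
      for x :: "(real \<times> real) \<times> 'a"
    have "(\<lambda>x. h (g x) x) \<in> borel_measurable (borel \<Otimes>\<^sub>M N)"
    proof (rule measurable_compose_countable)
      show "h i \<in> borel_measurable (borel \<Otimes>\<^sub>M N)" for i
        unfolding h_def[abs_def] by (rule measurable_compose[OF measurable_snd m])
      have "(\<lambda>x::(real \<times> real) \<times> 'a. \<lfloor>real (Suc n) * fst (fst x)\<rfloor>) \<in> measurable (borel \<Otimes>\<^sub>M N) (count_space UNIV)"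
        "(\<lambda>x::(real \<times> real) \<times> 'a. \<lfloor>real (Suc n) * snd (fst x)\<rfloor>) \<in> measurable (borel \<Otimes>\<^sub>M N) (count_space UNIV)"
        unfolding borel_prod[symmetric] by measurable
      then show "g \<in> measurable (borel \<Otimes>\<^sub>M N) (count_space UNIV)"
        unfolding g_def[abs_def] by measurable
    qed
    then show ?thesis by (simp add: \<phi>_def g_def h_def case_prod_beta')
  qed
  have lim: "(\<lambda>n. f (\<phi> (Suc n) p) \<omega>) \<longlonglongrightarrow> f p \<omega>" if \<omega>: "\<omega> \<in> space N" for p \<omega>
  proof (rule isCont_tendsto_compose[where g="\<lambda>p. f p \<omega>"])
    show "isCont (\<lambda>p. f p \<omega>) p"
      using c[OF \<omega>] continuous_on_eq_continuous_at[OF open_UNIV] by blast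
    have "(\<lambda>n. \<phi> (Suc n) p) \<longlonglongrightarrow> (fst p, snd p)"
      unfolding \<phi>_def by (intro tendsto_Pair floor_grid_LIMSEQ)
    then show "(\<lambda>n. \<phi> (Suc n) p) \<longlonglongrightarrow> p" by simp
  qed
  show ?thesis
    by (rule borel_measurable_LIMSEQ_metric[OF m\<phi>]) (auto simp: space_pair_measure intro: lim)
qed

text \<open>\<open>sheet_cov\<close> is symmetric in the two parameters. Every result about
  conditioning in s thereby becomes one about conditioning in t.\<close>

lemma brownian_sheet_swap:
  assumes "brownian_sheet M B" shows "brownian_sheet M (\<lambda>s t. B t s)"
proof -
  interpret sheet M B by unfold_locales fact
  have c: "continuous_on ({0..} \<times> {0..}) (\<lambda>p. B (snd p) (fst p) \<omega>)" if "\<omega> \<in> space M" for \<omega>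
  proof -
    have "continuous_on ({0..} \<times> {0..}) ((\<lambda>p. B (fst p) (snd p) \<omega>) \<circ> prod.swap)"
      by (intro continuous_on_compose continuous_on_subset[OF B_continuous[OF that]])
        (auto intro!: continuous_intros simp: prod.swap_def)
    then show ?thesis by (simp add: o_def)
  qed
  have g: "distr M borel (\<lambda>\<omega>. \<Sum>((s, t, i), c) \<leftarrow> ps. c * (B t s \<omega> $ i)) =
        centered_normal (\<Sum>(p, c) \<leftarrow> ps. \<Sum>(q, c') \<leftarrow> ps. c * c' * sheet_cov p q)"
    if ps: "\<forall>((s, t, i), c) \<in> set ps. s \<ge> 0 \<and> t \<ge> 0" for ps
  proof -
    let ?sw = "\<lambda>((s, t, i), c). ((t, s, i), c)"
    have 1: "(\<Sum>((s, t, i), c) \<leftarrow> ps. c * (B t s \<omega> $ i)) = (\<Sum>((s, t, i), c) \<leftarrow> map ?sw ps. c * (B s t \<omega> $ i))" for \<omega>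
      unfolding map_map by (intro arg_cong[where f=sum_list] map_cong) auto
    have 2: "(\<Sum>(p, c) \<leftarrow> ps. \<Sum>(q, c') \<leftarrow> ps. c * c' * sheet_cov p q)
       = (\<Sum>(p, c) \<leftarrow> map ?sw ps. \<Sum>(q, c') \<leftarrow> map ?sw ps. c * c' * sheet_cov p q)"
      unfolding map_map
      by (intro arg_cong[where f=sum_list] map_cong refl) (auto simp: sheet_cov_def o_def mult_ac intro!: arg_cong[where f=sum_list] map_cong)
    have "\<forall>((s, t, i), c) \<in> set (map ?sw ps). s \<ge> 0 \<and> t \<ge> 0" using ps by fastforce
    then show ?thesis
      using sheet unfolding 1 2 brownian_sheet_def by blast
  qed
  show ?thesis
    using c g prob_space_axioms B_measurable unfolding brownian_sheet_def by auto
qed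

context sheet
begin

lemma sheet_swap: "sheet M (\<lambda>s t. B t s)"
  using brownian_sheet_swap[OF sheet] by unfold_locales

text \<open>The variance at \<open>s = 0\<close> is 0, and \<open>centered_normal 0\<close> is the
  point mass at 0. Since only the law is prescribed, the value on the axis is known almost surely
  and not pointwise.\<close>

lemma AE_B_axis_zero: assumes "0 \<le> t" shows "AE \<omega> in M. B 0 t \<omega> = 0"
proof -
  have "AE \<omega> in M. B 0 t \<omega> $ i = 0" for i
  proof -
    let ?ps = "[((0, t, i), 1)] :: ((real \<times> real \<times> 'd) \<times> real) list"
    have [measurable]: "(\<lambda>\<omega>. B 0 t \<omega> $ i) \<in> borel_measurable M" using assms by (intro component_measurable) auto
    have ok: "\<forall>((s, t, i), c) \<in> set ?ps. s \<ge> 0 \<and> t \<ge> 0" using assms by auto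
    have "distr M borel (\<lambda>\<omega>. \<Sum>((s, t, i), c) \<leftarrow> ?ps. c * (B s t \<omega> $ i)) =
        centered_normal (\<Sum>(p, c) \<leftarrow> ?ps. \<Sum>(q, c') \<leftarrow> ?ps. c * c' * sheet_cov p q)"
      using sheet ok unfolding brownian_sheet_def by blast
    then have d: "distr M borel (\<lambda>\<omega>. B 0 t \<omega> $ i) = return borel 0"
      by (simp add: centered_normal_def sheet_cov_def)
    have "AE x in distr M borel (\<lambda>\<omega>. B 0 t \<omega> $ i). x = 0"
      unfolding d by (subst AE_return) auto
    then show ?thesis by (subst (asm) AE_distr_iff) auto
  qed
  then have "AE \<omega> in M. \<forall>i. B 0 t \<omega> $ i = 0" by (subst AE_all_countable) auto
  then show ?thesis by (simp add: vec_eq_iff)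
qed

text \<open>Conditioning all the way down to \<open>s0 = 0\<close> moves the kernel to the axis,
  where the sheet vanishes almost surely; this replaces a Gaussian integral over space.\<close>

lemma nn_expectation_heat:
  assumes "0 \<le> s" "0 \<le> t" "0 < e"
  shows "(\<integral>\<^sup>+\<omega>. heat e (B s t \<omega>) \<partial>M) = heat (e + s * t) (0 :: real ^ 'd)"
proof -
  have "(\<integral>\<^sup>+\<omega>. heat e (B s t \<omega>) \<partial>M) = (\<integral>\<^sup>+\<omega>. heat (e + s * t) (B 0 t \<omega>) \<partial>M)"
    using heat_past[of 0 s t e "\<lambda>_. 1"] assms by simp
  also have "\<dots> = (\<integral>\<^sup>+\<omega>. heat (e + s * t) (0 :: real ^ 'd) \<partial>M)"
    using AE_B_axis_zero[OF assms(2)] by (intro nn_integral_cong_AE) auto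
  also have "\<dots> = heat (e + s * t) (0 :: real ^ 'd)" by (simp add: emeasure_space_1)
  finally show ?thesis .
qed

lemma heat_B_past_measurable:
  "0 \<le> u \<Longrightarrow> u \<le> s0 \<Longrightarrow> 0 \<le> w \<Longrightarrow> (\<lambda>\<omega>. heat e (B u w \<omega>)) \<in> borel_measurable (past s0)"
  by (rule measurable_compose[OF B_past_measurable heat_measurable])

lemma heat_past_swap:
  fixes X :: "'a \<Rightarrow> ennreal"
  assumes "0 \<le> t0" "t0 \<le> t" "0 \<le> s" "0 < e"
    and "X \<in> borel_measurable (sheet.past M (\<lambda>s t. B t s) t0)"
  shows "(\<integral>\<^sup>+\<omega>. heat e (B s t \<omega>) * X \<omega> \<partial>M) = (\<integral>\<^sup>+\<omega>. heat (e + (t - t0) * s) (B s t0 \<omega>) * X \<omega> \<partial>M)"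
  using sheet.heat_past[OF sheet_swap] assms by blast

section \<open>Two-point moments\<close>

text \<open>The product formula leaves one kernel at (s, t), whose expectation is a kernel at 0 of
  variance at least \<open>s * t\<close>; kernels at 0 decrease in the variance.\<close>

lemma heat_pair_same:
  assumes "0 \<le> s" "0 \<le> t" "0 < a" "0 < c" "0 < r" "r \<le> s * t"
  shows "(\<integral>\<^sup>+\<omega>. ennreal (heat a (B s t \<omega>)) * heat c (B s t \<omega>) \<partial>M) \<le> ennreal (heat (a + c) (0 :: real ^ 'd) * heat r (0 :: real ^ 'd))"
proof -
  have ac: "0 < a * c / (a + c)" using assms by auto
  note [measurable] = heat_B_measurable[OF assms(1,2)]
  have "(\<integral>\<^sup>+\<omega>. ennreal (heat a (B s t \<omega>)) * heat c (B s t \<omega>) \<partial>M) =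
      (\<integral>\<^sup>+\<omega>. ennreal (heat (a + c) (0 :: real ^ 'd)) * heat (a * c / (a + c)) (B s t \<omega>) \<partial>M)"
    using assms by (simp add: ennreal_mult'[symmetric] heat_nonneg heat_times_heat)
  also have "\<dots> = heat (a + c) (0 :: real ^ 'd) * ennreal (heat (a * c / (a + c) + s * t) (0 :: real ^ 'd))"
    by (subst nn_integral_cmult) (auto simp: nn_expectation_heat[OF assms(1,2) ac])
  also have "\<dots> \<le> heat (a + c) (0 :: real ^ 'd) * ennreal (heat r (0 :: real ^ 'd))"
  proof -
    have "r \<le> a * c / (a + c) + s * t" using assms ac by linarith
    then show ?thesis using assms by (intro mult_left_mono ennreal_leI heat_zero_antimono) auto
  qed
  finally show ?thesis by (simp add: ennreal_mult' heat_nonneg)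
qed

text \<open>Conditioning moves the point with the larger s to the smaller one, then the point with
  the larger time to the smaller one, until both kernels sit at a common point. Each move adds to a
  variance its lag times the other coordinate, hence at least \<open>a\<close> times the lag;
  \<open>a * a\<close> bounds from below the variance of the sheet at the common point.\<close>

lemma heat_second_moment:
  assumes a: "0 < a" "a \<le> s" "a \<le> t" "a \<le> u" "a \<le> v" and e: "0 < e"
  shows "(\<integral>\<^sup>+\<omega>. ennreal (heat e (B s t \<omega>)) * heat e (B u v \<omega>) \<partial>M)
    \<le> ennreal (heat (2 * e + a * (\<bar>s - u\<bar> + \<bar>t - v\<bar>)) (0 :: real ^ 'd) * heat (a * a) (0 :: real ^ 'd))"
proof -
  have main: "(\<integral>\<^sup>+\<omega>. ennreal (heat e (B u v \<omega>)) * heat e (B s t \<omega>) \<partial>M)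
    \<le> ennreal (heat (2 * e + a * (\<bar>s - u\<bar> + \<bar>t - v\<bar>)) (0 :: real ^ 'd) * heat (a * a) (0 :: real ^ 'd))"
    if a: "0 < a" "a \<le> s" "a \<le> t" "a \<le> u" "a \<le> v" and su: "s \<le> u" for s t u v
  proof -
    have pos: "0 \<le> s" "0 \<le> t" "0 \<le> u" "0 \<le> v" using a by auto
    define e1 where "e1 = e + (u - s) * v"
    have e1: "e1 > 0" "e1 \<ge> e" unfolding e1_def using e su pos by (auto intro!: add_pos_nonneg)
    have bnd: "a * \<bar>s - u\<bar> \<le> (u - s) * v"
      using a su mult_right_mono[of a v "u - s"] by (simp add: mult.commute)
    have "(\<integral>\<^sup>+\<omega>. ennreal (heat e (B u v \<omega>)) * heat e (B s t \<omega>) \<partial>M)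
       = (\<integral>\<^sup>+\<omega>. ennreal (heat e1 (B s v \<omega>)) * heat e (B s t \<omega>) \<partial>M)"
      unfolding e1_def using pos su e
      by (intro heat_past measurable_compose[OF heat_B_past_measurable measurable_ennreal]) auto
    also have "\<dots> \<le> ennreal (heat (2 * e + a * (\<bar>s - u\<bar> + \<bar>t - v\<bar>)) (0 :: real ^ 'd) * heat (a * a) (0 :: real ^ 'd))"
    proof (cases "t \<le> v")
      case True
      define e2 where "e2 = e1 + (v - t) * s"
      have bnd2: "a * \<bar>t - v\<bar> \<le> (v - t) * s"
        using a True mult_right_mono[of a s "v - t"] by (simp add: mult.commute)
      have nn: "0 \<le> (v - t) * s" using True pos by simp
      have e2: "e2 > 0" "e2 + e \<ge> 2 * e + a * (\<bar>s - u\<bar> + \<bar>t - v\<bar>)"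
        unfolding e2_def distrib_left using e1 bnd bnd2 nn e1_def by linarith+
      have "(\<integral>\<^sup>+\<omega>. ennreal (heat e1 (B s v \<omega>)) * heat e (B s t \<omega>) \<partial>M)
          = (\<integral>\<^sup>+\<omega>. ennreal (heat e2 (B s t \<omega>)) * heat e (B s t \<omega>) \<partial>M)"
        unfolding e2_def using pos True e1
        by (intro heat_past_swap measurable_compose[OF sheet.heat_B_past_measurable[OF sheet_swap] measurable_ennreal]) auto
      also have "\<dots> \<le> ennreal (heat (e2 + e) (0 :: real ^ 'd) * heat (a * a) (0 :: real ^ 'd))"
        using pos e2 e a by (intro heat_pair_same mult_mono) auto
      also have "\<dots> \<le> ennreal (heat (2 * e + a * (\<bar>s - u\<bar> + \<bar>t - v\<bar>)) (0 :: real ^ 'd) * heat (a * a) (0 :: real ^ 'd))"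
        using e2 e a by (intro ennreal_leI mult_right_mono heat_zero_antimono heat_nonneg add_pos_nonneg) auto
      finally show ?thesis .
    next
      case False
      define e2 where "e2 = e + (t - v) * s"
      have bnd2: "a * \<bar>t - v\<bar> \<le> (t - v) * s"
        using a False mult_right_mono[of a s "t - v"] by (simp add: mult.commute)
      have nn: "0 \<le> (t - v) * s" using False pos by simp
      have e2: "e2 > 0" "e2 + e1 \<ge> 2 * e + a * (\<bar>s - u\<bar> + \<bar>t - v\<bar>)"
        unfolding e2_def distrib_left using e e1 bnd bnd2 nn e1_def by linarith+
      have "(\<integral>\<^sup>+\<omega>. ennreal (heat e1 (B s v \<omega>)) * heat e (B s t \<omega>) \<partial>M)
          = (\<integral>\<^sup>+\<omega>. ennreal (heat e (B s t \<omega>)) * heat e1 (B s v \<omega>) \<partial>M)"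
        by (simp add: mult.commute)
      also have "\<dots> = (\<integral>\<^sup>+\<omega>. ennreal (heat e2 (B s v \<omega>)) * heat e1 (B s v \<omega>) \<partial>M)"
        unfolding e2_def using pos False e
        by (intro heat_past_swap measurable_compose[OF sheet.heat_B_past_measurable[OF sheet_swap] measurable_ennreal]) auto
      also have "\<dots> \<le> ennreal (heat (e2 + e1) (0 :: real ^ 'd) * heat (a * a) (0 :: real ^ 'd))"
        using pos e2 e1 a by (intro heat_pair_same mult_mono) auto
      also have "\<dots> \<le> ennreal (heat (2 * e + a * (\<bar>s - u\<bar> + \<bar>t - v\<bar>)) (0 :: real ^ 'd) * heat (a * a) (0 :: real ^ 'd))"
        using e2 e a by (intro ennreal_leI mult_right_mono heat_zero_antimono heat_nonneg add_pos_nonneg) auto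
      finally show ?thesis .
    qed
    finally show ?thesis .
  qed
  show ?thesis
  proof (cases "s \<le> u")
    case True
    then show ?thesis using main[of s t u v] a by (simp add: mult.commute)
  next
    case False
    then show ?thesis using main[of u v s t] a by (simp add: abs_minus_commute)
  qed
qed

section \<open>The sheet on the whole plane\<close>

text \<open>Clamping negative arguments to 0 extends the paths continuously to the plane, so joint
  measurability and integrals against plane measures need no restriction to the quadrant.\<close>

definition Bp :: "real \<times> real \<Rightarrow> 'a \<Rightarrow> real ^ 'd" where
  "Bp p \<omega> = B (max 0 (fst p)) (max 0 (snd p)) \<omega>"

lemma Bp_continuous: "\<omega> \<in> space M \<Longrightarrow> continuous_on UNIV (\<lambda>p. Bp p \<omega>)"
proof -
  assume \<omega>: "\<omega> \<in> space M"
  have "continuous_on UNIV ((\<lambda>p. B (fst p) (snd p) \<omega>) \<circ> (\<lambda>p. (max 0 (fst p), max 0 (snd p))))"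
    by (intro continuous_on_compose continuous_on_subset[OF B_continuous[OF \<omega>]])
      (auto intro!: continuous_intros)
  then show ?thesis by (simp add: o_def Bp_def)
qed

lemma Bp_measurable_pair [measurable]: "(\<lambda>(p, \<omega>). Bp p \<omega>) \<in> borel_measurable (borel \<Otimes>\<^sub>M M)"
proof (rule borel_measurable_caratheodory)
  show "Bp p \<in> borel_measurable M" for p
    unfolding Bp_def[abs_def] by (intro B_measurable) auto
qed (rule Bp_continuous)

lemma Bp_past_measurable_pair:
  assumes "0 \<le> s0"
  shows "(\<lambda>(p :: real \<times> real, \<omega>). Bp (s0, snd p) \<omega>) \<in> borel_measurable (borel \<Otimes>\<^sub>M past s0)"
proof (rule borel_measurable_caratheodory)
  show "Bp (s0, snd p) \<in> borel_measurable (past s0)" for p :: "real \<times> real"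
    unfolding Bp_def[abs_def] using assms by (intro B_past_measurable) auto
  fix \<omega> assume "\<omega> \<in> space (past s0)"
  then have \<omega>: "\<omega> \<in> space M" by simp
  have "continuous_on UNIV ((\<lambda>p. Bp p \<omega>) \<circ> (\<lambda>p. (s0, snd p)))"
    by (intro continuous_on_compose continuous_on_subset[OF Bp_continuous[OF \<omega>]])
      (auto intro!: continuous_intros)
  then show "continuous_on UNIV (\<lambda>p::real \<times> real. Bp (s0, snd p) \<omega>)" by (simp add: o_def)
qed

text \<open>A continuous path has a zero on a compact set exactly if its norm gets arbitrarily small
  on a countable dense subset; the converse direction rests on the attained minimum.\<close>

lemma zero_event_measurable:
  assumes K: "compact K"
  shows "{\<omega> \<in> space M. \<exists>p\<in>K. Bp p \<omega> = 0} \<in> sets M"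
proof -
  obtain D where D: "countable D" "D \<subseteq> K" "K \<subseteq> closure D" by (rule separable)
  have Bm [measurable]: "Bp p \<in> borel_measurable M" for p
    unfolding Bp_def[abs_def] by (intro B_measurable) auto
  have "{\<omega> \<in> space M. \<exists>p\<in>K. Bp p \<omega> = 0} = (\<Inter>n. \<Union>p\<in>D. {\<omega> \<in> space M. norm (Bp p \<omega>) < 1 / real (Suc n)})"
  proof (intro equalityI subsetI)
    fix \<omega> assume "\<omega> \<in> {\<omega> \<in> space M. \<exists>p\<in>K. Bp p \<omega> = 0}"
    then obtain p where p: "\<omega> \<in> space M" "p \<in> K" "Bp p \<omega> = 0" by auto
    show "\<omega> \<in> (\<Inter>n. \<Union>p\<in>D. {\<omega> \<in> space M. norm (Bp p \<omega>) < 1 / real (Suc n)})"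
    proof
      fix n
      have c: "continuous (at p) (\<lambda>p. Bp p \<omega>)" using Bp_continuous[OF p(1)] continuous_on_eq_continuous_at[OF open_UNIV] by blast
      then obtain \<delta> where \<delta>: "\<delta> > 0" "\<And>q. dist q p < \<delta> \<Longrightarrow> dist (Bp q \<omega>) (Bp p \<omega>) < 1 / real (Suc n)"
        unfolding continuous_at_eps_delta by (metis divide_pos_pos of_nat_0_less_iff zero_less_Suc zero_less_one)
      obtain q where q: "q \<in> D" "dist q p < \<delta>" using D(3) p(2) \<delta>(1) by (metis closure_approachable subsetD)
      then show "\<omega> \<in> (\<Union>p\<in>D. {\<omega> \<in> space M. norm (Bp p \<omega>) < 1 / real (Suc n)})"
        using \<delta>(2)[OF q(2)] p by auto
    qed
  next
    fix \<omega> assume *: "\<omega> \<in> (\<Inter>n. \<Union>p\<in>D. {\<omega> \<in> space M. norm (Bp p \<omega>) < 1 / real (Suc n)})"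
    then have \<omega>: "\<omega> \<in> space M" by auto
    have "K \<noteq> {}" using * D(2) by auto
    have "continuous_on K (\<lambda>p. norm (Bp p \<omega>))"
      by (intro continuous_intros continuous_on_subset[OF Bp_continuous[OF \<omega>]]) auto
    from continuous_attains_inf[OF K \<open>K \<noteq> {}\<close> this] obtain p where p: "p \<in> K" "\<And>q. q \<in> K \<Longrightarrow> norm (Bp p \<omega>) \<le> norm (Bp q \<omega>)"
      by auto
    have "norm (Bp p \<omega>) < 1 / real (Suc n)" for n
    proof -
      obtain q where "q \<in> D" "norm (Bp q \<omega>) < 1 / real (Suc n)" using * by blast
      then show ?thesis using p(2)[of q] D(2) by auto
    qed
    then have "norm (Bp p \<omega>) \<le> 0"
      by (intro LIMSEQ_le_const[OF LIMSEQ_inverse_real_of_nat]) (auto simp: inverse_eq_divide less_imp_le)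
    then show "\<omega> \<in> {\<omega> \<in> space M. \<exists>p\<in>K. Bp p \<omega> = 0}" using p \<omega> by auto
  qed
  also have "\<dots> \<in> sets M" using D(1) by (intro sets.countable_INT image_subsetI sets.countable_UN'') auto
  finally show ?thesis .
qed

end

section \<open>Maximal inequalities\<close>

primrec running_max :: "(nat \<Rightarrow> 'a \<Rightarrow> real) \<Rightarrow> nat \<Rightarrow> 'a \<Rightarrow> real" where
  "running_max X 0 \<omega> = X 0 \<omega>"
| "running_max X (Suc n) \<omega> = max (running_max X n \<omega>) (X (Suc n) \<omega>)"

lemma running_max_ge: "k \<le> n \<Longrightarrow> X k \<omega> \<le> running_max X n \<omega>"
  by (induction n) (auto simp: le_Suc_eq)

lemma running_max_nonneg: "(\<And>k. 0 \<le> X k \<omega>) \<Longrightarrow> 0 \<le> running_max X n \<omega>"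
  using running_max_ge[of 0 n X \<omega>] by (meson le0 order_trans)

lemma running_max_le: "(\<And>k. X k \<omega> \<le> c) \<Longrightarrow> running_max X n \<omega> \<le> c"
  by (induction n) auto

lemma running_max_measurable:
  "(\<And>k. k \<le> n \<Longrightarrow> X k \<in> borel_measurable N) \<Longrightarrow> running_max X n \<in> borel_measurable N"
proof (induction n)
  case (Suc n)
  have "(\<lambda>\<omega>. max (running_max X n \<omega>) (X (Suc n) \<omega>)) \<in> borel_measurable N"
    using Suc by (intro borel_measurable_max) auto
  then show ?case by (simp add: running_max.simps(2)[abs_def] cong: measurable_cong)
qed (simp add: running_max.simps(1)[abs_def] cong: measurable_cong)

text \<open>Doob's inequality needs of a martingale E(J | F k) only that it is adapted and dominated
  by J when tested against nonnegative F k-measurable functions.\<close>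

lemma Doob_L2_dominated:
  fixes X :: "nat \<Rightarrow> 'a \<Rightarrow> real"
  assumes "prob_space M"
    and sub: "\<And>k. sets (F k) \<subseteq> sets M" and sp: "\<And>k. space (F k) = space M"
    and mono: "\<And>k. sets (F k) \<subseteq> sets (F (Suc k))"
    and X: "\<And>k. X k \<in> borel_measurable (F k)" and Xb: "\<And>k \<omega>. 0 \<le> X k \<omega>" "\<And>k \<omega>. X k \<omega> \<le> c"
    and J [measurable]: "J \<in> borel_measurable M" and Jb: "\<And>\<omega>. 0 \<le> J \<omega>" "\<And>\<omega>. J \<omega> \<le> c"
    and dom: "\<And>k Y. Y \<in> borel_measurable (F k) \<Longrightarrow> (\<And>\<omega>. 0 \<le> Y \<omega>) \<Longrightarrow>
      (\<integral>\<^sup>+\<omega>. ennreal (X k \<omega> * Y \<omega>) \<partial>M) \<le> (\<integral>\<^sup>+\<omega>. ennreal (J \<omega> * Y \<omega>) \<partial>M)"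
  shows "(\<integral>\<^sup>+\<omega>. ennreal ((running_max X n \<omega>)\<^sup>2) \<partial>M) \<le> 4 * (\<integral>\<^sup>+\<omega>. ennreal ((J \<omega>)\<^sup>2) \<partial>M)"
proof -
  interpret prob_space M by fact
  define R where "R = running_max X"
  have FM: "f \<in> borel_measurable M" if "f \<in> borel_measurable (F k)" for f :: "'a \<Rightarrow> real" and k
    using that measurable_mono[of borel borel "F k" M] sub[of k] sp[of k] by auto
  have Fm: "f \<in> borel_measurable (F n)" if "f \<in> borel_measurable (F k)" "k \<le> n" for f :: "'a \<Rightarrow> real" and k n
  proof -
    have "sets (F k) \<subseteq> sets (F n)" using that(2) by (rule lift_Suc_mono_le[of "\<lambda>k. sets (F k)", OF mono])
    then show ?thesis using that(1) measurable_mono[of borel borel "F k" "F n"] sp by auto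
  qed
  have RF: "R n \<in> borel_measurable (F n)" for n
    unfolding R_def by (rule running_max_measurable) (rule Fm[OF X])
  have [measurable]: "R n \<in> borel_measurable M" "X n \<in> borel_measurable M" for n
    using FM[OF RF] FM[OF X] by auto
  have Rb: "0 \<le> R n \<omega>" "R n \<omega> \<le> c" for n \<omega>
    unfolding R_def using Xb by (auto intro: running_max_nonneg running_max_le)
  have R_mono: "R n \<omega> \<le> R (Suc n) \<omega>" for n \<omega> by (simp add: R_def)
  have int: "integrable M (\<lambda>\<omega>. f \<omega> * g \<omega>)"
    if "f \<in> borel_measurable M" "g \<in> borel_measurable M" "\<And>\<omega>. \<bar>f \<omega>\<bar> \<le> c" "\<And>\<omega>. \<bar>g \<omega>\<bar> \<le> c" for f g :: "'a \<Rightarrow> real"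
    using that by (intro integrable_const_bound[where B="c * c"]) (auto simp: abs_mult intro!: AE_I2 mult_mono order_trans[OF abs_ge_zero])
  have dom': "(\<integral>\<omega>. X k \<omega> * Y \<omega> \<partial>M) \<le> (\<integral>\<omega>. J \<omega> * Y \<omega> \<partial>M)"
    if Y: "Y \<in> borel_measurable (F k)" and Yb: "\<And>\<omega>. 0 \<le> Y \<omega>" "\<And>\<omega>. Y \<omega> \<le> c" for k Y
  proof -
    note [measurable] = FM[OF Y]
    have "ennreal (\<integral>\<omega>. X k \<omega> * Y \<omega> \<partial>M) \<le> ennreal (\<integral>\<omega>. J \<omega> * Y \<omega> \<partial>M)"
      using dom[OF Y Yb(1)] Xb Jb Yb
      by (subst (1 2) nn_integral_eq_integral[symmetric]) (auto intro!: int)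
    then show ?thesis using Jb Yb by (simp add: integral_nonneg_AE)
  qed
  \<comment> \<open>Summation by parts: half of the squared maximum is at most the sum of
    \<open>X k\<close> times the increments of \<open>R\<close>. Each increment is nonnegative and
    \<open>F k\<close>-measurable, so \<open>X k\<close> may be replaced by \<open>J\<close>, after
    which the increments add up to \<open>R n\<close>.\<close>
  have key: "(\<integral>\<omega>. R n \<omega> * R n \<omega> \<partial>M) / 2 \<le> (\<integral>\<omega>. J \<omega> * R n \<omega> \<partial>M)" for n
  proof (induction n)
    case 0
    have "0 \<le> (\<integral>\<omega>. R 0 \<omega> * R 0 \<omega> \<partial>M)" by (intro integral_nonneg_AE) auto
    moreover have "(\<integral>\<omega>. R 0 \<omega> * R 0 \<omega> \<partial>M) \<le> (\<integral>\<omega>. J \<omega> * R 0 \<omega> \<partial>M)"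
      using dom'[OF RF[of 0] Rb] by (simp add: R_def)
    ultimately show ?case by linarith
  next
    case (Suc n)
    define Y where "Y \<omega> = R (Suc n) \<omega> - R n \<omega>" for \<omega>
    have YF: "Y \<in> borel_measurable (F (Suc n))"
      unfolding Y_def[abs_def] by (intro borel_measurable_diff RF Fm[OF RF]) auto
    note [measurable] = FM[OF YF]
    have Yb: "0 \<le> Y \<omega>" "Y \<omega> \<le> c" for \<omega>
      using R_mono[of n \<omega>] Rb[of n \<omega>] Rb[of "Suc n" \<omega>] by (auto simp: Y_def)
    \<comment> \<open>The maximum grows only where \<open>X (Suc n)\<close> is the new maximum;
      there the claim is nonnegativity of
      \<open>(X (Suc n) \<omega> - R n \<omega>)\<^sup>2\<close>.\<close>
    have pw: "R (Suc n) \<omega> * R (Suc n) \<omega> / 2 \<le> R n \<omega> * R n \<omega> / 2 + X (Suc n) \<omega> * Y \<omega>" for \<omega>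
    proof (cases "X (Suc n) \<omega> \<le> R n \<omega>")
      case True
      then show ?thesis by (simp add: R_def Y_def max_def)
    next
      case False
      then have "R (Suc n) \<omega> = X (Suc n) \<omega>" by (simp add: R_def)
      moreover have "0 \<le> (X (Suc n) \<omega> - R n \<omega>)\<^sup>2" by simp
      ultimately show ?thesis by (simp add: Y_def power2_eq_square algebra_simps)
    qed
    have absb: "\<bar>R n \<omega>\<bar> \<le> c" "\<bar>X n \<omega>\<bar> \<le> c" "\<bar>Y \<omega>\<bar> \<le> c" "\<bar>J \<omega>\<bar> \<le> c" for n \<omega>
      using Rb[of n \<omega>] Xb[of n \<omega>] Yb[of \<omega>] Jb[of \<omega>] by auto
    have "(\<integral>\<omega>. R (Suc n) \<omega> * R (Suc n) \<omega> \<partial>M) / 2 = (\<integral>\<omega>. R (Suc n) \<omega> * R (Suc n) \<omega> / 2 \<partial>M)" by simp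
    also have "\<dots> \<le> (\<integral>\<omega>. R n \<omega> * R n \<omega> / 2 + X (Suc n) \<omega> * Y \<omega> \<partial>M)"
      by (intro integral_mono pw Bochner_Integration.integrable_add integrable_divide int absb) auto
    also have "\<dots> = (\<integral>\<omega>. R n \<omega> * R n \<omega> / 2 \<partial>M) + (\<integral>\<omega>. X (Suc n) \<omega> * Y \<omega> \<partial>M)"
      by (intro Bochner_Integration.integral_add integrable_divide int absb) auto
    also have "\<dots> \<le> (\<integral>\<omega>. J \<omega> * R n \<omega> \<partial>M) + (\<integral>\<omega>. J \<omega> * Y \<omega> \<partial>M)"
      using Suc dom'[OF YF Yb] by simp
    also have "\<dots> = (\<integral>\<omega>. J \<omega> * R n \<omega> + J \<omega> * Y \<omega> \<partial>M)"
      by (intro Bochner_Integration.integral_add[symmetric] int absb) auto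
    also have "\<dots> = (\<integral>\<omega>. J \<omega> * R (Suc n) \<omega> \<partial>M)" by (simp add: Y_def algebra_simps)
    finally show ?case .
  qed
  have absb: "\<bar>R n \<omega>\<bar> \<le> c" "\<bar>J \<omega>\<bar> \<le> c" for n \<omega>
    using Rb[of n \<omega>] Jb[of \<omega>] by auto
  \<comment> \<open>Young's inequality with weights 1/4 and 1: the quarter is absorbed by the half
    on the left of \<open>key\<close>, which yields the constant 4.\<close>
  have "(\<integral>\<omega>. J \<omega> * R n \<omega> \<partial>M) \<le> (\<integral>\<omega>. R n \<omega> * R n \<omega> / 4 + J \<omega> * J \<omega> \<partial>M)"
  proof (intro integral_mono Bochner_Integration.integrable_add integrable_divide int absb)
    fix \<omega>
    have "0 \<le> (R n \<omega> / 2 - J \<omega>)\<^sup>2" by simp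
    then show "J \<omega> * R n \<omega> \<le> R n \<omega> * R n \<omega> / 4 + J \<omega> * J \<omega>" by (simp add: power2_eq_square algebra_simps)
  qed auto
  also have "\<dots> = (\<integral>\<omega>. R n \<omega> * R n \<omega> / 4 \<partial>M) + (\<integral>\<omega>. J \<omega> * J \<omega> \<partial>M)"
    by (intro Bochner_Integration.integral_add integrable_divide int absb) auto
  finally have "(\<integral>\<omega>. R n \<omega> * R n \<omega> \<partial>M) \<le> 4 * (\<integral>\<omega>. J \<omega> * J \<omega> \<partial>M)"
    using key[of n] by simp
  then have "ennreal (\<integral>\<omega>. R n \<omega> * R n \<omega> \<partial>M) \<le> 4 * ennreal (\<integral>\<omega>. J \<omega> * J \<omega> \<partial>M)"
    by (metis ennreal_leI ennreal_mult' ennreal_numeral zero_le_numeral)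
  moreover have "ennreal (\<integral>\<omega>. R n \<omega> * R n \<omega> \<partial>M) = (\<integral>\<^sup>+\<omega>. ennreal (R n \<omega> * R n \<omega>) \<partial>M)"
    by (intro nn_integral_eq_integral[symmetric] int absb) auto
  moreover have "ennreal (\<integral>\<omega>. J \<omega> * J \<omega> \<partial>M) = (\<integral>\<^sup>+\<omega>. ennreal (J \<omega> * J \<omega>) \<partial>M)"
    by (intro nn_integral_eq_integral[symmetric] int absb) auto
  ultimately show ?thesis by (simp add: R_def power2_eq_square)
qed

text \<open>Whether the new term exceeds the old maximum is decided in \<open>G\<close>, so the test
  function splits along this event into two admissible test functions, and each branch is dominated
  on its own.\<close>

lemma running_max_dominated:
  fixes \<Phi> \<Psi> :: "nat \<Rightarrow> 'a \<Rightarrow> real"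
  assumes sub: "sets G \<subseteq> sets M" and sp: "space G = space M"
    and \<Phi>: "\<And>i. \<Phi> i \<in> borel_measurable G" and \<Phi>0: "\<And>i \<omega>. 0 \<le> \<Phi> i \<omega>"
    and \<Psi>: "\<And>i. \<Psi> i \<in> borel_measurable M" and \<Psi>0: "\<And>i \<omega>. 0 \<le> \<Psi> i \<omega>"
    and dom: "\<And>i Y. Y \<in> borel_measurable G \<Longrightarrow> (\<And>\<omega>. 0 \<le> Y \<omega>) \<Longrightarrow>
      (\<integral>\<^sup>+\<omega>. ennreal (\<Phi> i \<omega> * Y \<omega>) \<partial>M) \<le> (\<integral>\<^sup>+\<omega>. ennreal (\<Psi> i \<omega> * Y \<omega>) \<partial>M)"
    and Y: "Y \<in> borel_measurable G" "\<And>\<omega>. 0 \<le> Y \<omega>"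
  shows "(\<integral>\<^sup>+\<omega>. ennreal (running_max \<Phi> m \<omega> * Y \<omega>) \<partial>M) \<le> (\<integral>\<^sup>+\<omega>. ennreal (running_max \<Psi> m \<omega> * Y \<omega>) \<partial>M)"
  using Y
proof (induction m arbitrary: Y)
  case 0
  then show ?case using dom by simp
next
  case (Suc m)
  have GM: "f \<in> borel_measurable M" if "f \<in> borel_measurable G" for f :: "'a \<Rightarrow> real"
    using that measurable_mono[of borel borel G M] sub sp by auto
  have [measurable]: "running_max \<Phi> m \<in> borel_measurable G" "\<Phi> (Suc m) \<in> borel_measurable G" "Y \<in> borel_measurable G"
    using \<Phi> Suc by (auto intro: running_max_measurable)
  have [measurable]: "running_max \<Psi> m \<in> borel_measurable M" "\<Psi> (Suc m) \<in> borel_measurable M"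
    using \<Psi> by (auto intro: running_max_measurable)
  define Y1 where "Y1 \<omega> = (if \<Phi> (Suc m) \<omega> \<le> running_max \<Phi> m \<omega> then Y \<omega> else 0)" for \<omega>
  define Y2 where "Y2 \<omega> = (if \<Phi> (Suc m) \<omega> \<le> running_max \<Phi> m \<omega> then 0 else Y \<omega>)" for \<omega>
  have Y1: "Y1 \<in> borel_measurable G" "\<And>\<omega>. 0 \<le> Y1 \<omega>" unfolding Y1_def[abs_def] using Suc by (measurable, auto)
  have Y2: "Y2 \<in> borel_measurable G" "\<And>\<omega>. 0 \<le> Y2 \<omega>" unfolding Y2_def[abs_def] using Suc by (measurable, auto)
  note [measurable] = GM[OF Y1(1)] GM[OF Y2(1)] GM[OF \<Phi>] GM[OF running_max_measurable[OF \<Phi>]]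
  have "(\<integral>\<^sup>+\<omega>. ennreal (running_max \<Phi> (Suc m) \<omega> * Y \<omega>) \<partial>M)
      = (\<integral>\<^sup>+\<omega>. ennreal (running_max \<Phi> m \<omega> * Y1 \<omega>) + ennreal (\<Phi> (Suc m) \<omega> * Y2 \<omega>) \<partial>M)"
    by (intro nn_integral_cong) (auto simp: Y1_def Y2_def max_def)
  also have "\<dots> = (\<integral>\<^sup>+\<omega>. ennreal (running_max \<Phi> m \<omega> * Y1 \<omega>) \<partial>M) + (\<integral>\<^sup>+\<omega>. ennreal (\<Phi> (Suc m) \<omega> * Y2 \<omega>) \<partial>M)"
    by (intro nn_integral_add) auto
  also have "\<dots> \<le> (\<integral>\<^sup>+\<omega>. ennreal (running_max \<Psi> m \<omega> * Y1 \<omega>) \<partial>M) + (\<integral>\<^sup>+\<omega>. ennreal (\<Psi> (Suc m) \<omega> * Y2 \<omega>) \<partial>M)"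
    using Suc.IH[OF Y1] dom[OF Y2] by (intro add_mono) auto
  also have "\<dots> = (\<integral>\<^sup>+\<omega>. ennreal (running_max \<Psi> m \<omega> * Y1 \<omega>) + ennreal (\<Psi> (Suc m) \<omega> * Y2 \<omega>) \<partial>M)"
    by (intro nn_integral_add[symmetric]) auto
  also have "\<dots> \<le> (\<integral>\<^sup>+\<omega>. ennreal (running_max \<Psi> (Suc m) \<omega> * Y \<omega>) \<partial>M)"
    using Suc.prems by (intro nn_integral_mono) (auto simp: Y1_def Y2_def intro!: ennreal_leI mult_right_mono)
  finally show ?case .
qed

text \<open>Doob's inequality in \<open>j\<close>, with the maximum of \<Psi> over \<open>i\<close>
  in the role of \<open>J\<close>, followed by Doob's inequality in \<open>i\<close>: the constant
  is 4 times 4. Domination passes to the maximum over \<open>i\<close> because all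
  \<open>\<Phi> i j\<close> with the same \<open>j\<close> are measurable for one algebra
  \<open>G j\<close>.\<close>

lemma Cairoli_L2_dominated:
  fixes \<Psi> :: "nat \<Rightarrow> 'a \<Rightarrow> real" and \<Phi> :: "nat \<Rightarrow> nat \<Rightarrow> 'a \<Rightarrow> real"
  assumes "prob_space M"
    and F: "\<And>k. sets (F k) \<subseteq> sets M" "\<And>k. space (F k) = space M" "\<And>k. sets (F k) \<subseteq> sets (F (Suc k))"
    and G: "\<And>k. sets (G k) \<subseteq> sets M" "\<And>k. space (G k) = space M" "\<And>k. sets (G k) \<subseteq> sets (G (Suc k))"
    and \<Psi>: "\<And>i. \<Psi> i \<in> borel_measurable (F i)" "\<And>i \<omega>. 0 \<le> \<Psi> i \<omega>" "\<And>i \<omega>. \<Psi> i \<omega> \<le> c"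
    and \<Phi>: "\<And>i j. \<Phi> i j \<in> borel_measurable (G j)" "\<And>i j \<omega>. 0 \<le> \<Phi> i j \<omega>" "\<And>i j \<omega>. \<Phi> i j \<omega> \<le> c"
    and J: "J \<in> borel_measurable M" "\<And>\<omega>. 0 \<le> J \<omega>" "\<And>\<omega>. J \<omega> \<le> c"
    and dom1: "\<And>i Y. Y \<in> borel_measurable (F i) \<Longrightarrow> (\<And>\<omega>. 0 \<le> Y \<omega>) \<Longrightarrow>
      (\<integral>\<^sup>+\<omega>. ennreal (\<Psi> i \<omega> * Y \<omega>) \<partial>M) \<le> (\<integral>\<^sup>+\<omega>. ennreal (J \<omega> * Y \<omega>) \<partial>M)"
    and dom2: "\<And>i j Y. Y \<in> borel_measurable (G j) \<Longrightarrow> (\<And>\<omega>. 0 \<le> Y \<omega>) \<Longrightarrow>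
      (\<integral>\<^sup>+\<omega>. ennreal (\<Phi> i j \<omega> * Y \<omega>) \<partial>M) \<le> (\<integral>\<^sup>+\<omega>. ennreal (\<Psi> i \<omega> * Y \<omega>) \<partial>M)"
  shows "(\<integral>\<^sup>+\<omega>. ennreal ((running_max (\<lambda>j. running_max (\<lambda>i. \<Phi> i j) m) n \<omega>)\<^sup>2) \<partial>M)
    \<le> 16 * (\<integral>\<^sup>+\<omega>. ennreal ((J \<omega>)\<^sup>2) \<partial>M)"
proof -
  have \<Psi>M: "\<Psi> i \<in> borel_measurable M" for i
    using \<Psi>(1)[of i] measurable_mono[of borel borel "F i" M] F by auto
  have "(\<integral>\<^sup>+\<omega>. ennreal ((running_max (\<lambda>j. running_max (\<lambda>i. \<Phi> i j) m) n \<omega>)\<^sup>2) \<partial>M)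
     \<le> 4 * (\<integral>\<^sup>+\<omega>. ennreal ((running_max \<Psi> m \<omega>)\<^sup>2) \<partial>M)"
  proof (rule Doob_L2_dominated[where F=G and c=c])
    show "(\<integral>\<^sup>+\<omega>. ennreal (running_max (\<lambda>i. \<Phi> i k) m \<omega> * Y \<omega>) \<partial>M) \<le> (\<integral>\<^sup>+\<omega>. ennreal (running_max \<Psi> m \<omega> * Y \<omega>) \<partial>M)"
      if "Y \<in> borel_measurable (G k)" "\<And>\<omega>. 0 \<le> Y \<omega>" for k Y
      using that by (intro running_max_dominated[where G="G k"] G \<Phi> \<Psi> \<Psi>M dom2)
  qed (use assms(1) G \<Phi> \<Psi> \<Psi>M in \<open>auto intro: running_max_measurable running_max_nonneg running_max_le\<close>)
  also have "\<dots> \<le> 4 * (4 * (\<integral>\<^sup>+\<omega>. ennreal ((J \<omega>)\<^sup>2) \<partial>M))"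
    by (intro mult_left_mono Doob_L2_dominated[where F=F and c=c] assms) auto
  finally show ?thesis by (simp add: mult.assoc[symmetric])
qed

section \<open>Kernel comparison\<close>

text \<open>The second moments of the sheet produce the kernel \<open>(|s - u| + |t - v|) powr (- d / 2)\<close>;
  integrating out the time lag turns it into the Riesz kernel of order (d - 2) / 2.  The
  regularisation e keeps everything finite.\<close>

definition slab_kernel :: "nat \<Rightarrow> real \<Rightarrow> real \<Rightarrow> ennreal" where
  "slab_kernel d e h = (\<integral>\<^sup>+r\<in>{0..1}. ennreal ((e + h + r) powr (- real d / 2)) \<partial>lborel)"

lemma slab_kernel_measurable [measurable]: "slab_kernel d e \<in> borel_measurable borel"
  unfolding slab_kernel_def[abs_def] by measurable

lemma slab_kernel_bound:
  assumes "0 < e" "0 \<le> h"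
  shows "slab_kernel d e h \<le> ennreal (e powr (- real d / 2))"
proof -
  have "slab_kernel d e h \<le> (\<integral>\<^sup>+r\<in>{0..1::real}. ennreal (e powr (- real d / 2)) \<partial>lborel)"
    unfolding slab_kernel_def using assms
    by (intro nn_integral_mono) (auto simp: indicator_def intro!: ennreal_leI powr_mono2')
  also have "\<dots> = ennreal (e powr (- real d / 2))" by (simp add: nn_integral_cmult)
  finally show ?thesis .
qed

lemma slab_kernel_two:
  assumes "0 < e" "0 \<le> h"
  shows "slab_kernel 2 e h = ennreal (ln (e + h + 1) - ln (e + h))"
proof -
  have "slab_kernel 2 e h = ennreal (ln (e + h + 1) - ln (e + h + 0))"
    unfolding slab_kernel_def using assms
    by (intro nn_integral_FTC_Icc)
      (auto intro!: derivative_eq_intros simp: powr_minus field_simps)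
  then show ?thesis by simp
qed

lemma slab_kernel_neq_two:
  assumes "0 < e" "0 \<le> h" "d \<noteq> 2"
  shows "slab_kernel d e h = ennreal (((e + h + 1) powr (1 - d / 2) - (e + h) powr (1 - d / 2)) / (1 - d / 2))"
proof -
  have d: "1 - real d / 2 \<noteq> 0" using assms by simp
  have "slab_kernel d e h = ennreal ((e + h + 1) powr (1 - d / 2) / (1 - d / 2) - (e + h + 0) powr (1 - d / 2) / (1 - d / 2))"
    unfolding slab_kernel_def
  proof (rule nn_integral_FTC_Icc[where F="\<lambda>r. (e + h + r) powr (1 - d / 2) / (1 - d / 2)"])
    fix r :: real assume "r \<in> {0..1}"
    then have "((\<lambda>r. (e + h + r) powr (1 - d / 2) / (1 - d / 2)) has_real_derivative
        ((1 - d / 2) * (e + h + r) powr (1 - d / 2 - 1)) / (1 - d / 2)) (at r)"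
      using assms d by (auto intro!: derivative_eq_intros)
    moreover have "1 - real d / 2 - 1 = - real d / 2" by simp
    ultimately show "((\<lambda>r. (e + h + r) powr (1 - d / 2) / (1 - d / 2)) has_real_derivative (e + h + r) powr (- real d / 2)) (at r)"
      using d by simp
  qed auto
  then show ?thesis by (simp add: diff_divide_distrib)
qed

text \<open>The slab kernel is the increment over unit length of a primitive of
  \<open>r powr (- d / 2)\<close>: a square root for d = 1, a logarithm for d = 2, a negative power
  for d at least 3. The summand 1 covers large distances for d = 2, where the truncated logarithm is
  0 and the increment is not.\<close>

lemma slab_kernel_le_riesz:
  assumes "1 \<le> d"
  obtains C :: real where "0 \<le> C" "\<And>e h. 0 < e \<Longrightarrow> slab_kernel d e \<bar>h\<bar> \<le> ennreal C * (1 + riesz_kernel ((real d - 2) / 2) h)"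
proof -
  consider "d = 1" | "d = 2" | "d \<ge> 3" using assms by linarith
  then show thesis
  proof cases
    case 1
    show thesis
    proof (rule that[of 2])
      fix e h :: real assume e: "0 < e"
      \<comment> \<open>Subadditivity bounds the increment of the square root by 1; the primitive
        carries the factor 2.\<close>
      have "sqrt (e + \<bar>h\<bar> + 1) \<le> sqrt (e + \<bar>h\<bar>) + sqrt 1"
        by (rule sqrt_add_le_add_sqrt) (use e in auto)
      then have "slab_kernel 1 e \<bar>h\<bar> \<le> ennreal 2"
        using slab_kernel_neq_two[OF e, of "\<bar>h\<bar>" 1] e
        by (auto simp: powr_half_sqrt simp del: ennreal_numeral intro!: ennreal_leI)
      also have "\<dots> \<le> ennreal 2 * (1 + riesz_kernel ((real d - 2) / 2) h)"
        using mult_left_mono[of 1 "1 + riesz_kernel ((real d - 2) / 2) h" "ennreal 2"] by simp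
      finally show "slab_kernel d e \<bar>h\<bar> \<le> ennreal 2 * (1 + riesz_kernel ((real d - 2) / 2) h)" using 1 by simp
    qed simp
  next
    case 2
    show thesis
    proof (rule that[of 1])
      fix e h :: real assume e: "0 < e"
      show "slab_kernel d e \<bar>h\<bar> \<le> ennreal 1 * (1 + riesz_kernel ((real d - 2) / 2) h)"
      proof (cases "h = 0")
        case True then show ?thesis using 2 by (simp add: riesz_kernel_def)
      next
        case False
        define x where "x = \<bar>h\<bar>"
        have x: "x > 0" using False by (simp add: x_def)
        have "1 + 1 / (e + x) = (e + x + 1) / (e + x)" using e x by (simp add: field_simps)
        then have "ln (e + x + 1) - ln (e + x) = ln (1 + 1 / (e + x))"
          using e x by (simp add: ln_div)
        \<comment> \<open>Both summands 1 and 1/(e + x) are at most max 1 (1/x), and the logarithm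
          of this maximum is the positive part of the logarithm.\<close>
        also have "\<dots> \<le> ln (2 * max 1 (1 / x))"
        proof (subst ln_le_cancel_iff)
          have "1 / (e + x) \<le> 1 / x" using e x by (simp add: frac_le)
          then show "1 + 1 / (e + x) \<le> 2 * max 1 (1 / x)" by (simp add: max_def)
        qed (use e x in \<open>auto simp: add_pos_pos\<close>)
        also have "\<dots> = ln 2 + ln (max 1 (1 / x))" using x by (subst ln_mult) (auto simp: max_def)
        also have "ln (max 1 (1 / x)) = max 0 (ln (1 / x))"
        proof (cases "x \<le> 1")
          case True
          then have "ln (1 / x) \<ge> 0" "1 / x \<ge> 1" using x by auto
          then show ?thesis by (simp add: max_def)
        next
          case False
          then have "ln (1 / x) \<le> 0" "1 / x \<le> 1" using x by (auto simp: ln_div)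
          then show ?thesis by (simp add: max_def)
        qed
        also have "ln 2 + max 0 (ln (1 / x)) \<le> 1 + max 0 (ln (1 / x))"
          using ln_2_less_1 by simp
        finally have "slab_kernel d e x \<le> ennreal (1 + max 0 (ln (1 / x)))"
          unfolding \<open>d = 2\<close> slab_kernel_two[OF e less_imp_le[OF x]] by (rule ennreal_leI)
        also have "\<dots> = 1 + ennreal (max 0 (ln (1 / x)))" by (subst ennreal_plus) auto
        finally show ?thesis using 2 False by (simp add: riesz_kernel_def x_def)
      qed
    qed simp
  next
    case 3
    define b where "b = (real d - 2) / 2"
    have b: "b > 0" "1 - real d / 2 = - b" using 3 by (auto simp: b_def field_simps)
    show thesis
    \<comment> \<open>The factor in the primitive of \<open>r powr (- b - 1)\<close>.\<close>
    proof (rule that[of "1 / b"])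
      fix e h :: real assume e: "0 < e"
      show "slab_kernel d e \<bar>h\<bar> \<le> ennreal (1 / b) * (1 + riesz_kernel ((real d - 2) / 2) h)"
      proof (cases "h = 0")
        case True then show ?thesis using b by (simp add: riesz_kernel_def b_def[symmetric] ennreal_mult_top)
      next
        case False
        have "slab_kernel d e \<bar>h\<bar> = ennreal (((e + \<bar>h\<bar>) powr (- b) - (e + \<bar>h\<bar> + 1) powr (- b)) / b)"
          using slab_kernel_neq_two[OF e, of "\<bar>h\<bar>" d] 3 b by (simp add: minus_divide_right[symmetric] minus_divide_left diff_divide_distrib)
        also have "\<dots> \<le> ennreal (1 / b * (\<bar>h\<bar> powr (- b)))"
        proof -
          have "(e + \<bar>h\<bar>) powr (- b) \<le> \<bar>h\<bar> powr (- b)" using e b False by (intro powr_mono2') auto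
          moreover have "0 \<le> (e + \<bar>h\<bar> + 1) powr (- b)" by simp
          ultimately have "(e + \<bar>h\<bar>) powr (- b) - (e + \<bar>h\<bar> + 1) powr (- b) \<le> \<bar>h\<bar> powr (- b)" by linarith
          from divide_right_mono[OF this, of b] show ?thesis using b by (intro ennreal_leI) auto
        qed
        also have "\<dots> = ennreal (1 / b) * riesz_kernel ((real d - 2) / 2) h"
          using b False by (simp add: riesz_kernel_def b_def[symmetric] ennreal_mult'[symmetric])
        also have "\<dots> \<le> ennreal (1 / b) * (1 + riesz_kernel ((real d - 2) / 2) h)"
          by (intro mult_left_mono) auto
        finally show ?thesis .
      qed
    qed (use b in simp)
  qed
qed

text \<open>The shift by \<open>e\<close> keeps the Riesz kernel finite on the diagonal. As the lag
  stops at 1, the slab kernel misses the end value of the primitive at lag 1. For d at least 3 this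
  value is at most 1 up to constants and is covered by the summand 1; for d = 2 its sign is
  favourable.\<close>

lemma riesz_le_slab_kernel:
  assumes "1 \<le> d"
  obtains C :: real where "0 \<le> C"
    "\<And>e h. 0 < e \<Longrightarrow> riesz_kernel ((real d - 2) / 2) (\<bar>h\<bar> + e :: real) \<le> ennreal C * (1 + slab_kernel d e \<bar>h\<bar>)"
proof -
  consider "d = 1" | "d = 2" | "d \<ge> 3" using assms by linarith
  then show thesis
  proof cases
    case 1
    then show thesis by (intro that[of 1]) (auto simp: riesz_kernel_def)
  next
    case 2
    show thesis
    proof (rule that[of 1])
      fix e h :: real assume e: "0 < e"
      have p: "e + \<bar>h\<bar> > 0" using e by auto
      have "max 0 (ln (1 / (e + \<bar>h\<bar>))) \<le> ln (e + \<bar>h\<bar> + 1) - ln (e + \<bar>h\<bar>)"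
      proof -
        have "ln (1 / (e + \<bar>h\<bar>)) = - ln (e + \<bar>h\<bar>)" using p by (simp add: ln_div)
        moreover have "0 \<le> ln (e + \<bar>h\<bar> + 1)" using p by simp
        moreover have "ln (e + \<bar>h\<bar>) \<le> ln (e + \<bar>h\<bar> + 1)" using p by simp
        ultimately show ?thesis by simp
      qed
      then have "riesz_kernel ((real d - 2) / 2) (\<bar>h\<bar> + e :: real) \<le> slab_kernel d e \<bar>h\<bar>"
        using 2 slab_kernel_two[OF e, of "\<bar>h\<bar>"] p by (auto simp: riesz_kernel_def add.commute intro!: ennreal_leI)
      also have "\<dots> \<le> 1 + slab_kernel d e \<bar>h\<bar>" by simp
      finally show "riesz_kernel ((real d - 2) / 2) (\<bar>h\<bar> + e :: real) \<le> ennreal 1 * (1 + slab_kernel d e \<bar>h\<bar>)" by simp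
    qed simp
  next
    case 3
    define b where "b = (real d - 2) / 2"
    have b: "b > 0" "1 - real d / 2 = - b" using 3 by (auto simp: b_def field_simps)
    show thesis
    proof (rule that[of "max 1 b"])
      fix e h :: real assume e: "0 < e"
      have p: "e + \<bar>h\<bar> > 0" using e by auto
      have s: "slab_kernel d e \<bar>h\<bar> = ennreal (((e + \<bar>h\<bar>) powr (- b) - (e + \<bar>h\<bar> + 1) powr (- b)) / b)"
        using slab_kernel_neq_two[OF e, of "\<bar>h\<bar>" d] 3 b by (simp add: minus_divide_right[symmetric] minus_divide_left diff_divide_distrib)
      define y where "y = ((e + \<bar>h\<bar>) powr (- b) - (e + \<bar>h\<bar> + 1) powr (- b)) / b"
      have "(e + \<bar>h\<bar> + 1) powr (- b) \<le> (e + \<bar>h\<bar>) powr (- b)" using p b by (intro powr_mono2') auto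
      then have y: "0 \<le> y" using b by (simp add: y_def)
      have "(e + \<bar>h\<bar> + 1) powr (- b) \<le> 1 powr (- b)" using p b by (intro powr_mono2') auto
      then have "(e + \<bar>h\<bar>) powr (- b) \<le> 1 + b * y" using b by (simp add: y_def)
      also have "\<dots> \<le> max 1 b * (1 + y)"
        using mult_right_mono[of b "max 1 b" y] y by (simp add: distrib_left add_mono)
      finally have "riesz_kernel ((real d - 2) / 2) (\<bar>h\<bar> + e :: real) \<le> ennreal (max 1 b * (1 + y))"
        using b p by (auto simp: riesz_kernel_def b_def[symmetric] add.commute intro!: ennreal_leI)
      also have "\<dots> = ennreal (max 1 b) * (1 + slab_kernel d e \<bar>h\<bar>)"
        unfolding s y_def[symmetric] using y b by (simp add: ennreal_mult ennreal_plus)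
      finally show "riesz_kernel ((real d - 2) / 2) (\<bar>h\<bar> + e :: real) \<le> ennreal (max 1 b) * (1 + slab_kernel d e \<bar>h\<bar>)" .
    qed simp
  qed
qed

lemma riesz_kernel_measurable [measurable]: "riesz_kernel \<beta> \<in> borel_measurable (borel :: 'v::real_normed_vector measure)"
  unfolding riesz_kernel_def[abs_def] by measurable

text \<open>Continuity of the kernel, including the infinite value at \<open>h = 0\<close> when
  \<beta> \<ge> 0. It allows Fatou's lemma to remove the mollification.\<close>

lemma riesz_kernel_LIMSEQ:
  "(\<lambda>n. riesz_kernel \<beta> (\<bar>h\<bar> + 1 / real (Suc n))) \<longlonglongrightarrow> riesz_kernel \<beta> h" for h :: real
proof -
  have l0: "(\<lambda>n. \<bar>h\<bar> + 1 / real (Suc n)) \<longlonglongrightarrow> \<bar>h\<bar> + 0"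
    using LIMSEQ_inverse_real_of_nat by (intro tendsto_intros) (simp add: inverse_eq_divide)
  have pos: "0 < \<bar>h\<bar> + 1 / real (Suc n)" for n by (simp add: add_nonneg_pos)
  consider "\<beta> < 0" | "\<beta> = 0" "h \<noteq> 0" | "\<beta> > 0" "h \<noteq> 0" | "\<beta> = 0" "h = 0" | "\<beta> > 0" "h = 0" by linarith
  then show ?thesis
  proof cases
    case 1
    then show ?thesis by (simp add: riesz_kernel_def)
  next
    case 2
    have "(\<lambda>n. ennreal (max 0 (ln (1 / (\<bar>h\<bar> + 1 / real (Suc n)))))) \<longlonglongrightarrow> ennreal (max 0 (ln (1 / \<bar>h\<bar>)))"
      using 2 l0 by (intro tendsto_ennrealI tendsto_max tendsto_intros) auto
    then show ?thesis using 2 pos by (auto simp: riesz_kernel_def less_le)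
  next
    case 3
    have "(\<lambda>n. ennreal ((\<bar>h\<bar> + 1 / real (Suc n)) powr (- \<beta>))) \<longlonglongrightarrow> ennreal (\<bar>h\<bar> powr (- \<beta>))"
      using 3 l0 by (intro tendsto_ennrealI tendsto_powr tendsto_const) auto
    then show ?thesis using 3 pos by (auto simp: riesz_kernel_def less_le)
  next
    case 4
    have "filterlim (\<lambda>n. ln (real (Suc n))) at_top sequentially"
      by (intro filterlim_compose[OF ln_at_top] filterlim_compose[OF filterlim_real_sequentially] filterlim_Suc)
    then have "(\<lambda>n. ennreal (ln (real (Suc n)))) \<longlonglongrightarrow> \<top>"
      by (rule filterlim_compose[OF ennreal_tendsto_top_eq_at_top[THEN iffD2, OF filterlim_ident]])
    then show ?thesis using 4 by (simp add: riesz_kernel_def del: of_nat_Suc)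
  next
    case 5
    have "filterlim (\<lambda>n. exp (\<beta> * ln (real (Suc n)))) at_top sequentially"
      using 5 by (intro filterlim_compose[OF exp_at_top] filterlim_tendsto_pos_mult_at_top[OF tendsto_const]
          filterlim_compose[OF ln_at_top] filterlim_compose[OF filterlim_real_sequentially] filterlim_Suc)
    then have "filterlim (\<lambda>n. real (Suc n) powr \<beta>) at_top sequentially"
      by (simp add: powr_def)
    then have "(\<lambda>n. ennreal (real (Suc n) powr \<beta>)) \<longlonglongrightarrow> \<top>"
      by (simp add: ennreal_tendsto_top_eq_at_top)
    moreover have "(1 / real (Suc n)) powr (- \<beta>) = real (Suc n) powr \<beta>" for n
      by (simp add: powr_minus powr_divide)
    ultimately show ?thesis using 5 by (simp add: riesz_kernel_def del: of_nat_Suc)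
  qed
qed

text \<open>The lag |t - t'| is cut into unit pieces. On the piece that starts at \<open>k\<close>,
  the decreasing power is at most its value at the lag minus \<open>k\<close>, a translate of the
  slab integrand; \<open>N\<close> pieces on each side of \<open>t\<close> give the factor
  \<open>2 * N\<close>.\<close>

lemma nn_integral_distance_le_slab:
  assumes e: "0 < e" and h: "0 \<le> h" and t: "a \<le> t" "t \<le> b" and N: "b - a < real N"
  shows "(\<integral>\<^sup>+t'\<in>{a..b}. ennreal ((e + h + \<bar>t - t'\<bar>) powr (- real d / 2)) \<partial>lborel) \<le> ennreal (2 * real N) * slab_kernel d e h"
proof -
  define f where "f r = ennreal ((e + h + r) powr (- real d / 2)) * indicator {0..1} r" for r
  have [measurable]: "f \<in> borel_measurable borel" unfolding f_def[abs_def] by measurable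
  have sl: "slab_kernel d e h = (\<integral>\<^sup>+r. f r \<partial>lborel)" by (simp add: slab_kernel_def f_def)
  have tr1: "(\<integral>\<^sup>+t'. f (t' - t - real k) \<partial>lborel) = slab_kernel d e h" for k :: nat
    using nn_integral_real_affine[of f 1 "- t - real k"] by (simp add: sl algebra_simps)
  have tr2: "(\<integral>\<^sup>+t'. f (t - t' - real k) \<partial>lborel) = slab_kernel d e h" for k :: nat
    using nn_integral_real_affine[of f "-1" "t - real k"] by (simp add: sl algebra_simps)
  have "(\<integral>\<^sup>+t'\<in>{a..b}. ennreal ((e + h + \<bar>t - t'\<bar>) powr (- real d / 2)) \<partial>lborel)
     \<le> (\<integral>\<^sup>+t'. (\<Sum>k<N. f (t' - t - real k) + f (t - t' - real k)) \<partial>lborel)"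
  proof (rule nn_integral_mono)
    fix t' :: real
    show "ennreal ((e + h + \<bar>t - t'\<bar>) powr (- real d / 2)) * indicator {a..b} t' \<le> (\<Sum>k<N. f (t' - t - real k) + f (t - t' - real k))"
    proof (cases "t' \<in> {a..b}")
      case True
      define k where "k = nat \<lfloor>\<bar>t - t'\<bar>\<rfloor>"
      have k1: "real k \<le> \<bar>t - t'\<bar>" "\<bar>t - t'\<bar> \<le> real k + 1" unfolding k_def by linarith+
      have "\<bar>t - t'\<bar> < real N" using t True N by auto
      then have k2: "k < N" using k1 by linarith
      have "ennreal ((e + h + \<bar>t - t'\<bar>) powr (- real d / 2)) \<le> f (\<bar>t - t'\<bar> - real k)"
        unfolding f_def using k1 e h by (auto intro!: ennreal_leI powr_mono2')
      also have "\<dots> \<le> f (t' - t - real k) + f (t - t' - real k)" by (cases "t \<le> t'") auto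
      also have "\<dots> \<le> (\<Sum>k<N. f (t' - t - real k) + f (t - t' - real k))"
        using k2 by (intro member_le_sum) auto
      finally show ?thesis using True by simp
    qed auto
  qed
  also have "\<dots> = (\<Sum>k<N. 2 * slab_kernel d e h)"
    by (subst nn_integral_sum) (auto intro!: sum.cong simp: nn_integral_add tr1 tr2 mult_2)
  also have "\<dots> = ennreal (2 * real N) * slab_kernel d e h"
    by (simp add: ennreal_mult ennreal_of_nat_eq_real_of_nat mult_ac)
  finally show ?thesis .
qed

section \<open>Mollified local time\<close>

definition strip :: "real measure \<Rightarrow> real \<Rightarrow> real \<Rightarrow> (real \<times> real) measure" where
  "strip \<mu> \<alpha> \<gamma> = \<mu> \<Otimes>\<^sub>M density lborel (indicator {\<alpha>..\<gamma>})"

lemma sets_strip: "sets \<mu> = sets borel \<Longrightarrow> sets (strip \<mu> \<alpha> \<gamma>) = sets borel"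
  unfolding strip_def borel_prod[symmetric] by (intro sets_pair_measure_cong) auto

lemma sigma_finite_interval: "sigma_finite_measure (density lborel (indicator {\<alpha>..\<gamma>::real}))"
proof -
  have "finite_measure (density lborel (indicator {\<alpha>..\<gamma>::real}))"
    by (intro finite_measureI) (auto simp: emeasure_density emeasure_lborel_Icc_eq cong: nn_integral_cong)
  then show ?thesis by (simp add: finite_measure_def)
qed

lemma nn_integral_strip:
  assumes \<mu>: "sets \<mu> = sets borel" and f: "f \<in> borel_measurable borel"
  shows "(\<integral>\<^sup>+p. f p \<partial>strip \<mu> \<alpha> \<gamma>) = (\<integral>\<^sup>+s. (\<integral>\<^sup>+t\<in>{\<alpha>..\<gamma>}. f (s, t) \<partial>lborel) \<partial>\<mu>)"
proof -
  interpret sigma_finite_measure "density lborel (indicator {\<alpha>..\<gamma>::real})" by (rule sigma_finite_interval)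
  have fm: "f \<in> borel_measurable (\<mu> \<Otimes>\<^sub>M density lborel (indicator {\<alpha>..\<gamma>}))"
    using f measurable_cong_sets[OF sets_strip[OF \<mu>, of \<alpha> \<gamma>] refl, of borel] unfolding strip_def by blast
  have [measurable]: "(\<lambda>t. f (s, t)) \<in> borel_measurable borel" for s
    using f by (rule measurable_compose[rotated]) (simp add: borel_prod[symmetric])
  show ?thesis
    unfolding strip_def nn_integral_fst[OF fm, symmetric]
    by (subst nn_integral_density) (auto simp: mult.commute)
qed

lemma emeasure_strip:
  assumes "prob_space \<mu>" "sets \<mu> = sets borel" "\<alpha> \<le> \<gamma>"
  shows "emeasure (strip \<mu> \<alpha> \<gamma>) UNIV = ennreal (\<gamma> - \<alpha>)"
proof -
  have "space \<mu> = UNIV" using sets_eq_imp_space_eq[OF assms(2)] by simp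
  then show ?thesis
    using nn_integral_strip[OF assms(2), of "\<lambda>_. 1" \<alpha> \<gamma>] assms(3) prob_space.emeasure_space_1[OF assms(1)]
      sets_eq_imp_space_eq[OF sets_strip[OF assms(2), of \<alpha> \<gamma>]]
    by simp
qed

lemma finite_measure_strip:
  assumes "prob_space \<mu>" "sets \<mu> = sets borel" "\<alpha> \<le> \<gamma>"
  shows "finite_measure (strip \<mu> \<alpha> \<gamma>)"
  using emeasure_strip[OF assms] sets_eq_imp_space_eq[OF sets_strip[OF assms(2), of \<alpha> \<gamma>]]
  by (intro finite_measureI) simp

lemma heat_measurable_pair [measurable]:
  "(\<lambda>(e, x). heat e x) \<in> borel_measurable (borel \<Otimes>\<^sub>M (borel :: (real ^ 'd::finite) measure))"
proof -
  have "(\<lambda>z. normal_density 0 (sqrt (fst z)) (snd z $ i)) \<in> borel_measurable (borel \<Otimes>\<^sub>M (borel :: (real ^ 'd) measure))" for i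
  proof -
    have [measurable]: "(\<lambda>z. snd z $ i) \<in> borel_measurable ((borel :: real measure) \<Otimes>\<^sub>M (borel :: (real ^ 'd) measure))"
      by (rule measurable_compose[OF measurable_snd]) measurable
    show ?thesis unfolding normal_density_def by measurable
  qed
  then show ?thesis
    unfolding heat_def case_prod_beta' by (intro borel_measurable_prod)
qed

context sheet
begin

text \<open>For A = UNIV, w constant and \<open>\<pi>\<close> the identity this is the mollified local time at 0 along
  \<open>\<rho>\<close>; other choices give lower bounds for its conditional expectations.\<close>

definition occ :: "(real \<times> real) measure \<Rightarrow> (real \<times> real) set \<Rightarrow> (real \<times> real \<Rightarrow> real) \<Rightarrow> (real \<times> real \<Rightarrow> real \<times> real) \<Rightarrow> 'a \<Rightarrow> ennreal" where
  "occ \<rho> A w \<pi> \<omega> = (\<integral>\<^sup>+p\<in>A. ennreal (heat (w p) (Bp (\<pi> p) \<omega>)) \<partial>\<rho>)"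

lemma occ_integrand_measurable:
  assumes \<rho>: "sets \<rho> = sets borel" and A: "A \<in> sets borel" and w: "w \<in> borel_measurable borel"
    and \<pi>: "(\<lambda>(p, \<omega>). Bp (\<pi> p) \<omega>) \<in> borel_measurable (borel \<Otimes>\<^sub>M N)"
  shows "(\<lambda>(\<omega>, p). ennreal (heat (w p) (Bp (\<pi> p) \<omega>)) * indicator A p) \<in> borel_measurable (N \<Otimes>\<^sub>M \<rho>)"
proof -
  note [measurable] = A w
  have [measurable]: "(\<lambda>x. Bp (\<pi> (snd x)) (fst x)) \<in> borel_measurable (N \<Otimes>\<^sub>M borel)"
    using measurable_compose[OF measurable_pair_swap'[of N borel] \<pi>] by (simp add: case_prod_beta')
  have "(\<lambda>x. (w (snd x), Bp (\<pi> (snd x)) (fst x))) \<in> measurable (N \<Otimes>\<^sub>M borel) (borel \<Otimes>\<^sub>M borel)"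
    by measurable
  from measurable_compose[OF this heat_measurable_pair]
  have [measurable]: "(\<lambda>x. heat (w (snd x)) (Bp (\<pi> (snd x)) (fst x))) \<in> borel_measurable (N \<Otimes>\<^sub>M borel)" by simp
  have "(\<lambda>(\<omega>, p). ennreal (heat (w p) (Bp (\<pi> p) \<omega>)) * indicator A p) \<in> borel_measurable (N \<Otimes>\<^sub>M borel)"
    unfolding case_prod_beta' by measurable
  then show ?thesis using measurable_cong_sets[OF sets_pair_measure_cong[OF refl \<rho>]] by blast
qed

lemma occ_measurable:
  assumes \<rho>: "finite_measure \<rho>" "sets \<rho> = sets borel" and A: "A \<in> sets borel" and w: "w \<in> borel_measurable borel"
    and \<pi>: "(\<lambda>(p, \<omega>). Bp (\<pi> p) \<omega>) \<in> borel_measurable (borel \<Otimes>\<^sub>M N)"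
  shows "occ \<rho> A w \<pi> \<in> borel_measurable N"
proof -
  interpret finite_measure \<rho> by fact
  show ?thesis
    unfolding occ_def[abs_def]
    by (rule borel_measurable_nn_integral) (rule occ_integrand_measurable[OF \<rho>(2) A w \<pi>])
qed

lemma nn_integral_occ_times:
  assumes \<rho>: "finite_measure \<rho>" "sets \<rho> = sets borel" and A: "A \<in> sets borel" and w: "w \<in> borel_measurable borel"
    and \<pi>: "(\<lambda>(p, \<omega>). Bp (\<pi> p) \<omega>) \<in> borel_measurable (borel \<Otimes>\<^sub>M M)" and Y: "Y \<in> borel_measurable M"
  shows "(\<integral>\<^sup>+\<omega>. occ \<rho> A w \<pi> \<omega> * Y \<omega> \<partial>M) = (\<integral>\<^sup>+p\<in>A. (\<integral>\<^sup>+\<omega>. ennreal (heat (w p) (Bp (\<pi> p) \<omega>)) * Y \<omega> \<partial>M) \<partial>\<rho>)"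
proof -
  interpret R: finite_measure \<rho> by fact
  interpret P: pair_sigma_finite M \<rho> ..
  note m = occ_integrand_measurable[OF \<rho>(2) A w \<pi>]
  have m1: "(\<lambda>p. ennreal (heat (w p) (Bp (\<pi> p) \<omega>)) * indicator A p) \<in> borel_measurable \<rho>" if "\<omega> \<in> space M" for \<omega>
    using measurable_compose[OF measurable_Pair1'[OF that] m] by simp
  have "(\<integral>\<^sup>+\<omega>. occ \<rho> A w \<pi> \<omega> * Y \<omega> \<partial>M) = (\<integral>\<^sup>+\<omega>. (\<integral>\<^sup>+p. (ennreal (heat (w p) (Bp (\<pi> p) \<omega>)) * indicator A p) * Y \<omega> \<partial>\<rho>) \<partial>M)"
    unfolding occ_def by (intro nn_integral_cong nn_integral_multc[symmetric] m1)
  also have "\<dots> = (\<integral>\<^sup>+p. (\<integral>\<^sup>+\<omega>. (ennreal (heat (w p) (Bp (\<pi> p) \<omega>)) * indicator A p) * Y \<omega> \<partial>M) \<partial>\<rho>)"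
  proof (rule P.Fubini'[symmetric])
    have "(\<lambda>x. (\<lambda>(\<omega>, p). ennreal (heat (w p) (Bp (\<pi> p) \<omega>)) * indicator A p) x * Y (fst x)) \<in> borel_measurable (M \<Otimes>\<^sub>M \<rho>)"
      using m Y by (intro borel_measurable_times_ennreal measurable_compose[OF measurable_fst])
    then show "(\<lambda>(\<omega>, p). (ennreal (heat (w p) (Bp (\<pi> p) \<omega>)) * indicator A p) * Y \<omega>) \<in> borel_measurable (M \<Otimes>\<^sub>M \<rho>)"
      by (simp add: case_prod_beta')
  qed
  also have "\<dots> = (\<integral>\<^sup>+p\<in>A. (\<integral>\<^sup>+\<omega>. ennreal (heat (w p) (Bp (\<pi> p) \<omega>)) * Y \<omega> \<partial>M) \<partial>\<rho>)"
    by (intro nn_integral_cong) (auto simp: indicator_def)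
  finally show ?thesis .
qed

lemma occ_bound:
  assumes \<rho>: "finite_measure \<rho>" and e: "0 < e" "\<And>p. p \<in> A \<Longrightarrow> e \<le> w p"
  shows "occ \<rho> A w \<pi> \<omega> \<le> ennreal (heat e (0 :: real ^ 'd) * measure \<rho> (space \<rho>))"
proof -
  interpret finite_measure \<rho> by fact
  have "occ \<rho> A w \<pi> \<omega> \<le> (\<integral>\<^sup>+p. ennreal (heat e (0 :: real ^ 'd)) \<partial>\<rho>)"
    unfolding occ_def
  proof (rule nn_integral_mono)
    fix p
    have "heat (w p) (Bp (\<pi> p) \<omega>) \<le> heat e (0 :: real ^ 'd)" if "p \<in> A"
      using e(2)[OF that] e(1) heat_le_zero[of "w p" "Bp (\<pi> p) \<omega>"] heat_zero_antimono[of e "w p"] by (meson less_le_trans order_trans)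
    then show "ennreal (heat (w p) (Bp (\<pi> p) \<omega>)) * indicator A p \<le> ennreal (heat e (0 :: real ^ 'd))"
      by (auto simp: indicator_def intro: ennreal_leI)
  qed
  also have "\<dots> = ennreal (heat e (0 :: real ^ 'd) * measure \<rho> (space \<rho>))"
    by (simp add: emeasure_eq_measure ennreal_mult heat_nonneg)
  finally show ?thesis .
qed

lemma Bp_eq: "0 \<le> fst p \<Longrightarrow> 0 \<le> snd p \<Longrightarrow> Bp p = B (fst p) (snd p)"
  by (auto simp: Bp_def fun_eq_iff max_def)

lemma Bp_measurable [measurable]: "Bp p \<in> borel_measurable M"
  unfolding Bp_def[abs_def] by (intro B_measurable) auto

abbreviation occ_total :: "(real \<times> real) measure \<Rightarrow> real \<Rightarrow> 'a \<Rightarrow> ennreal" where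
  "occ_total \<rho> e \<equiv> occ \<rho> UNIV (\<lambda>_. e) (\<lambda>p. p)"

lemma occ_total_measurable:
  "finite_measure \<rho> \<Longrightarrow> sets \<rho> = sets borel \<Longrightarrow> occ_total \<rho> e \<in> borel_measurable M"
  by (intro occ_measurable) measurable

text \<open>Tonelli turns the square into a double integral of two-point moments, each bounded by a
  power of e + |s - u| + |t - v|. Integrating over v gives the slab kernel, integrating over t the
  length of the interval. That \<open>C\<close> precedes \<open>e\<close> in the order of choice is
  essential for letting \<open>e\<close> tend to 0.\<close>

lemma occ_second_moment:
  assumes \<mu>: "prob_space \<mu>" "sets \<mu> = sets borel" and a: "0 < a" "AE s in \<mu>. a \<le> s" "a \<le> \<alpha>" and "\<alpha> \<le> \<gamma>"
  obtains C :: real where "0 \<le> C"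
    "\<And>e. 0 < e \<Longrightarrow> (\<integral>\<^sup>+\<omega>. (occ_total (strip \<mu> \<alpha> \<gamma>) e \<omega>)\<^sup>2 \<partial>M) \<le>
       ennreal C * (\<integral>\<^sup>+x. (\<integral>\<^sup>+y. slab_kernel CARD('d) e \<bar>x - y\<bar> \<partial>\<mu>) \<partial>\<mu>)"
proof -
  interpret mu: prob_space \<mu> by fact
  let ?d = "- real CARD('d) / 2"
  define N where "N = nat \<lceil>\<gamma> - \<alpha>\<rceil> + 1"
  have N: "\<gamma> - \<alpha> < real N" unfolding N_def by linarith
  \<comment> \<open>Chosen so that \<open>m * (e + x)\<close> lies below
    \<open>2 * e + a * x\<close>: the two coefficients merge into one constant.\<close>
  define m where "m = min 1 a"
  have m: "m > 0" using a by (simp add: m_def)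
  define C1 where "C1 = m powr ?d * heat (a * a) (0 :: real ^ 'd)"
  have C1: "C1 \<ge> 0" by (simp add: C1_def heat_nonneg)
  define C where "C = C1 * (2 * real N) * (\<gamma> - \<alpha>)"
  have C: "C \<ge> 0" using C1 \<open>\<alpha> \<le> \<gamma>\<close> by (simp add: C_def)
  let ?\<rho> = "strip \<mu> \<alpha> \<gamma>"
  note \<rho> = finite_measure_strip[OF \<mu> \<open>\<alpha> \<le> \<gamma>\<close>] sets_strip[OF \<mu>(2), of \<alpha> \<gamma>]
  have heat_le: "heat (2 * e + a * x) (0 :: real ^ 'd) * heat (a * a) (0 :: real ^ 'd) \<le> C1 * (e + x) powr ?d"
    if "0 < e" "0 \<le> x" for e x
  proof -
    have p: "0 < 2 * e + a * x" using that a by (simp add: add_pos_nonneg)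
    have "m * (e + x) \<le> e + a * x"
    proof -
      have "m * e \<le> 1 * e" "m * x \<le> a * x"
        using that by (intro mult_right_mono; simp add: m_def)+
      then show ?thesis by (simp add: distrib_left)
    qed
    also have "\<dots> \<le> 1 * (2 * e + a * x)" using that by simp
    also have "\<dots> \<le> (2 * pi) * (2 * e + a * x)" using p pi_gt3 by (intro mult_right_mono) auto
    finally have "(2 * pi * (2 * e + a * x)) powr ?d \<le> (m * (e + x)) powr ?d"
      using m that by (intro powr_mono2') auto
    also have "\<dots> = m powr ?d * (e + x) powr ?d" using m that by (simp add: powr_mult)
    finally have "heat (2 * e + a * x) (0 :: real ^ 'd) \<le> m powr ?d * (e + x) powr ?d" using heat_zero[OF p, where 'd='d] by simp
    then have "heat (2 * e + a * x) (0 :: real ^ 'd) * heat (a * a) (0 :: real ^ 'd) \<le> (m powr ?d * (e + x) powr ?d) * heat (a * a) (0 :: real ^ 'd)"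
      by (intro mult_right_mono heat_nonneg)
    then show ?thesis by (simp add: C1_def mult_ac)
  qed
  show thesis
  proof (rule that[OF C])
    fix e :: real assume e: "0 < e"
    have [measurable]: "occ_total ?\<rho> e \<in> borel_measurable M" by (rule occ_total_measurable[OF \<rho>])
    have [measurable]: "(\<lambda>\<omega>. ennreal (heat e (Bp p \<omega>))) \<in> borel_measurable M" for p by measurable
    define g where "g q p = (\<integral>\<^sup>+\<omega>. ennreal (heat e (Bp q \<omega>)) * ennreal (heat e (Bp p \<omega>)) \<partial>M)" for q p
    have gm: "case_prod g \<in> borel_measurable (borel \<Otimes>\<^sub>M borel)"
    proof -
      have "(\<lambda>x :: ((real \<times> real) \<times> (real \<times> real)) \<times> 'a. Bp (fst (fst x)) (snd x)) \<in> borel_measurable ((borel \<Otimes>\<^sub>M borel) \<Otimes>\<^sub>M M)"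
        "(\<lambda>x :: ((real \<times> real) \<times> (real \<times> real)) \<times> 'a. Bp (snd (fst x)) (snd x)) \<in> borel_measurable ((borel \<Otimes>\<^sub>M borel) \<Otimes>\<^sub>M M)"
        using measurable_compose[OF _ Bp_measurable_pair, of "\<lambda>x. (fst (fst x), snd x)" "(borel \<Otimes>\<^sub>M borel) \<Otimes>\<^sub>M M"]
          measurable_compose[OF _ Bp_measurable_pair, of "\<lambda>x. (snd (fst x), snd x)" "(borel \<Otimes>\<^sub>M borel) \<Otimes>\<^sub>M M"]
        by auto
      then show ?thesis unfolding g_def by measurable
    qed
    have gm1: "g q \<in> borel_measurable borel" for q
      using measurable_compose[OF measurable_Pair1' gm, of q] by simp
    have gm2: "(\<lambda>q. \<integral>\<^sup>+p. g q p \<partial>?\<rho>) \<in> borel_measurable borel"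
    proof -
      interpret R: finite_measure ?\<rho> by (rule \<rho>)
      show ?thesis
        by (rule R.borel_measurable_nn_integral)
          (use gm measurable_cong_sets[OF sets_pair_measure_cong[OF refl \<rho>(2)]] in blast)
    qed
    have "(\<integral>\<^sup>+\<omega>. (occ_total ?\<rho> e \<omega>)\<^sup>2 \<partial>M) = (\<integral>\<^sup>+\<omega>. occ_total ?\<rho> e \<omega> * occ_total ?\<rho> e \<omega> \<partial>M)"
      by (simp add: power2_eq_square)
    also have "\<dots> = (\<integral>\<^sup>+q. (\<integral>\<^sup>+\<omega>. ennreal (heat e (Bp q \<omega>)) * occ_total ?\<rho> e \<omega> \<partial>M) \<partial>?\<rho>)"
      by (subst nn_integral_occ_times[OF \<rho>]) auto
    also have "\<dots> = (\<integral>\<^sup>+q. (\<integral>\<^sup>+\<omega>. occ_total ?\<rho> e \<omega> * ennreal (heat e (Bp q \<omega>)) \<partial>M) \<partial>?\<rho>)"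
      by (simp add: mult.commute)
    also have "\<dots> = (\<integral>\<^sup>+q. (\<integral>\<^sup>+p. g p q \<partial>?\<rho>) \<partial>?\<rho>)"
      unfolding g_def by (subst nn_integral_occ_times[OF \<rho>]) auto
    also have "\<dots> = (\<integral>\<^sup>+q. (\<integral>\<^sup>+p. g q p \<partial>?\<rho>) \<partial>?\<rho>)"
      by (simp add: g_def mult.commute)
    also have "\<dots> = (\<integral>\<^sup>+s. (\<integral>\<^sup>+t\<in>{\<alpha>..\<gamma>}. (\<integral>\<^sup>+u. (\<integral>\<^sup>+v\<in>{\<alpha>..\<gamma>}. g (s, t) (u, v) \<partial>lborel) \<partial>\<mu>) \<partial>lborel) \<partial>\<mu>)"
      by (subst nn_integral_strip[OF \<mu>(2) gm2]) (simp only: nn_integral_strip[OF \<mu>(2) gm1])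
    also have "\<dots> \<le> (\<integral>\<^sup>+s. (\<integral>\<^sup>+t\<in>{\<alpha>..\<gamma>}. (\<integral>\<^sup>+u. ennreal (C1 * (2 * real N)) * slab_kernel CARD('d) e \<bar>s - u\<bar> \<partial>\<mu>) \<partial>lborel) \<partial>\<mu>)"
    proof (rule nn_integral_mono_AE, rule AE_mp[OF a(2)], rule AE_I2, rule impI, rule nn_integral_mono)
      fix s t :: real assume s: "a \<le> s"
      have "(\<integral>\<^sup>+u. (\<integral>\<^sup>+v\<in>{\<alpha>..\<gamma>}. g (s, t) (u, v) \<partial>lborel) \<partial>\<mu>) \<le> (\<integral>\<^sup>+u. ennreal (C1 * (2 * real N)) * slab_kernel CARD('d) e \<bar>s - u\<bar> \<partial>\<mu>)"
        if t: "t \<in> {\<alpha>..\<gamma>}"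
      proof (rule nn_integral_mono_AE, rule AE_mp[OF a(2)], rule AE_I2, rule impI)
        fix u assume u: "a \<le> u"
        have "(\<integral>\<^sup>+v\<in>{\<alpha>..\<gamma>}. g (s, t) (u, v) \<partial>lborel) \<le> (\<integral>\<^sup>+v. ennreal C1 * (ennreal ((e + \<bar>s - u\<bar> + \<bar>t - v\<bar>) powr ?d) * indicator {\<alpha>..\<gamma>} v) \<partial>lborel)"
        proof (rule nn_integral_mono)
          fix v :: real
          show "g (s, t) (u, v) * indicator {\<alpha>..\<gamma>} v \<le> ennreal C1 * (ennreal ((e + \<bar>s - u\<bar> + \<bar>t - v\<bar>) powr ?d) * indicator {\<alpha>..\<gamma>} v)"
          proof (cases "v \<in> {\<alpha>..\<gamma>}")
            case True
            have "g (s, t) (u, v) \<le> ennreal (heat (2 * e + a * (\<bar>s - u\<bar> + \<bar>t - v\<bar>)) (0 :: real ^ 'd) * heat (a * a) (0 :: real ^ 'd))"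
              unfolding g_def using heat_second_moment[of a s t u v e] True t s u a e by (simp add: Bp_eq)
            also have "\<dots> \<le> ennreal (C1 * (e + (\<bar>s - u\<bar> + \<bar>t - v\<bar>)) powr ?d)"
              by (intro ennreal_leI heat_le e) auto
            also have "\<dots> = ennreal C1 * ennreal ((e + \<bar>s - u\<bar> + \<bar>t - v\<bar>) powr ?d)"
              using C1 by (simp add: ennreal_mult add.assoc)
            finally show ?thesis using True by simp
          qed auto
        qed
        also have "\<dots> = ennreal C1 * (\<integral>\<^sup>+v\<in>{\<alpha>..\<gamma>}. ennreal ((e + \<bar>s - u\<bar> + \<bar>t - v\<bar>) powr ?d) \<partial>lborel)"
          by (rule nn_integral_cmult) measurable
        also have "\<dots> \<le> ennreal C1 * (ennreal (2 * real N) * slab_kernel CARD('d) e \<bar>s - u\<bar>)"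
          using t N e by (intro mult_left_mono nn_integral_distance_le_slab) auto
        finally show "(\<integral>\<^sup>+v\<in>{\<alpha>..\<gamma>}. g (s, t) (u, v) \<partial>lborel) \<le> ennreal (C1 * (2 * real N)) * slab_kernel CARD('d) e \<bar>s - u\<bar>"
          using C1 by (simp add: ennreal_mult mult_ac)
      qed
      then show "(\<integral>\<^sup>+u. (\<integral>\<^sup>+v\<in>{\<alpha>..\<gamma>}. g (s, t) (u, v) \<partial>lborel) \<partial>\<mu>) * indicator {\<alpha>..\<gamma>} t \<le>
        (\<integral>\<^sup>+u. ennreal (C1 * (2 * real N)) * slab_kernel CARD('d) e \<bar>s - u\<bar> \<partial>\<mu>) * indicator {\<alpha>..\<gamma>} t"
        by (auto simp: indicator_def)
    qed
    also have "\<dots> = (\<integral>\<^sup>+s. ennreal C * (\<integral>\<^sup>+u. slab_kernel CARD('d) e \<bar>s - u\<bar> \<partial>\<mu>) \<partial>\<mu>)"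
    proof (rule nn_integral_cong)
      fix s
      have [measurable]: "(\<lambda>u. slab_kernel CARD('d) e \<bar>s - u\<bar>) \<in> borel_measurable \<mu>"
        unfolding measurable_cong_sets[OF \<mu>(2) refl] by measurable
      define I where "I = (\<integral>\<^sup>+u. slab_kernel CARD('d) e \<bar>s - u\<bar> \<partial>\<mu>)"
      have "(\<integral>\<^sup>+u. ennreal (C1 * (2 * real N)) * slab_kernel CARD('d) e \<bar>s - u\<bar> \<partial>\<mu>) = ennreal (C1 * (2 * real N)) * I"
        unfolding I_def by (rule nn_integral_cmult) simp
      moreover have "(\<integral>\<^sup>+t\<in>{\<alpha>..\<gamma>}. ennreal (C1 * (2 * real N)) * I \<partial>lborel) = ennreal (C1 * (2 * real N)) * I * ennreal (\<gamma> - \<alpha>)"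
        using \<open>\<alpha> \<le> \<gamma>\<close> by (subst nn_integral_cmult) auto
      moreover have "ennreal C = ennreal (C1 * (2 * real N)) * ennreal (\<gamma> - \<alpha>)"
        unfolding C_def using \<open>\<alpha> \<le> \<gamma>\<close> C1 by (intro ennreal_mult) auto
      ultimately show "(\<integral>\<^sup>+t\<in>{\<alpha>..\<gamma>}. (\<integral>\<^sup>+u. ennreal (C1 * (2 * real N)) * slab_kernel CARD('d) e \<bar>s - u\<bar> \<partial>\<mu>) \<partial>lborel)
         = ennreal C * (\<integral>\<^sup>+u. slab_kernel CARD('d) e \<bar>s - u\<bar> \<partial>\<mu>)"
        unfolding I_def[symmetric] by (simp add: mult.assoc mult.commute mult.left_commute)
    qed
    also have "\<dots> = ennreal C * (\<integral>\<^sup>+s. (\<integral>\<^sup>+u. slab_kernel CARD('d) e \<bar>s - u\<bar> \<partial>\<mu>) \<partial>\<mu>)"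
    proof (rule nn_integral_cmult)
      have "(\<lambda>s. \<integral>\<^sup>+u. slab_kernel CARD('d) e \<bar>s - u\<bar> \<partial>\<mu>) \<in> borel_measurable borel"
      proof (rule mu.borel_measurable_nn_integral)
        have "(\<lambda>(s, u). slab_kernel CARD('d) e \<bar>s - u\<bar>) \<in> borel_measurable (borel \<Otimes>\<^sub>M borel)" by measurable
        then show "(\<lambda>(s, u). slab_kernel CARD('d) e \<bar>s - u\<bar>) \<in> borel_measurable (borel \<Otimes>\<^sub>M \<mu>)"
          using measurable_cong_sets[OF sets_pair_measure_cong[OF refl \<mu>(2)]] by blast
      qed
      then show "(\<lambda>s. \<integral>\<^sup>+u. slab_kernel CARD('d) e \<bar>s - u\<bar> \<partial>\<mu>) \<in> borel_measurable \<mu>"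
        unfolding measurable_cong_sets[OF \<mu>(2) refl] .
    qed
    finally show "(\<integral>\<^sup>+\<omega>. (occ_total ?\<rho> e \<omega>)\<^sup>2 \<partial>M) \<le> ennreal C * (\<integral>\<^sup>+x. (\<integral>\<^sup>+y. slab_kernel CARD('d) e \<bar>x - y\<bar> \<partial>\<mu>) \<partial>\<mu>)" .
  qed
qed

end

section \<open>Positive capacity implies hitting\<close>

lemma power_times_exp_LIMSEQ_0:
  fixes q :: real assumes "0 < q"
  shows "(\<lambda>n. real (Suc n) ^ k * exp (- (q * real (Suc n)))) \<longlonglongrightarrow> 0"
proof -
  have "filterlim (\<lambda>n. q * real (Suc n)) at_top sequentially"
    using assms by (intro filterlim_tendsto_pos_mult_at_top[OF tendsto_const]
        filterlim_compose[OF filterlim_real_sequentially] filterlim_Suc)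
  from filterlim_compose[OF tendsto_power_div_exp_0 this]
  have "(\<lambda>n. (q * real (Suc n)) ^ k / exp (q * real (Suc n))) \<longlonglongrightarrow> 0" .
  then have "(\<lambda>n. inverse (q ^ k) * ((q * real (Suc n)) ^ k / exp (q * real (Suc n)))) \<longlonglongrightarrow> inverse (q ^ k) * 0"
    by (intro tendsto_intros)
  moreover have "inverse (q ^ k) * ((q * x) ^ k / exp (q * x)) = x ^ k * exp (- (q * x))" for x
    using assms by (simp add: exp_minus power_mult_distrib field_simps)
  ultimately show ?thesis by (simp only: mult_zero_right)
qed

lemma (in prob_space) limsup_events_prob_ge:
  assumes A: "\<And>n::nat. A n \<in> sets M" and \<delta>: "\<And>n. \<delta> \<le> emeasure M (A n)"
  shows "\<delta> \<le> emeasure M (\<Inter>m. \<Union>n\<in>{m..}. A n)"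
proof -
  have "emeasure M (\<Inter>m. \<Union>n\<in>{m..}. A n) = (INF m. emeasure M (\<Union>n\<in>{m..}. A n))"
  proof (rule INF_emeasure_decseq[symmetric])
    show "decseq (\<lambda>m. \<Union>n\<in>{m..}. A n)" unfolding decseq_def by (intro allI impI UN_mono) auto
  qed (use A in \<open>auto simp: emeasure_eq_measure\<close>)
  also have "\<delta> \<le> \<dots>"
  proof (rule INF_greatest)
    fix m
    have "\<delta> \<le> emeasure M (A m)" by (rule \<delta>)
    also have "\<dots> \<le> emeasure M (\<Union>n\<in>{m..}. A n)" using A by (intro emeasure_mono) auto
    finally show "\<delta> \<le> emeasure M (\<Union>n\<in>{m..}. A n)" .
  qed
  finally show ?thesis .
qed

text \<open>Values of \<open>X\<close> below \<open>c / 2\<close> contribute at most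
  \<open>c / 2\<close> to the mean, so the event carries at least \<open>c / 2\<close>.
  Cauchy-Schwarz against its indicator then gives
  \<open>(c / 2)\<^sup>2 \<le> K * measure M A\<close>.\<close>

lemma (in prob_space) Paley_Zygmund_half:
  assumes X [measurable]: "X \<in> borel_measurable M" and c: "0 < c" "ennreal c \<le> (\<integral>\<^sup>+\<omega>. X \<omega> \<partial>M)"
    and K: "0 < K" "(\<integral>\<^sup>+\<omega>. (X \<omega>)\<^sup>2 \<partial>M) \<le> ennreal K"
  shows "ennreal (c\<^sup>2 / (4 * K)) \<le> emeasure M {\<omega> \<in> space M. ennreal (c / 2) \<le> X \<omega>}"
proof -
  define A where "A = {\<omega> \<in> space M. ennreal (c / 2) \<le> X \<omega>}"
  have [measurable]: "A \<in> sets M" unfolding A_def by measurable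
  have "(\<integral>\<^sup>+\<omega>. X \<omega> \<partial>M) \<le> (\<integral>\<^sup>+\<omega>. ennreal (c / 2) + X \<omega> * indicator A \<omega> \<partial>M)"
    by (intro nn_integral_mono) (auto simp: A_def indicator_def)
  also have "\<dots> = ennreal (c / 2) + (\<integral>\<^sup>+\<omega>. X \<omega> * indicator A \<omega> \<partial>M)"
    by (subst nn_integral_add) (auto simp: emeasure_space_1)
  finally have "ennreal (c / 2) + ennreal (c / 2) \<le> ennreal (c / 2) + (\<integral>\<^sup>+\<omega>. X \<omega> * indicator A \<omega> \<partial>M)"
    using c by (simp flip: ennreal_plus)
  then have 1: "ennreal (c / 2) \<le> (\<integral>\<^sup>+\<omega>. X \<omega> * indicator A \<omega> \<partial>M)" by (subst (asm) ennreal_add_left_cancel_le) auto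
  have "(ennreal (c / 2))\<^sup>2 \<le> (\<integral>\<^sup>+\<omega>. X \<omega> * indicator A \<omega> \<partial>M)\<^sup>2" by (intro power_mono 1) auto
  also have "\<dots> \<le> (\<integral>\<^sup>+\<omega>. (X \<omega>)\<^sup>2 \<partial>M) * (\<integral>\<^sup>+\<omega>. (indicator A \<omega>)\<^sup>2 \<partial>M)"
    by (intro Cauchy_Schwarz_nn_integral) auto
  also have "(\<integral>\<^sup>+\<omega>. (indicator A \<omega> :: ennreal)\<^sup>2 \<partial>M) = (\<integral>\<^sup>+\<omega>. indicator A \<omega> \<partial>M)"
    by (intro nn_integral_cong) (auto simp: indicator_def)
  also have "\<dots> = emeasure M A" by simp
  also have "(\<integral>\<^sup>+\<omega>. (X \<omega>)\<^sup>2 \<partial>M) * emeasure M A \<le> ennreal K * emeasure M A" by (intro mult_right_mono K) auto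
  finally have "ennreal ((c / 2)\<^sup>2) \<le> ennreal (K * measure M A)"
    using c K by (simp add: ennreal_power emeasure_eq_measure ennreal_mult)
  then have "(c / 2)\<^sup>2 \<le> K * measure M A" using K by (subst (asm) ennreal_le_iff) auto
  then have "c\<^sup>2 / (4 * K) \<le> measure M A" using K by (simp add: field_simps power2_eq_square)
  then show ?thesis unfolding A_def[symmetric] by (simp add: emeasure_eq_measure ennreal_leI)
qed

context sheet
begin

text \<open>A continuous path without zeros on the compact set has a positive minimal norm there, so
  with variance 1/N the kernel is at most a power of N times exp(-q N), uniformly on the support of
  \<rho>.\<close>

lemma occ_total_tendsto_0:
  assumes \<rho>: "finite_measure \<rho>" "sets \<rho> = sets borel" and K: "compact K" "AE p in \<rho>. p \<in> K"
    and \<omega>: "\<omega> \<in> space M" and nz: "\<And>p. p \<in> K \<Longrightarrow> Bp p \<omega> \<noteq> 0" and c: "0 < c"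
  shows "\<forall>\<^sub>F n in sequentially. occ_total \<rho> (1 / real (Suc n)) \<omega> < ennreal c"
proof (cases "K = {}")
  case True
  then have "occ_total \<rho> e \<omega> = 0" for e
    unfolding occ_def using K(2) by (subst nn_integral_cong_AE[where v="\<lambda>_. 0"]) auto
  then show ?thesis using c by simp
next
  case False
  interpret finite_measure \<rho> by fact
  let ?m = "measure \<rho> (space \<rho>)"
  have "continuous_on K (\<lambda>p. norm (Bp p \<omega>))"
    by (intro continuous_intros continuous_on_subset[OF Bp_continuous[OF \<omega>]]) auto
  from continuous_attains_inf[OF K(1) False this] obtain p0 where
    p0: "p0 \<in> K" "\<And>p. p \<in> K \<Longrightarrow> norm (Bp p0 \<omega>) \<le> norm (Bp p \<omega>)" by auto
  define q where "q = (norm (Bp p0 \<omega>))\<^sup>2 / 2"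
  have q: "q > 0" using nz[OF p0(1)] by (simp add: q_def)
  have le: "occ_total \<rho> (1 / real (Suc n)) \<omega> \<le> ennreal (real (Suc n) ^ CARD('d) * exp (- (q * real (Suc n))) * ?m)" for n
  proof -
    let ?e = "1 / real (Suc n)"
    have hb: "heat ?e (Bp p \<omega>) \<le> real (Suc n) ^ CARD('d) * exp (- (q * real (Suc n)))" if "p \<in> K" for p
    proof -
      \<comment> \<open>Crude on purpose: dropping 2 pi and raising the exponent from d/2 to d
        leaves an integer power.\<close>
      have "(2 * pi * ?e) powr (- real CARD('d) / 2) \<le> ?e powr (- real CARD('d) / 2)"
      proof (rule powr_mono2')
        show "?e \<le> 2 * pi * ?e" using pi_gt3 mult_right_mono[of 1 "2 * pi" ?e] by simp
      qed auto
      also have "\<dots> = real (Suc n) powr (real CARD('d) / 2)" by (simp add: powr_minus powr_divide)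
      also have "\<dots> \<le> real (Suc n) powr (real CARD('d))" by (intro powr_mono) auto
      also have "\<dots> = real (Suc n) ^ CARD('d)" by (simp add: powr_realpow)
      finally have 1: "(2 * pi * ?e) powr (- real CARD('d) / 2) \<le> real (Suc n) ^ CARD('d)" .
      have "(norm (Bp p0 \<omega>))\<^sup>2 \<le> (norm (Bp p \<omega>))\<^sup>2" using p0(2)[OF that] by (intro power_mono) auto
      then have "(norm (Bp p0 \<omega>))\<^sup>2 * real (Suc n) \<le> (norm (Bp p \<omega>))\<^sup>2 * real (Suc n)" by (intro mult_right_mono) auto
      then have 2: "exp (- (norm (Bp p \<omega>))\<^sup>2 / (2 * ?e)) \<le> exp (- (q * real (Suc n)))" by (simp add: q_def del: of_nat_Suc)
      show ?thesis
        using mult_mono[OF 1 2] by (subst heat_eq) (auto simp del: of_nat_Suc)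
    qed
    have "occ_total \<rho> ?e \<omega> \<le> (\<integral>\<^sup>+p. ennreal (real (Suc n) ^ CARD('d) * exp (- (q * real (Suc n)))) \<partial>\<rho>)"
      unfolding occ_def using K(2)
      by (intro nn_integral_mono_AE) (auto intro!: ennreal_leI hb simp del: of_nat_Suc elim!: eventually_mono)
    also have "\<dots> = ennreal (real (Suc n) ^ CARD('d) * exp (- (q * real (Suc n))) * ?m)"
      by (simp add: emeasure_eq_measure ennreal_mult del: of_nat_Suc)
    finally show ?thesis .
  qed
  have "(\<lambda>n. real (Suc n) ^ CARD('d) * exp (- (q * real (Suc n))) * ?m) \<longlonglongrightarrow> 0 * ?m"
    by (intro tendsto_mult tendsto_const power_times_exp_LIMSEQ_0 q)
  then have "\<forall>\<^sub>F n in sequentially. real (Suc n) ^ CARD('d) * exp (- (q * real (Suc n))) * ?m < c"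
    using c by (auto dest: order_tendstoD(2))
  then show ?thesis
  proof (rule eventually_mono)
    fix n assume "real (Suc n) ^ CARD('d) * exp (- (q * real (Suc n))) * ?m < c"
    then have "ennreal (real (Suc n) ^ CARD('d) * exp (- (q * real (Suc n))) * ?m) < ennreal c"
      by (intro ennreal_lessI c)
    then show "occ_total \<rho> (1 / real (Suc n)) \<omega> < ennreal c" using le[of n] by order
  qed
qed

text \<open>Positive times are exhausted by the compact intervals [1/N, N], and on each of them the
  zero event concerns a compact set.\<close>

lemma hit_event_measurable:
  assumes F: "compact F" "F \<subseteq> {0<..}"
  shows "{\<omega> \<in> space M. \<exists>s\<in>F. \<exists>t>0. B s t \<omega> = 0} =
      (\<Union>n. {\<omega> \<in> space M. \<exists>p\<in>F \<times> {1 / real (Suc n)..real (Suc n)}. Bp p \<omega> = 0})"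
    and "{\<omega> \<in> space M. \<exists>s\<in>F. \<exists>t>0. B s t \<omega> = 0} \<in> sets M"
proof -
  show eq: "{\<omega> \<in> space M. \<exists>s\<in>F. \<exists>t>0. B s t \<omega> = 0} =
      (\<Union>n. {\<omega> \<in> space M. \<exists>p\<in>F \<times> {1 / real (Suc n)..real (Suc n)}. Bp p \<omega> = 0})"
  proof (intro equalityI subsetI)
    fix \<omega> assume "\<omega> \<in> {\<omega> \<in> space M. \<exists>s\<in>F. \<exists>t>0. B s t \<omega> = 0}"
    then obtain s t where st: "\<omega> \<in> space M" "s \<in> F" "t > 0" "B s t \<omega> = 0" by auto
    obtain n where n: "max t (1 / t) < real n" using reals_Archimedean2 by blast
    have "1 / t < real (Suc n)" using n by simp
    then have "1 / real (Suc n) \<le> t" using st(3) by (simp add: field_simps)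
    moreover have "t \<le> real (Suc n)" using n by simp
    moreover have "Bp (s, t) \<omega> = 0" using st F by (subst Bp_eq) (auto simp: less_imp_le subset_eq)
    ultimately have "\<exists>p\<in>F \<times> {1 / real (Suc n)..real (Suc n)}. Bp p \<omega> = 0"
      using st(2) by (intro bexI[of _ "(s, t)"]) auto
    then show "\<omega> \<in> (\<Union>n. {\<omega> \<in> space M. \<exists>p\<in>F \<times> {1 / real (Suc n)..real (Suc n)}. Bp p \<omega> = 0})"
      using st(1) by blast
  next
    fix \<omega> assume "\<omega> \<in> (\<Union>n. {\<omega> \<in> space M. \<exists>p\<in>F \<times> {1 / real (Suc n)..real (Suc n)}. Bp p \<omega> = 0})"
    then obtain n s t where st: "\<omega> \<in> space M" "s \<in> F" "1 / real (Suc n) \<le> t" "Bp (s, t) \<omega> = 0" by auto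
    have t: "t > 0" using st(3) by (rule less_le_trans[rotated]) simp
    have "B s t \<omega> = 0" using st t F by (subst (asm) Bp_eq) (auto simp: less_imp_le subset_eq)
    then show "\<omega> \<in> {\<omega> \<in> space M. \<exists>s\<in>F. \<exists>t>0. B s t \<omega> = 0}" using st t by auto
  qed
  show "{\<omega> \<in> space M. \<exists>s\<in>F. \<exists>t>0. B s t \<omega> = 0} \<in> sets M"
    unfolding eq using F by (intro sets.countable_UN image_subsetI zero_event_measurable compact_Times) auto
qed

lemma hit_prob_pos_if_capacity_pos:
  assumes F: "compact F" "F \<subseteq> {0<..}" and cap: "riesz_capacity ((real CARD('d) - 2) / 2) F > 0"
  shows "measure M {\<omega> \<in> space M. \<exists>s\<in>F. \<exists>t>0. B s t \<omega> = 0} > 0"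
proof -
  let ?\<beta> = "(real CARD('d) - 2) / 2"
  have "(INF \<mu>\<in>prob_measures_on F. riesz_energy ?\<beta> \<mu>) < \<top>"
    using cap unfolding riesz_capacity_def by (metis ennreal_inverse_top less_irrefl top.not_eq_extremum)
  then obtain \<mu> where \<mu>F: "\<mu> \<in> prob_measures_on F" and fin: "riesz_energy ?\<beta> \<mu> < \<top>"
    by (auto simp: INF_less_iff)
  have \<mu>: "prob_space \<mu>" "sets \<mu> = sets borel" "emeasure \<mu> F = 1" using \<mu>F by (auto simp: prob_measures_on_def)
  interpret mu: prob_space \<mu> by fact
  have Fm: "F \<in> sets \<mu>" using F(1) \<mu>(2) by (simp add: borel_compact)
  have AEF: "AE s in \<mu>. s \<in> F"
    using \<mu>(3) Fm by (intro mu.AE_prob_1) (simp add: mu.emeasure_eq_measure)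
  have "F \<noteq> {}" using \<mu>(3) by auto
  obtain a0 where a0: "a0 \<in> F" "\<And>s. s \<in> F \<Longrightarrow> a0 \<le> s" using compact_attains_inf[OF F(1) \<open>F \<noteq> {}\<close>] by auto
  obtain b0 where b0: "b0 \<in> F" "\<And>s. s \<in> F \<Longrightarrow> s \<le> b0" using compact_attains_sup[OF F(1) \<open>F \<noteq> {}\<close>] by auto
  \<comment> \<open>A common lower bound for the points of \<open>F\<close> and for the times in
    [1, 2], as the second moment estimate requires.\<close>
  define a where "a = min a0 1"
  have a: "0 < a" "a \<le> 1" using a0 F by (auto simp: a_def)
  have AEa: "AE s in \<mu>. a \<le> s" using AEF by (rule eventually_mono) (use a0 in \<open>force simp: a_def\<close>)
  \<comment> \<open>Any compact interval of positive times would do, since a single zero at a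
    positive time is wanted.\<close>
  let ?\<rho> = "strip \<mu> 1 2"
  have \<rho>: "finite_measure ?\<rho>" "sets ?\<rho> = sets borel" using finite_measure_strip[OF \<mu>(1,2)] sets_strip[OF \<mu>(2)] by auto
  obtain C where C: "0 \<le> C" "\<And>e. 0 < e \<Longrightarrow> (\<integral>\<^sup>+\<omega>. (occ_total ?\<rho> e \<omega>)\<^sup>2 \<partial>M) \<le>
       ennreal C * (\<integral>\<^sup>+x. (\<integral>\<^sup>+y. slab_kernel CARD('d) e \<bar>x - y\<bar> \<partial>\<mu>) \<partial>\<mu>)"
    using occ_second_moment[OF \<mu>(1,2) a(1) AEa a(2), of 2] by auto
  obtain C2 where C2: "0 \<le> C2" "\<And>e h. 0 < e \<Longrightarrow> slab_kernel CARD('d) e \<bar>h\<bar> \<le> ennreal C2 * (1 + riesz_kernel ?\<beta> h)"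
    using slab_kernel_le_riesz[of "CARD('d)"] by (metis One_nat_def Suc_leI zero_less_card_finite)
  define E where "E = enn2real (riesz_energy ?\<beta> \<mu>)"
  have E: "riesz_energy ?\<beta> \<mu> = ennreal E" "0 \<le> E" using fin by (auto simp: E_def)
  \<comment> \<open>The added 1 keeps \<open>K\<close> positive, so that it can stand in a
    denominator.\<close>
  define K where "K = C * (C2 * (1 + E)) + 1"
  have K: "K > 0" using C C2 E by (simp add: K_def add_nonneg_pos)
  have second: "(\<integral>\<^sup>+\<omega>. (occ_total ?\<rho> e \<omega>)\<^sup>2 \<partial>M) \<le> ennreal K" if e: "0 < e" for e
  proof -
    have rm: "(\<lambda>y. riesz_kernel ?\<beta> (x - y)) \<in> borel_measurable \<mu>" for x :: real
      unfolding measurable_cong_sets[OF \<mu>(2) refl] by measurable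
    have rm2: "(\<lambda>x. \<integral>\<^sup>+y. riesz_kernel ?\<beta> (x - y) \<partial>\<mu>) \<in> borel_measurable \<mu>"
    proof (rule mu.borel_measurable_nn_integral)
      have "(\<lambda>(x :: real, y). riesz_kernel ?\<beta> (x - y)) \<in> borel_measurable (borel \<Otimes>\<^sub>M borel)" by measurable
      then show "(\<lambda>(x, y). riesz_kernel ?\<beta> (x - y)) \<in> borel_measurable (\<mu> \<Otimes>\<^sub>M \<mu>)"
        using measurable_cong_sets[OF sets_pair_measure_cong[OF \<mu>(2) \<mu>(2)]] by blast
    qed
    have "(\<integral>\<^sup>+x. (\<integral>\<^sup>+y. slab_kernel CARD('d) e \<bar>x - y\<bar> \<partial>\<mu>) \<partial>\<mu>)
       \<le> (\<integral>\<^sup>+x. (\<integral>\<^sup>+y. ennreal C2 * (1 + riesz_kernel ?\<beta> (x - y)) \<partial>\<mu>) \<partial>\<mu>)"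
      by (intro nn_integral_mono C2 e)
    also have "\<dots> = ennreal C2 * (1 + riesz_energy ?\<beta> \<mu>)"
      using rm rm2 by (simp add: nn_integral_cmult nn_integral_add mu.emeasure_space_1 riesz_energy_def)
    also have "\<dots> = ennreal (C2 * (1 + E))" using E C2 by (simp add: ennreal_mult ennreal_plus)
    finally have "ennreal C * (\<integral>\<^sup>+x. (\<integral>\<^sup>+y. slab_kernel CARD('d) e \<bar>x - y\<bar> \<partial>\<mu>) \<partial>\<mu>) \<le> ennreal C * ennreal (C2 * (1 + E))"
      by (intro mult_left_mono) auto
    also have "\<dots> \<le> ennreal K" using C C2 E by (simp add: K_def ennreal_mult'[symmetric] ennreal_leI)
    finally show ?thesis using C(2)[OF e] by order
  qed
  \<comment> \<open>\<open>1 + b0 * 2\<close> bounds the variance \<open>e + s * t\<close> for e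
    \<le> 1, s \<le> b0 and t \<le> 2, so \<open>c\<close> is a lower bound for the mean at every
    such point.\<close>
  define c where "c = heat (1 + b0 * 2) (0 :: real ^ 'd)"
  have b0p: "b0 > 0" using b0 F by auto
  have c: "c > 0" unfolding c_def using b0p by (subst heat_zero) (auto simp: add_pos_pos)
  have AE\<rho>: "AE p in ?\<rho>. p \<in> F \<times> {1..2}"
  proof (rule AE_I[where N="- (F \<times> {1..2})"])
    have m: "- (F \<times> {1..2}) \<in> sets (borel :: (real \<times> real) measure)"
      using F by (intro borel_comp borel_compact compact_Times) auto
    then show "- (F \<times> {1..2}) \<in> sets ?\<rho>" using \<rho>(2) by blast
    have "emeasure ?\<rho> (- (F \<times> {1..2::real})) = (\<integral>\<^sup>+p. indicator (- (F \<times> {1..2})) p \<partial>?\<rho>)"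
      using m \<rho>(2) by (intro nn_integral_indicator[symmetric]) simp
    also have "\<dots> = (\<integral>\<^sup>+s. (\<integral>\<^sup>+t\<in>{1..2}. indicator (- (F \<times> {1..2::real})) (s, t) \<partial>lborel) \<partial>\<mu>)"
      using m by (intro nn_integral_strip[OF \<mu>(2)]) auto
    also have "\<dots> = (\<integral>\<^sup>+s. 0 \<partial>\<mu>)"
      using AEF by (intro nn_integral_cong_AE) (auto elim!: eventually_mono simp: indicator_def cong: nn_integral_cong intro!: nn_integral_0_iff_AE[THEN iffD2])
    finally show "emeasure ?\<rho> (- (F \<times> {1..2})) = 0" by simp
  qed auto
  have first: "ennreal c \<le> (\<integral>\<^sup>+\<omega>. occ_total ?\<rho> e \<omega> \<partial>M)" if e: "0 < e" "e \<le> 1" for e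
  proof -
    have "ennreal c = (\<integral>\<^sup>+p. ennreal c \<partial>?\<rho>)"
      using emeasure_strip[OF \<mu>(1,2), of 1 2] sets_eq_imp_space_eq[OF \<rho>(2)] by simp
    also have "\<dots> \<le> (\<integral>\<^sup>+p. (\<integral>\<^sup>+\<omega>. ennreal (heat e (Bp p \<omega>)) \<partial>M) \<partial>?\<rho>)"
    proof (rule nn_integral_mono_AE, rule AE_mp[OF AE\<rho>], rule AE_I2, rule impI)
      fix p :: "real \<times> real" assume p: "p \<in> F \<times> {1..2}"
      have pos: "0 < fst p" "0 < snd p" using p F by auto
      have "fst p \<le> b0" "snd p \<le> 2" using p b0(2) by auto
      then have "fst p * snd p \<le> b0 * 2" using pos b0p by (intro mult_mono) simp_all
      then have "e + fst p * snd p \<le> 1 + b0 * 2" using e by linarith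
      then have "ennreal c \<le> ennreal (heat (e + fst p * snd p) (0 :: real ^ 'd))"
        unfolding c_def using e pos by (intro ennreal_leI heat_zero_antimono) (auto simp: add_pos_pos)
      also have "\<dots> = (\<integral>\<^sup>+\<omega>. ennreal (heat e (Bp p \<omega>)) \<partial>M)"
        using pos e by (simp add: Bp_eq nn_expectation_heat less_imp_le)
      finally show "ennreal c \<le> (\<integral>\<^sup>+\<omega>. ennreal (heat e (Bp p \<omega>)) \<partial>M)" .
    qed
    also have "\<dots> = (\<integral>\<^sup>+\<omega>. occ_total ?\<rho> e \<omega> \<partial>M)"
      using nn_integral_occ_times[OF \<rho>, of UNIV "\<lambda>_. e" "\<lambda>p. p" "\<lambda>_. 1"] by simp
    finally show ?thesis .
  qed
  define A where "A n = {\<omega> \<in> space M. ennreal (c / 2) \<le> occ_total ?\<rho> (1 / real (Suc n)) \<omega>}" for n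
  note [measurable] = occ_total_measurable[OF \<rho>]
  have Am: "A n \<in> sets M" for n unfolding A_def by measurable
  have "ennreal (c\<^sup>2 / (4 * K)) \<le> emeasure M (A n)" for n
    unfolding A_def by (intro Paley_Zygmund_half first second c K) auto
  then have lim: "ennreal (c\<^sup>2 / (4 * K)) \<le> emeasure M (\<Inter>m. \<Union>n\<in>{m..}. A n)"
    by (intro limsup_events_prob_ge Am)
  \<comment> \<open>A path in infinitely many \<open>A n\<close> keeps its mollified local time from
    tending to 0, which forces a zero on the compact set.\<close>
  have "(\<Inter>m. \<Union>n\<in>{m..}. A n) \<subseteq> {\<omega> \<in> space M. \<exists>s\<in>F. \<exists>t>0. B s t \<omega> = 0}"
  proof
    fix \<omega> assume \<omega>: "\<omega> \<in> (\<Inter>m. \<Union>n\<in>{m..}. A n)"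
    then have sp\<omega>: "\<omega> \<in> space M" by (auto simp: A_def)
    have "\<exists>p\<in>F \<times> {1..2}. Bp p \<omega> = 0"
    proof (rule ccontr)
      assume "\<not> (\<exists>p\<in>F \<times> {1..2}. Bp p \<omega> = 0)"
      then have "\<forall>\<^sub>F n in sequentially. occ_total ?\<rho> (1 / real (Suc n)) \<omega> < ennreal (c / 2)"
        using F c by (intro occ_total_tendsto_0[OF \<rho> compact_Times AE\<rho> sp\<omega>]) auto
      then obtain m where m: "\<And>n. n \<ge> m \<Longrightarrow> occ_total ?\<rho> (1 / real (Suc n)) \<omega> < ennreal (c / 2)"
        by (auto simp: eventually_sequentially)
      obtain n where "n \<ge> m" "\<omega> \<in> A n" using \<omega> by auto
      then show False using m[of n] by (auto simp: A_def not_less)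
    qed
    then obtain s t where st: "s \<in> F" "t \<in> {1..2}" "Bp (s, t) \<omega> = 0" by auto
    then have "0 < s" using F by auto
    then have "B s t \<omega> = 0" using st(2,3) by (subst (asm) Bp_eq) simp_all
    moreover have "t > 0" using st(2) by simp
    ultimately show "\<omega> \<in> {\<omega> \<in> space M. \<exists>s\<in>F. \<exists>t>0. B s t \<omega> = 0}" using st(1) sp\<omega> by blast
  qed
  then have "emeasure M (\<Inter>m. \<Union>n\<in>{m..}. A n) \<le> emeasure M {\<omega> \<in> space M. \<exists>s\<in>F. \<exists>t>0. B s t \<omega> = 0}"
    by (intro emeasure_mono hit_event_measurable F)
  then have "ennreal (c\<^sup>2 / (4 * K)) \<le> ennreal (measure M {\<omega> \<in> space M. \<exists>s\<in>F. \<exists>t>0. B s t \<omega> = 0})"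
    using lim by (simp add: emeasure_eq_measure)
  then have "c\<^sup>2 / (4 * K) \<le> measure M {\<omega> \<in> space M. \<exists>s\<in>F. \<exists>t>0. B s t \<omega> = 0}"
    by (subst (asm) ennreal_le_iff) auto
  moreover have "0 < c\<^sup>2 / (4 * K)" using c K by simp
  ultimately show ?thesis by linarith
qed

end

section \<open>Hitting implies positive capacity\<close>

lemma ennreal_enn2real_le: "x \<le> ennreal c \<Longrightarrow> ennreal (enn2real x) = x"
  by (intro ennreal_enn2real) (auto intro: le_less_trans)

lemma quadrant_borel [measurable]: "{p :: real \<times> real. a \<le> fst p \<and> b \<le> snd p} \<in> sets borel"
  by (intro borel_closed closed_Collect_conj closed_Collect_le continuous_intros)

context sheet
begin

text \<open>What the quadrant above (s, t) contributes to the conditional expectation of \<open>occ_total \<rho> e\<close>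
  given first the past up to s in the first parameter and then up to t in the second.\<close>

definition corner_occ :: "(real \<times> real) measure \<Rightarrow> real \<Rightarrow> real \<Rightarrow> real \<Rightarrow> 'a \<Rightarrow> ennreal" where
  "corner_occ \<rho> e s t = occ \<rho> {p. s \<le> fst p \<and> t \<le> snd p}
     (\<lambda>p. e + (fst p - s) * snd p + (snd p - t) * s) (\<lambda>p. (s, t))"

text \<open>Cairoli's inequality with \<open>pos\<close> as \<open>J\<close>. \<open>psi i\<close>
  keeps the part of \<rho> beyond \<open>s i\<close>, where conditioning on
  \<open>past (s i)\<close> is explicit, and \<open>phi i j\<close> the part beyond both
  \<open>s i\<close> and \<open>s j\<close>. The discarded parts contribute nonnegatively, hence
  domination in place of a martingale identity. A value at (u, v) is moved to (\<open>s i\<close>,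
  v) and then to (\<open>s i\<close>, \<open>s j\<close>), which produces the two added
  variances.\<close>

lemma corner_occ_maximal:
  fixes h :: real
  assumes \<rho>: "finite_measure \<rho>" "sets \<rho> = sets borel" and e: "0 < e" and h: "0 \<le> h"
  shows "(\<integral>\<^sup>+\<omega>. ennreal ((running_max (\<lambda>j. running_max (\<lambda>i \<omega>. enn2real (corner_occ \<rho> e (real i * h) (real j * h) \<omega>)) m) m \<omega>)\<^sup>2) \<partial>M)
    \<le> 16 * (\<integral>\<^sup>+\<omega>. (occ_total \<rho> e \<omega>)\<^sup>2 \<partial>M)"
proof -
  define s where "s i = real i * h" for i
  have s0: "0 \<le> s i" for i using h by (simp add: s_def)
  have s_mono: "s i \<le> s (Suc i)" for i using h by (simp add: s_def mult_right_mono)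
  define c where "c = heat e (0 :: real ^ 'd) * measure \<rho> (space \<rho>)"
  have c0: "0 \<le> c" by (simp add: c_def heat_nonneg)
  define G where "G j = sheet.past M (\<lambda>s t. B t s) (s j)" for j
  define pos where "pos \<omega> = occ_total \<rho> e \<omega>" for \<omega>
  define psi where "psi i = occ \<rho> {p. s i \<le> fst p \<and> 0 \<le> snd p} (\<lambda>p. e + (fst p - s i) * snd p) (\<lambda>p. (s i, snd p))" for i
  define phi where "phi i j = corner_occ \<rho> e (s i) (s j)" for i j
  have w1: "(\<lambda>p :: real \<times> real. e + (fst p - s i) * snd p) \<in> borel_measurable borel" for i
    by (intro borel_measurable_continuous_onI continuous_intros)
  have w2: "(\<lambda>p :: real \<times> real. e + (fst p - s i) * snd p + (snd p - s j) * s i) \<in> borel_measurable borel" for i j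
    by (intro borel_measurable_continuous_onI continuous_intros)
  have pos_le: "pos \<omega> \<le> ennreal c" for \<omega>
    unfolding pos_def c_def by (rule occ_bound[OF \<rho>(1) e]) simp
  have psi_le: "psi i \<omega> \<le> ennreal c" for i \<omega>
    unfolding psi_def c_def by (rule occ_bound[OF \<rho>(1) e]) auto
  have phi_le: "phi i j \<omega> \<le> ennreal c" for i j \<omega>
    unfolding phi_def corner_occ_def c_def
  proof (rule occ_bound[OF \<rho>(1) e])
    fix p :: "real \<times> real" assume "p \<in> {p. s i \<le> fst p \<and> s j \<le> snd p}"
    then have "0 \<le> (fst p - s i) * snd p" "0 \<le> (snd p - s j) * s i" using s0[of i] s0[of j] by auto
    then show "e \<le> e + (fst p - s i) * snd p + (snd p - s j) * s i" by linarith
  qed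
  have \<pi>1: "(\<lambda>(p :: real \<times> real, \<omega>). Bp (s i, snd p) \<omega>) \<in> borel_measurable (borel \<Otimes>\<^sub>M past (s i))" for i
    by (rule Bp_past_measurable_pair[OF s0])
  have \<pi>1M: "(\<lambda>(p :: real \<times> real, \<omega>). Bp (s i, snd p) \<omega>) \<in> borel_measurable (borel \<Otimes>\<^sub>M M)" for i
  proof -
    have "(\<lambda>x :: (real \<times> real) \<times> 'a. ((s i, snd (fst x)), snd x)) \<in> measurable (borel \<Otimes>\<^sub>M M) (borel \<Otimes>\<^sub>M M)"
      unfolding borel_prod[symmetric] by measurable
    from measurable_compose[OF this Bp_measurable_pair] show ?thesis by (simp add: case_prod_beta')
  qed
  have BG: "Bp (s i, s j) \<in> borel_measurable (G j)" for i j
    unfolding G_def using sheet.B_past_measurable[OF sheet_swap, of "s j" "s j" "s i"] s0 by (simp add: Bp_eq)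
  have \<pi>2: "(\<lambda>(p :: real \<times> real, \<omega>). Bp (s i, s j) \<omega>) \<in> borel_measurable (borel \<Otimes>\<^sub>M G j)" for i j
    using measurable_compose[OF measurable_snd BG] by (simp add: case_prod_beta')
  have \<pi>2M: "(\<lambda>(p :: real \<times> real, \<omega>). Bp (s i, s j) \<omega>) \<in> borel_measurable (borel \<Otimes>\<^sub>M M)" for i j
    using measurable_compose[OF measurable_snd Bp_measurable] by (simp add: case_prod_beta')
  have pos_m [measurable]: "pos \<in> borel_measurable M"
    unfolding pos_def[abs_def] by (rule occ_total_measurable[OF \<rho>])
  have psi_m: "psi i \<in> borel_measurable (past (s i))" for i
    unfolding psi_def by (rule occ_measurable[OF \<rho> quadrant_borel w1 \<pi>1])
  have phi_m: "phi i j \<in> borel_measurable (G j)" for i j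
    unfolding phi_def corner_occ_def by (rule occ_measurable[OF \<rho> quadrant_borel w2 \<pi>2])
  have subM: "sets (past (s i)) \<subseteq> sets M" "sets (G i) \<subseteq> sets M" for i
    unfolding G_def by (auto intro!: sets_past_subset sheet.sets_past_subset[OF sheet_swap, THEN subsetD] simp: subset_iff[symmetric] dest: sets_past_subset[THEN subsetD])
  have YM: "Y \<in> borel_measurable M" if "Y \<in> borel_measurable (past (s i)) \<or> Y \<in> borel_measurable (G i)" for Y :: "'a \<Rightarrow> real" and i
    using that measurable_mono[of borel borel "past (s i)" M] measurable_mono[of borel borel "G i" M] subM[of i]
    by (auto simp: G_def sheet.space_past[OF sheet_swap])
  have dom1: "(\<integral>\<^sup>+\<omega>. psi i \<omega> * ennreal (Y \<omega>) \<partial>M) \<le> (\<integral>\<^sup>+\<omega>. pos \<omega> * ennreal (Y \<omega>) \<partial>M)"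
    if Y: "Y \<in> borel_measurable (past (s i))" for i Y
  proof -
    have [measurable]: "Y \<in> borel_measurable M" using YM Y by blast
    have "(\<integral>\<^sup>+\<omega>. psi i \<omega> * ennreal (Y \<omega>) \<partial>M) = (\<integral>\<^sup>+p\<in>{p. s i \<le> fst p \<and> 0 \<le> snd p}.
        (\<integral>\<^sup>+\<omega>. ennreal (heat (e + (fst p - s i) * snd p) (Bp (s i, snd p) \<omega>)) * ennreal (Y \<omega>) \<partial>M) \<partial>\<rho>)"
      unfolding psi_def by (rule nn_integral_occ_times[OF \<rho> quadrant_borel w1 \<pi>1M]) simp
    also have "\<dots> \<le> (\<integral>\<^sup>+p\<in>UNIV. (\<integral>\<^sup>+\<omega>. ennreal (heat e (Bp p \<omega>)) * ennreal (Y \<omega>) \<partial>M) \<partial>\<rho>)"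
    proof (rule nn_integral_mono)
      fix p :: "real \<times> real"
      have "(\<integral>\<^sup>+\<omega>. ennreal (heat (e + (fst p - s i) * snd p) (Bp (s i, snd p) \<omega>)) * ennreal (Y \<omega>) \<partial>M)
         = (\<integral>\<^sup>+\<omega>. ennreal (heat e (Bp p \<omega>)) * ennreal (Y \<omega>) \<partial>M)" if p: "s i \<le> fst p" "0 \<le> snd p"
        using heat_past[OF s0 p e, of "\<lambda>\<omega>. ennreal (Y \<omega>)"] Y s0[of i] p by (simp add: Bp_eq)
      then show "(\<integral>\<^sup>+\<omega>. ennreal (heat (e + (fst p - s i) * snd p) (Bp (s i, snd p) \<omega>)) * ennreal (Y \<omega>) \<partial>M) * indicator {p. s i \<le> fst p \<and> 0 \<le> snd p} p
        \<le> (\<integral>\<^sup>+\<omega>. ennreal (heat e (Bp p \<omega>)) * ennreal (Y \<omega>) \<partial>M) * indicator UNIV p"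
        by (auto simp: indicator_def)
    qed
    also have "\<dots> = (\<integral>\<^sup>+\<omega>. pos \<omega> * ennreal (Y \<omega>) \<partial>M)"
      unfolding pos_def by (rule nn_integral_occ_times[OF \<rho>, symmetric]) auto
    finally show ?thesis .
  qed
  have dom2: "(\<integral>\<^sup>+\<omega>. phi i j \<omega> * ennreal (Y \<omega>) \<partial>M) \<le> (\<integral>\<^sup>+\<omega>. psi i \<omega> * ennreal (Y \<omega>) \<partial>M)"
    if Y: "Y \<in> borel_measurable (G j)" for i j Y
  proof -
    have [measurable]: "Y \<in> borel_measurable M" using YM Y by blast
    have "(\<integral>\<^sup>+\<omega>. phi i j \<omega> * ennreal (Y \<omega>) \<partial>M) = (\<integral>\<^sup>+p\<in>{p. s i \<le> fst p \<and> s j \<le> snd p}.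
        (\<integral>\<^sup>+\<omega>. ennreal (heat (e + (fst p - s i) * snd p + (snd p - s j) * s i) (Bp (s i, s j) \<omega>)) * ennreal (Y \<omega>) \<partial>M) \<partial>\<rho>)"
      unfolding phi_def corner_occ_def by (rule nn_integral_occ_times[OF \<rho> quadrant_borel w2 \<pi>2M]) simp
    also have "\<dots> \<le> (\<integral>\<^sup>+p\<in>{p. s i \<le> fst p \<and> 0 \<le> snd p}.
        (\<integral>\<^sup>+\<omega>. ennreal (heat (e + (fst p - s i) * snd p) (Bp (s i, snd p) \<omega>)) * ennreal (Y \<omega>) \<partial>M) \<partial>\<rho>)"
    proof (rule nn_integral_mono)
      fix p :: "real \<times> real"
      have eq: "(\<integral>\<^sup>+\<omega>. ennreal (heat (e + (fst p - s i) * snd p + (snd p - s j) * s i) (Bp (s i, s j) \<omega>)) * ennreal (Y \<omega>) \<partial>M)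
         = (\<integral>\<^sup>+\<omega>. ennreal (heat (e + (fst p - s i) * snd p) (Bp (s i, snd p) \<omega>)) * ennreal (Y \<omega>) \<partial>M)"
        if p: "s i \<le> fst p" "s j \<le> snd p"
      proof -
        have "0 \<le> snd p" using p s0[of j] by linarith
        then have e1: "0 < e + (fst p - s i) * snd p" using e p by (simp add: add_pos_nonneg)
        show ?thesis
          using heat_past_swap[OF s0 p(2) s0 e1, of "\<lambda>\<omega>. ennreal (Y \<omega>)"] Y s0[of i] s0[of j] \<open>0 \<le> snd p\<close>
          by (simp add: Bp_eq G_def)
      qed
      have "0 \<le> snd p" if "s j \<le> snd p" using that s0[of j] by linarith
      then show "(\<integral>\<^sup>+\<omega>. ennreal (heat (e + (fst p - s i) * snd p + (snd p - s j) * s i) (Bp (s i, s j) \<omega>)) * ennreal (Y \<omega>) \<partial>M) * indicator {p. s i \<le> fst p \<and> s j \<le> snd p} p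
        \<le> (\<integral>\<^sup>+\<omega>. ennreal (heat (e + (fst p - s i) * snd p) (Bp (s i, snd p) \<omega>)) * ennreal (Y \<omega>) \<partial>M) * indicator {p. s i \<le> fst p \<and> 0 \<le> snd p} p"
        using eq by (auto simp: indicator_def)
    qed
    also have "\<dots> = (\<integral>\<^sup>+\<omega>. psi i \<omega> * ennreal (Y \<omega>) \<partial>M)"
      unfolding psi_def by (rule nn_integral_occ_times[OF \<rho> quadrant_borel w1 \<pi>1M, symmetric]) simp
    finally show ?thesis .
  qed
  have conv: "ennreal (enn2real x * y) = x * ennreal y" if "x \<le> ennreal c" "0 \<le> y" for x y
    using that by (simp add: ennreal_mult ennreal_enn2real_le)
  have le_c: "enn2real x \<le> c" if "x \<le> ennreal c" for x
    using that c0 by (metis enn2real_mono enn2real_ennreal ennreal_less_top)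
  have "(\<integral>\<^sup>+\<omega>. ennreal ((running_max (\<lambda>j. running_max (\<lambda>i \<omega>. enn2real (phi i j \<omega>)) m) m \<omega>)\<^sup>2) \<partial>M)
    \<le> 16 * (\<integral>\<^sup>+\<omega>. ennreal ((enn2real (pos \<omega>))\<^sup>2) \<partial>M)"
  proof (rule Cairoli_L2_dominated[where F="\<lambda>i. past (s i)" and G=G and \<Psi>="\<lambda>i \<omega>. enn2real (psi i \<omega>)" and c=c])
    show "prob_space M" by unfold_locales
    show "sets (past (s k)) \<subseteq> sets M" "sets (G k) \<subseteq> sets M" for k by (fact subM)+
    show "space (past (s k)) = space M" for k by simp
    show "space (G k) = space M" for k by (simp add: G_def sheet.space_past[OF sheet_swap])
    show "sets (past (s k)) \<subseteq> sets (past (s (Suc k)))" for k by (rule sets_past_mono[OF s_mono])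
    show "sets (G k) \<subseteq> sets (G (Suc k))" for k
      unfolding G_def by (rule sheet.sets_past_mono[OF sheet_swap s_mono])
    show "(\<lambda>\<omega>. enn2real (psi i \<omega>)) \<in> borel_measurable (past (s i))" for i
      using psi_m[of i] by measurable
    show "(\<lambda>\<omega>. enn2real (phi i j \<omega>)) \<in> borel_measurable (G j)" for i j
      using phi_m[of i j] by measurable
    show "(\<integral>\<^sup>+\<omega>. ennreal (enn2real (psi i \<omega>) * Y \<omega>) \<partial>M) \<le> (\<integral>\<^sup>+\<omega>. ennreal (enn2real (pos \<omega>) * Y \<omega>) \<partial>M)"
      if "Y \<in> borel_measurable (past (s i))" "\<And>\<omega>. 0 \<le> Y \<omega>" for i Y
      using dom1[OF that(1)] that(2) by (simp add: conv[OF psi_le] conv[OF pos_le])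
    show "(\<integral>\<^sup>+\<omega>. ennreal (enn2real (phi i j \<omega>) * Y \<omega>) \<partial>M) \<le> (\<integral>\<^sup>+\<omega>. ennreal (enn2real (psi i \<omega>) * Y \<omega>) \<partial>M)"
      if "Y \<in> borel_measurable (G j)" "\<And>\<omega>. 0 \<le> Y \<omega>" for i j Y
      using dom2[OF that(1)] that(2) by (simp add: conv[OF psi_le] conv[OF phi_le])
  qed (auto intro!: le_c psi_le phi_le pos_le)
  also have "(\<integral>\<^sup>+\<omega>. ennreal ((enn2real (pos \<omega>))\<^sup>2) \<partial>M) = (\<integral>\<^sup>+\<omega>. (pos \<omega>)\<^sup>2 \<partial>M)"
    by (intro nn_integral_cong) (simp add: ennreal_power[symmetric] ennreal_enn2real_le[OF pos_le])
  finally show ?thesis unfolding phi_def pos_def s_def .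
qed

text \<open>In the application (S, T) is a zero and (s, t) a grid corner just below it. By
  \<open>close\<close> the displacement raises the variances by at most \<open>e\<close>; by
  \<open>small\<close> the sheet at the corner is within one standard deviation of 0, whence the
  factor \<open>exp (- (1 / 2))\<close>. The times between T and T + 1 supply the whole slab
  kernel.\<close>

lemma corner_occ_lower:
  assumes \<mu>: "sets \<mu> = sets borel" and e: "0 < e" and \<alpha>: "0 < \<alpha>"
    and S: "0 \<le> s" "s \<le> S" "S \<le> S0" and T: "0 \<le> t" "t \<le> T" "\<alpha> \<le> T" "T + 1 \<le> \<gamma>"
    and close: "(S - s) * \<gamma> + (T - t) * S0 \<le> e" and small: "(norm (Bp (s, t) \<omega>))\<^sup>2 \<le> e"
  shows "ennreal (exp (- (1 / 2)) * (2 * pi * max 2 (\<gamma> + S0)) powr (- real CARD('d) / 2)) *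
      (\<integral>\<^sup>+y\<in>{S..}. slab_kernel CARD('d) e (y - S) \<partial>\<mu>) \<le> corner_occ (strip \<mu> \<alpha> \<gamma>) e s t \<omega>"
proof -
  let ?d = "- real CARD('d) / 2"
  \<comment> \<open>Dominates the coefficients 2, \<gamma> and \<open>S0\<close> that
    \<open>e\<close>, \<open>y - S\<close> and \<open>t' - T\<close> carry in the upper bound for
    the variance.\<close>
  define D where "D = max 2 (\<gamma> + S0)"
  have D: "D \<ge> 2" "D \<ge> \<gamma> + S0" by (auto simp: D_def)
  define c0 where "c0 = exp (- (1 / 2)) * (2 * pi * D) powr ?d"
  have c0: "0 \<le> c0" by (simp add: c0_def)
  define w where "w p = e + (fst p - s) * snd p + (snd p - t) * s" for p :: "real \<times> real"
  define x where "x = Bp (s, t) \<omega>"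
  have wm [measurable]: "w \<in> borel_measurable borel"
    unfolding w_def[abs_def] by (intro borel_measurable_continuous_onI continuous_intros)
  have hm: "(\<lambda>p. ennreal (heat (w p) x) * indicator {p. s \<le> fst p \<and> t \<le> snd p} p) \<in> borel_measurable borel"
  proof -
    have "(\<lambda>p. (w p, x)) \<in> measurable borel (borel \<Otimes>\<^sub>M borel)" by measurable
    from measurable_compose[OF this heat_measurable_pair] have [measurable]: "(\<lambda>p. heat (w p) x) \<in> borel_measurable borel" by simp
    show ?thesis by measurable
  qed
  have key: "c0 * (e + (y - S) + (t' - T)) powr ?d \<le> heat (w (y, t')) x" if y: "S \<le> y" and t': "T \<le> t'" "t' \<le> T + 1" for y t'
  proof -
    have p: "0 < e + (y - S) + (t' - T)" using e y t' by linarith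
    have t'g: "0 \<le> t'" "t' \<le> \<gamma>" using t' T by auto
    have "0 \<le> (y - s) * t'" "0 \<le> (t' - t) * s" using y S t' T t'g by auto
    then have we: "e \<le> w (y, t')" by (simp add: w_def)
    then have w0: "0 < w (y, t')" using e by linarith
    have "(y - s) * t' \<le> (y - s) * \<gamma>" using y S t'g by (intro mult_left_mono) auto
    moreover have "(t' - t) * s \<le> (t' - t) * S0" using t' T S by (intro mult_left_mono) auto
    ultimately have "w (y, t') \<le> e + ((S - s) * \<gamma> + (T - t) * S0) + (y - S) * \<gamma> + (t' - T) * S0"
      by (simp add: w_def algebra_simps)
    also have "\<dots> \<le> 2 * e + (y - S) * \<gamma> + (t' - T) * S0" using close by simp
    also have "\<dots> \<le> D * e + (y - S) * D + (t' - T) * D"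
    proof -
      have "2 * e \<le> D * e" using D e by (intro mult_right_mono) auto
      moreover have "(y - S) * \<gamma> \<le> (y - S) * D" using y D S by (intro mult_left_mono) auto
      moreover have "(t' - T) * S0 \<le> (t' - T) * D" using t' t'g D by (intro mult_left_mono) auto
      ultimately show ?thesis by linarith
    qed
    also have "\<dots> = D * (e + (y - S) + (t' - T))" by (simp add: algebra_simps)
    finally have "2 * pi * w (y, t') \<le> 2 * pi * D * (e + (y - S) + (t' - T))" by simp
    then have 1: "(2 * pi * D * (e + (y - S) + (t' - T))) powr ?d \<le> (2 * pi * w (y, t')) powr ?d"
      using w0 by (intro powr_mono2') auto
    have "(norm x)\<^sup>2 / (2 * w (y, t')) \<le> 1 / 2"
      using small we w0 by (simp add: x_def field_simps)
    then have 2: "exp (- (1 / 2)) \<le> exp (- (norm x)\<^sup>2 / (2 * w (y, t')))" by simp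
    have "(2 * pi * D * (e + (y - S) + (t' - T))) powr ?d = (2 * pi * D) powr ?d * (e + (y - S) + (t' - T)) powr ?d"
      using D p by (intro powr_mult)
    then have "c0 * (e + (y - S) + (t' - T)) powr ?d = (2 * pi * D * (e + (y - S) + (t' - T))) powr ?d * exp (- (1 / 2))"
      by (simp add: c0_def)
    also have "\<dots> \<le> (2 * pi * w (y, t')) powr ?d * exp (- (norm x)\<^sup>2 / (2 * w (y, t')))"
      by (intro mult_mono 1 2) auto
    also have "\<dots> = heat (w (y, t')) x" using heat_eq[OF w0, of x] by simp
    finally show ?thesis .
  qed
  have inner: "ennreal c0 * slab_kernel CARD('d) e (y - S) * indicator {S..} y \<le>
     (\<integral>\<^sup>+t'\<in>{\<alpha>..\<gamma>}. ennreal (heat (w (y, t')) x) * indicator {p. s \<le> fst p \<and> t \<le> snd p} (y, t') \<partial>lborel)" for y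
  proof (cases "S \<le> y")
    case True
    have "slab_kernel CARD('d) e (y - S) = (\<integral>\<^sup>+t'. ennreal ((e + (y - S) + (- T + 1 * t')) powr ?d) * indicator {0..1} (- T + 1 * t') \<partial>lborel)"
      unfolding slab_kernel_def by (subst nn_integral_real_affine[where c=1 and t="- T"]) auto
    then have "ennreal c0 * slab_kernel CARD('d) e (y - S) = (\<integral>\<^sup>+t'. ennreal c0 * (ennreal ((e + (y - S) + (- T + 1 * t')) powr ?d) * indicator {0..1} (- T + 1 * t')) \<partial>lborel)"
      by (simp only:) (rule nn_integral_cmult[symmetric], measurable)
    also have "\<dots> \<le> (\<integral>\<^sup>+t'\<in>{\<alpha>..\<gamma>}. ennreal (heat (w (y, t')) x) * indicator {p. s \<le> fst p \<and> t \<le> snd p} (y, t') \<partial>lborel)"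
    proof (rule nn_integral_mono)
      fix t' :: real
      show "ennreal c0 * (ennreal ((e + (y - S) + (- T + 1 * t')) powr ?d) * indicator {0..1} (- T + 1 * t'))
         \<le> ennreal (heat (w (y, t')) x) * indicator {p. s \<le> fst p \<and> t \<le> snd p} (y, t') * indicator {\<alpha>..\<gamma>} t'"
      proof (cases "t' \<in> {T..T+1}")
        case t': True
        have "ennreal c0 * ennreal ((e + (y - S) + (- T + 1 * t')) powr ?d) = ennreal (c0 * (e + (y - S) + (t' - T)) powr ?d)"
          using c0 by (simp add: ennreal_mult)
        also have "\<dots> \<le> ennreal (heat (w (y, t')) x)" using key[OF True] t' by (intro ennreal_leI) auto
        finally show ?thesis using t' T S True by (auto simp: indicator_def)
      next
        case False
        then show ?thesis by (auto simp: indicator_def)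
      qed
    qed
    finally show ?thesis using True by simp
  qed auto
  have sm: "(\<lambda>y. slab_kernel CARD('d) e (y - S) * indicator {S..} y) \<in> borel_measurable \<mu>"
    unfolding measurable_cong_sets[OF \<mu> refl] by measurable
  have "ennreal c0 * (\<integral>\<^sup>+y\<in>{S..}. slab_kernel CARD('d) e (y - S) \<partial>\<mu>) = (\<integral>\<^sup>+y. ennreal c0 * slab_kernel CARD('d) e (y - S) * indicator {S..} y \<partial>\<mu>)"
    using nn_integral_cmult[OF sm, of "ennreal c0"] by (simp add: mult.assoc)
  also have "\<dots> \<le> (\<integral>\<^sup>+y. (\<integral>\<^sup>+t'\<in>{\<alpha>..\<gamma>}. ennreal (heat (w (y, t')) x) * indicator {p. s \<le> fst p \<and> t \<le> snd p} (y, t') \<partial>lborel) \<partial>\<mu>)"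
    by (intro nn_integral_mono inner)
  also have "\<dots> = (\<integral>\<^sup>+p. ennreal (heat (w p) x) * indicator {p. s \<le> fst p \<and> t \<le> snd p} p \<partial>strip \<mu> \<alpha> \<gamma>)"
    by (rule nn_integral_strip[OF \<mu> hm, symmetric])
  also have "\<dots> = corner_occ (strip \<mu> \<alpha> \<gamma>) e s t \<omega>"
    unfolding corner_occ_def occ_def w_def x_def ..
  finally show ?thesis unfolding c0_def D_def .
qed

end

lemma borel_measurable_pair_cong:
  assumes "sets \<mu> = sets borel" "f \<in> borel_measurable (borel \<Otimes>\<^sub>M borel)"
  shows "f \<in> borel_measurable (\<mu> \<Otimes>\<^sub>M \<mu>)"
  using assms measurable_cong_sets[OF sets_pair_measure_cong[OF assms(1) assms(1)]] by blast

text \<open>Along e = 1/(n+1) the shifted Riesz kernels converge to the kernel itself, also on the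
  diagonal; Fatou's lemma in each variable passes the uniform bound to the limit.\<close>

lemma riesz_energy_finite_if_slab_bounded:
  fixes \<mu> :: "real measure"
  assumes \<mu>: "prob_space \<mu>" "sets \<mu> = sets borel" and d: "1 \<le> d"
    and L: "\<And>e. 0 < e \<Longrightarrow> (\<integral>\<^sup>+x. (\<integral>\<^sup>+y. slab_kernel d e \<bar>x - y\<bar> \<partial>\<mu>) \<partial>\<mu>) \<le> ennreal L"
  shows "riesz_energy ((real d - 2) / 2) \<mu> < \<top>"
proof -
  interpret mu: prob_space \<mu> by fact
  let ?\<beta> = "(real d - 2) / 2"
  obtain C where C: "0 \<le> C"
    "\<And>e h. 0 < e \<Longrightarrow> riesz_kernel ?\<beta> (\<bar>h\<bar> + e :: real) \<le> ennreal C * (1 + slab_kernel d e \<bar>h\<bar>)"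
    using riesz_le_slab_kernel[OF d] by metis
  define u where "u n x y = riesz_kernel ?\<beta> (\<bar>x - y\<bar> + 1 / real (Suc n))" for n and x y :: real
  have um: "case_prod (u n) \<in> borel_measurable (\<mu> \<Otimes>\<^sub>M \<mu>)" for n
    by (rule borel_measurable_pair_cong[OF \<mu>(2)]) (unfold u_def, measurable)
  have um1: "u n x \<in> borel_measurable \<mu>" for n x
    unfolding measurable_cong_sets[OF \<mu>(2) refl] u_def[abs_def] by measurable
  have um2: "(\<lambda>x. \<integral>\<^sup>+y. u n x y \<partial>\<mu>) \<in> borel_measurable \<mu>" for n
    by (rule mu.borel_measurable_nn_integral[OF um])
  have bound: "(\<integral>\<^sup>+x. (\<integral>\<^sup>+y. u n x y \<partial>\<mu>) \<partial>\<mu>) \<le> ennreal C * (1 + ennreal L)" for n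
  proof -
    let ?e = "1 / real (Suc n)"
    have sm: "(\<lambda>y. slab_kernel d ?e \<bar>x - y\<bar>) \<in> borel_measurable \<mu>" for x
      unfolding measurable_cong_sets[OF \<mu>(2) refl] by measurable
    have "(\<lambda>(x, y). slab_kernel d ?e \<bar>x - y\<bar>) \<in> borel_measurable (\<mu> \<Otimes>\<^sub>M \<mu>)"
      by (rule borel_measurable_pair_cong[OF \<mu>(2)]) measurable
    then have sm2: "(\<lambda>x. \<integral>\<^sup>+y. slab_kernel d ?e \<bar>x - y\<bar> \<partial>\<mu>) \<in> borel_measurable \<mu>"
      by (rule mu.borel_measurable_nn_integral)
    have "(\<integral>\<^sup>+x. (\<integral>\<^sup>+y. u n x y \<partial>\<mu>) \<partial>\<mu>) \<le> (\<integral>\<^sup>+x. (\<integral>\<^sup>+y. ennreal C * (1 + slab_kernel d ?e \<bar>x - y\<bar>) \<partial>\<mu>) \<partial>\<mu>)"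
      unfolding u_def by (intro nn_integral_mono C) simp
    also have "\<dots> = ennreal C * (1 + (\<integral>\<^sup>+x. (\<integral>\<^sup>+y. slab_kernel d ?e \<bar>x - y\<bar> \<partial>\<mu>) \<partial>\<mu>))"
      using sm sm2 by (simp add: nn_integral_cmult nn_integral_add mu.emeasure_space_1)
    also have "\<dots> \<le> ennreal C * (1 + ennreal L)"
      by (intro mult_left_mono add_left_mono L) auto
    finally show ?thesis .
  qed
  have "riesz_energy ?\<beta> \<mu> = (\<integral>\<^sup>+x. (\<integral>\<^sup>+y. liminf (\<lambda>n. u n x y) \<partial>\<mu>) \<partial>\<mu>)"
    unfolding riesz_energy_def u_def
    by (intro nn_integral_cong lim_imp_Liminf[symmetric] riesz_kernel_LIMSEQ) auto
  also have "\<dots> \<le> (\<integral>\<^sup>+x. liminf (\<lambda>n. \<integral>\<^sup>+y. u n x y \<partial>\<mu>) \<partial>\<mu>)"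
    by (intro nn_integral_mono nn_integral_liminf um1)
  also have "\<dots> \<le> liminf (\<lambda>n. \<integral>\<^sup>+x. (\<integral>\<^sup>+y. u n x y \<partial>\<mu>) \<partial>\<mu>)"
    by (intro nn_integral_liminf um2)
  also have "\<dots> \<le> ennreal C * (1 + ennreal L)"
    by (intro Liminf_le always_eventually allI bound) simp
  also have "\<dots> < \<top>" by (simp add: ennreal_mult_less_top ennreal_add_less_top)
  finally show ?thesis .
qed

text \<open>Split by the order of x and y and exchange the variables in one half; the diagonal is
  counted twice, so the result is an inequality. The one-sided integral is the one that a corner of
  the grid can see.\<close>

lemma slab_energy_le_one_sided:
  assumes \<mu>: "prob_space \<mu>" "sets \<mu> = sets borel"
  shows "(\<integral>\<^sup>+x. (\<integral>\<^sup>+y. slab_kernel d e \<bar>x - y\<bar> \<partial>\<mu>) \<partial>\<mu>) \<le> 2 * (\<integral>\<^sup>+x. (\<integral>\<^sup>+y\<in>{x..}. slab_kernel d e (y - x) \<partial>\<mu>) \<partial>\<mu>)"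
proof -
  interpret mu: prob_space \<mu> by fact
  interpret P: pair_sigma_finite \<mu> \<mu> ..
  define f where "f x y = slab_kernel d e (y - x) * indicator {x..} y" for x y
  have fm0: "case_prod f \<in> borel_measurable (borel \<Otimes>\<^sub>M borel)"
  proof -
    have "(\<lambda>(x, y). slab_kernel d e (y - x) * (if x \<le> y then 1 else 0)) \<in> borel_measurable (borel \<Otimes>\<^sub>M borel)" by measurable
    moreover have "(\<lambda>(x, y). slab_kernel d e (y - x) * (if x \<le> y then 1 else 0)) = case_prod f"
      by (auto simp: f_def fun_eq_iff indicator_def)
    ultimately show ?thesis by simp
  qed
  have fm: "case_prod f \<in> borel_measurable (\<mu> \<Otimes>\<^sub>M \<mu>)" by (rule borel_measurable_pair_cong[OF \<mu>(2) fm0])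
  have fm': "(\<lambda>(x, y). f y x) \<in> borel_measurable (\<mu> \<Otimes>\<^sub>M \<mu>)"
    using measurable_pair_swap[OF fm] by simp
  have sp: "space \<mu> = UNIV" using sets_eq_imp_space_eq[OF \<mu>(2)] by simp
  have f1: "f x \<in> borel_measurable \<mu>" "(\<lambda>y. f y x) \<in> borel_measurable \<mu>" for x
    using measurable_compose[OF measurable_Pair1' fm, of x] measurable_compose[OF measurable_Pair1' fm', of x] sp by auto
  have "(\<integral>\<^sup>+x. (\<integral>\<^sup>+y. slab_kernel d e \<bar>x - y\<bar> \<partial>\<mu>) \<partial>\<mu>) \<le> (\<integral>\<^sup>+x. (\<integral>\<^sup>+y. f x y + f y x \<partial>\<mu>) \<partial>\<mu>)"
  proof (intro nn_integral_mono)
    fix x y :: real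
    show "slab_kernel d e \<bar>x - y\<bar> \<le> f x y + f y x"
      by (cases "x \<le> y") (auto simp: f_def)
  qed
  also have "\<dots> = (\<integral>\<^sup>+x. (\<integral>\<^sup>+y. f x y \<partial>\<mu>) + (\<integral>\<^sup>+y. f y x \<partial>\<mu>) \<partial>\<mu>)"
    by (intro nn_integral_cong nn_integral_add f1)
  also have "\<dots> = (\<integral>\<^sup>+x. (\<integral>\<^sup>+y. f x y \<partial>\<mu>) \<partial>\<mu>) + (\<integral>\<^sup>+x. (\<integral>\<^sup>+y. f y x \<partial>\<mu>) \<partial>\<mu>)"
    by (intro nn_integral_add mu.borel_measurable_nn_integral fm fm')
  also have "(\<integral>\<^sup>+x. (\<integral>\<^sup>+y. f y x \<partial>\<mu>) \<partial>\<mu>) = (\<integral>\<^sup>+x. (\<integral>\<^sup>+y. f x y \<partial>\<mu>) \<partial>\<mu>)"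
    by (rule P.Fubini'[OF fm])
  finally show ?thesis unfolding f_def by (simp add: mult_2)
qed

context sheet
begin

text \<open>The mesh is \<open>1 / Suc n\<close>, and \<open>X * Suc n\<close> steps reach exactly
  \<open>X\<close> in both directions: the range stays fixed while the mesh shrinks.\<close>

definition grid_max :: "(real \<times> real) measure \<Rightarrow> real \<Rightarrow> nat \<Rightarrow> nat \<Rightarrow> 'a \<Rightarrow> real" where
  "grid_max \<rho> e X n = running_max (\<lambda>j. running_max (\<lambda>i \<omega>. enn2real
     (corner_occ \<rho> e (real i * (1 / real (Suc n))) (real j * (1 / real (Suc n))) \<omega>)) (X * Suc n)) (X * Suc n)"

lemma corner_occ_measurable:
  assumes "finite_measure \<rho>" "sets \<rho> = sets borel"
  shows "corner_occ \<rho> e s t \<in> borel_measurable M"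
  unfolding corner_occ_def
proof (rule occ_measurable[OF assms quadrant_borel])
  show "(\<lambda>p :: real \<times> real. e + (fst p - s) * snd p + (snd p - t) * s) \<in> borel_measurable borel"
    by (intro borel_measurable_continuous_onI continuous_intros)
  show "(\<lambda>(p :: real \<times> real, \<omega>). Bp (s, t) \<omega>) \<in> borel_measurable (borel \<Otimes>\<^sub>M M)"
    using measurable_compose[OF measurable_snd Bp_measurable] by (simp add: case_prod_beta')
qed

lemma corner_occ_finite:
  assumes \<rho>: "finite_measure \<rho>" and "0 < e" "0 \<le> s" "0 \<le> t"
  shows "ennreal (enn2real (corner_occ \<rho> e s t \<omega>)) = corner_occ \<rho> e s t \<omega>"
proof (rule ennreal_enn2real_le)
  show "corner_occ \<rho> e s t \<omega> \<le> ennreal (heat e (0 :: real ^ 'd) * measure \<rho> (space \<rho>))"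
    unfolding corner_occ_def
  proof (rule occ_bound[OF \<rho> \<open>0 < e\<close>])
    fix p :: "real \<times> real" assume "p \<in> {p. s \<le> fst p \<and> t \<le> snd p}"
    then have "0 \<le> (fst p - s) * snd p" "0 \<le> (snd p - t) * s" using assms by auto
    then show "e \<le> e + (fst p - s) * snd p + (snd p - t) * s" by linarith
  qed
qed

text \<open>Rounding S and T down to the mesh keeps the corner below the zero, and continuity of the
  path drives its value at the corner to 0. The mesh from which both estimates hold depends on
  \<omega>, hence the eventual form.\<close>

lemma grid_max_lower:
  assumes \<mu>: "prob_space \<mu>" "sets \<mu> = sets borel" and e: "0 < e" and \<alpha>: "0 < \<alpha>"
    and S: "0 \<le> S" "S \<le> S0" and T: "\<alpha> \<le> T" "T + 1 \<le> \<gamma>" and X: "S0 \<le> real X" "\<gamma> \<le> real X"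
    and \<omega>: "\<omega> \<in> space M" and zero: "Bp (S, T) \<omega> = 0"
  shows "\<forall>\<^sub>F n in sequentially.
    ennreal (exp (- (1 / 2)) * (2 * pi * max 2 (\<gamma> + S0)) powr (- real CARD('d) / 2)) *
      (\<integral>\<^sup>+y\<in>{S..}. slab_kernel CARD('d) e (y - S) \<partial>\<mu>) \<le> ennreal (grid_max (strip \<mu> \<alpha> \<gamma>) e X n \<omega>)"
proof -
  have T0: "0 \<le> T" using T \<alpha> by linarith
  have \<gamma>: "0 \<le> \<gamma>" "\<alpha> \<le> \<gamma>" using T T0 by auto
  note \<rho> = finite_measure_strip[OF \<mu> \<gamma>(2)]
  define g where "g n r = real (nat \<lfloor>real (Suc n) * r\<rfloor>) * (1 / real (Suc n))" for n and r :: real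
  have g_eq: "g n r = real_of_int \<lfloor>real (Suc n) * r\<rfloor> / real (Suc n)" if "0 \<le> r" for n r
    using that by (simp add: g_def del: of_nat_Suc)
  have g_lim: "(\<lambda>n. g n r) \<longlonglongrightarrow> r" if "0 \<le> r" for r
    unfolding g_eq[OF that] by (rule floor_grid_LIMSEQ)
  have g_le: "g n r \<le> r" if "0 \<le> r" for n r
  proof -
    have "real_of_int \<lfloor>real (Suc n) * r\<rfloor> / real (Suc n) \<le> real (Suc n) * r / real (Suc n)"
      by (intro divide_right_mono of_int_floor_le) simp
    then show ?thesis using g_eq[OF that] by simp
  qed
  have g0: "0 \<le> g n r" for n r by (simp add: g_def)
  have idx: "nat \<lfloor>real (Suc n) * r\<rfloor> \<le> X * Suc n" if "0 \<le> r" "r \<le> real X" for n r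
  proof -
    have "real (Suc n) * r \<le> real (Suc n) * real X" using that by (intro mult_left_mono) auto
    also have "\<dots> = real (X * Suc n)" by (simp only: of_nat_mult mult.commute)
    finally have "\<lfloor>real (Suc n) * r\<rfloor> \<le> int (X * Suc n)" by linarith
    then show ?thesis by (simp only: nat_le_iff)
  qed
  have "(\<lambda>n. (S - g n S) * \<gamma> + (T - g n T) * S0) \<longlonglongrightarrow> (S - S) * \<gamma> + (T - T) * S0"
    by (intro tendsto_intros g_lim S T0)
  then have ev1: "\<forall>\<^sub>F n in sequentially. (S - g n S) * \<gamma> + (T - g n T) * S0 < e"
    using e by (auto dest: order_tendstoD(2))
  have "isCont (\<lambda>p. Bp p \<omega>) (S, T)"
    using Bp_continuous[OF \<omega>] continuous_on_eq_continuous_at[OF open_UNIV] by blast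
  then have "(\<lambda>n. Bp (g n S, g n T) \<omega>) \<longlonglongrightarrow> Bp (S, T) \<omega>"
    by (rule isCont_tendsto_compose) (intro tendsto_Pair g_lim S T0)
  then have "(\<lambda>n. (norm (Bp (g n S, g n T) \<omega>))\<^sup>2) \<longlonglongrightarrow> (norm (Bp (S, T) \<omega>))\<^sup>2"
    by (intro tendsto_intros)
  then have ev2: "\<forall>\<^sub>F n in sequentially. (norm (Bp (g n S, g n T) \<omega>))\<^sup>2 < e"
    by (rule order_tendstoD(2)) (use e zero in simp)
  show ?thesis
    using ev1 ev2
  proof eventually_elim
    case (elim n)
    define i where "i = nat \<lfloor>real (Suc n) * S\<rfloor>"
    define j where "j = nat \<lfloor>real (Suc n) * T\<rfloor>"
    have ij: "i \<le> X * Suc n" "j \<le> X * Suc n"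
      unfolding i_def j_def using S T T0 X by (intro idx; linarith)+
    have gi: "g n S = real i * (1 / real (Suc n))" "g n T = real j * (1 / real (Suc n))"
      unfolding g_def i_def j_def by auto
    have "ennreal (exp (- (1 / 2)) * (2 * pi * max 2 (\<gamma> + S0)) powr (- real CARD('d) / 2)) *
      (\<integral>\<^sup>+y\<in>{S..}. slab_kernel CARD('d) e (y - S) \<partial>\<mu>) \<le> corner_occ (strip \<mu> \<alpha> \<gamma>) e (g n S) (g n T) \<omega>"
      using elim S T g_le[OF S(1), of n] g_le[OF T0, of n]
      by (intro corner_occ_lower[OF \<mu>(2) e \<alpha>] g0) auto
    also have "\<dots> = ennreal (enn2real (corner_occ (strip \<mu> \<alpha> \<gamma>) e (g n S) (g n T) \<omega>))"
      by (rule corner_occ_finite[OF \<rho> e g0 g0, symmetric])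
    also have "\<dots> \<le> ennreal (grid_max (strip \<mu> \<alpha> \<gamma>) e X n \<omega>)"
    proof (rule ennreal_leI)
      let ?\<Phi> = "\<lambda>i j \<omega>. enn2real (corner_occ (strip \<mu> \<alpha> \<gamma>) e (real i * (1 / real (Suc n))) (real j * (1 / real (Suc n))) \<omega>)"
      have "enn2real (corner_occ (strip \<mu> \<alpha> \<gamma>) e (g n S) (g n T) \<omega>) = ?\<Phi> i j \<omega>" unfolding gi ..
      also have "\<dots> \<le> running_max (\<lambda>i. ?\<Phi> i j) (X * Suc n) \<omega>" by (rule running_max_ge[OF ij(1)])
      also have "\<dots> \<le> running_max (\<lambda>j. running_max (\<lambda>i. ?\<Phi> i j) (X * Suc n)) (X * Suc n) \<omega>"
        by (rule running_max_ge[OF ij(2)])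
      finally show "enn2real (corner_occ (strip \<mu> \<alpha> \<gamma>) e (g n S) (g n T) \<omega>) \<le> grid_max (strip \<mu> \<alpha> \<gamma>) e X n \<omega>"
        unfolding grid_max_def .
    qed
    finally show ?case .
  qed
qed

text \<open>The minimum is chosen because, within \<open>H\<close>, the event
  \<open>S \<omega> \<le> x\<close> is the zero event of the compact set
  \<open>(F \<inter> {..x}) \<times> {\<alpha>..\<gamma>}\<close>, so measurability comes from
  \<open>zero_event_measurable\<close>.\<close>

lemma first_zero_selection:
  fixes \<alpha> \<gamma> :: real
  assumes F: "compact F"
  defines "H \<equiv> {\<omega> \<in> space M. \<exists>p\<in>F \<times> {\<alpha>..\<gamma>}. Bp p \<omega> = 0}"
  obtains S where "S \<in> borel_measurable M" "\<And>\<omega>. \<omega> \<in> H \<Longrightarrow> S \<omega> \<in> F \<and> (\<exists>t\<in>{\<alpha>..\<gamma>}. Bp (S \<omega>, t) \<omega> = 0)"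
proof -
  define Z where "Z \<omega> = {s \<in> F. \<exists>t\<in>{\<alpha>..\<gamma>}. Bp (s, t) \<omega> = 0}" for \<omega>
  \<comment> \<open>The default 0 outside \<open>H\<close> is the origin of the case distinction on
    \<open>0 \<le> x\<close> in the sublevel sets below.\<close>
  define S where "S \<omega> = (if \<omega> \<in> H then Inf (Z \<omega>) else 0)" for \<omega>
  have min: "\<exists>s\<in>Z \<omega>. \<forall>s'\<in>Z \<omega>. s \<le> s'" if \<omega>: "\<omega> \<in> H" for \<omega>
  proof -
    have sp: "\<omega> \<in> space M" using \<omega> by (simp add: H_def)
    have "compact ((F \<times> {\<alpha>..\<gamma>}) \<inter> {p. Bp p \<omega> = 0})"
      by (intro compact_Int_closed compact_Times F compact_Icc closed_Collect_eq Bp_continuous[OF sp] continuous_on_const)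
    then have "compact (fst ` ((F \<times> {\<alpha>..\<gamma>}) \<inter> {p. Bp p \<omega> = 0}))"
      by (intro compact_continuous_image continuous_intros)
    moreover have "fst ` ((F \<times> {\<alpha>..\<gamma>}) \<inter> {p. Bp p \<omega> = 0}) = Z \<omega>" by (force simp: Z_def)
    ultimately have "compact (Z \<omega>)" by simp
    moreover have "Z \<omega> \<noteq> {}" using \<omega> by (auto simp: H_def Z_def)
    ultimately show ?thesis using compact_attains_inf by blast
  qed
  have SZ: "S \<omega> \<in> Z \<omega>" "\<And>s. s \<in> Z \<omega> \<Longrightarrow> S \<omega> \<le> s" if \<omega>: "\<omega> \<in> H" for \<omega>
  proof -
    obtain s where s: "s \<in> Z \<omega>" "\<And>s'. s' \<in> Z \<omega> \<Longrightarrow> s \<le> s'" using min[OF \<omega>] by auto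
    then have "S \<omega> = s" using \<omega> by (simp add: S_def cInf_eq_minimum)
    then show "S \<omega> \<in> Z \<omega>" "\<And>s. s \<in> Z \<omega> \<Longrightarrow> S \<omega> \<le> s" using s by auto
  qed
  have Hm: "H \<in> sets M" unfolding H_def by (intro zero_event_measurable compact_Times F compact_Icc)
  have "S \<in> borel_measurable M"
    unfolding borel_measurable_iff_le
  proof
    fix x
    have "{\<omega> \<in> space M. S \<omega> \<le> x} = (if 0 \<le> x then space M - H else {}) \<union> {\<omega> \<in> space M. \<exists>p\<in>(F \<inter> {..x}) \<times> {\<alpha>..\<gamma>}. Bp p \<omega> = 0}"
    proof (intro equalityI subsetI)
      fix \<omega> assume \<omega>: "\<omega> \<in> {\<omega> \<in> space M. S \<omega> \<le> x}"
      show "\<omega> \<in> (if 0 \<le> x then space M - H else {}) \<union> {\<omega> \<in> space M. \<exists>p\<in>(F \<inter> {..x}) \<times> {\<alpha>..\<gamma>}. Bp p \<omega> = 0}"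
      proof (cases "\<omega> \<in> H")
        case True
        then show ?thesis using SZ(1)[OF True] \<omega> by (auto simp: Z_def)
      next
        case False
        then show ?thesis using \<omega> by (auto simp: S_def)
      qed
    next
      fix \<omega> assume \<omega>: "\<omega> \<in> (if 0 \<le> x then space M - H else {}) \<union> {\<omega> \<in> space M. \<exists>p\<in>(F \<inter> {..x}) \<times> {\<alpha>..\<gamma>}. Bp p \<omega> = 0}"
      show "\<omega> \<in> {\<omega> \<in> space M. S \<omega> \<le> x}"
      proof (cases "\<omega> \<in> H")
        case True
        then obtain s t where "s \<in> F" "s \<le> x" "t \<in> {\<alpha>..\<gamma>}" "Bp (s, t) \<omega> = 0" using \<omega> by (auto split: if_splits)
        then have "s \<in> Z \<omega>" by (auto simp: Z_def)
        then have "S \<omega> \<le> s" by (rule SZ(2)[OF True])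
        then show ?thesis using True \<open>s \<le> x\<close> by (auto simp: H_def)
      next
        case False
        then show ?thesis using \<omega> by (auto simp: S_def H_def split: if_splits)
      qed
    qed
    also have "\<dots> \<in> sets M"
      using Hm F by (intro sets.Un zero_event_measurable compact_Times compact_Int_closed) auto
    finally show "{\<omega> \<in> space M. S \<omega> \<le> x} \<in> sets M" .
  qed
  moreover have "S \<omega> \<in> F \<and> (\<exists>t\<in>{\<alpha>..\<gamma>}. Bp (S \<omega>, t) \<omega> = 0)" if "\<omega> \<in> H" for \<omega>
    using SZ(1)[OF that] by (auto simp: Z_def)
  ultimately show thesis by (rule that)
qed

lemma capacity_pos_if_hit_prob_pos:
  assumes F: "compact F" "F \<subseteq> {0<..}"
    and hit: "measure M {\<omega> \<in> space M. \<exists>s\<in>F. \<exists>t>0. B s t \<omega> = 0} > 0"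
  shows "riesz_capacity ((real CARD('d) - 2) / 2) F > 0"
proof -
  define HH where "HH n = {\<omega> \<in> space M. \<exists>p\<in>F \<times> {1 / real (Suc n)..real (Suc n)}. Bp p \<omega> = 0}" for n
  have HHm: "HH n \<in> sets M" for n unfolding HH_def by (intro zero_event_measurable compact_Times F compact_Icc)
  have "emeasure M (\<Union>n. HH n) \<noteq> 0"
    using hit unfolding hit_event_measurable(1)[OF F] HH_def[symmetric] by (auto simp: measure_def)
  \<comment> \<open>Countable subadditivity fixes one compact interval of times, bounded away from
    0, on which zeros still have positive probability.\<close>
  then obtain n where n: "emeasure M (HH n) \<noteq> 0" using emeasure_UN_eq_0[of M HH] HHm by blast
  define \<alpha> where "\<alpha> = 1 / real (Suc n)"
  define \<gamma>' where "\<gamma>' = real (Suc n)"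
  \<comment> \<open>The extra unit guarantees that [T, T + 1] lies in the strip for every zero time
    T up to \<open>\<gamma>'\<close>.\<close>
  define \<gamma> where "\<gamma> = \<gamma>' + 1"
  define H where "H = {\<omega> \<in> space M. \<exists>p\<in>F \<times> {\<alpha>..\<gamma>'}. Bp p \<omega> = 0}"
  have H_eq: "H = HH n" by (simp add: H_def HH_def \<alpha>_def \<gamma>'_def)
  have Hm [measurable]: "H \<in> sets M" using HHm H_eq by simp
  define P where "P = measure M H"
  have P: "emeasure M H = ennreal P" "P > 0"
    using n by (auto simp: P_def H_eq emeasure_eq_measure zero_less_measure_iff)
  have \<alpha>: "0 < \<alpha>" "\<alpha> \<le> 1" by (auto simp: \<alpha>_def)
  have \<gamma>: "1 \<le> \<gamma>'" "\<alpha> \<le> \<gamma>" using \<alpha> by (auto simp: \<gamma>'_def \<gamma>_def)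
  obtain S where Sm [measurable]: "S \<in> borel_measurable M"
    and SH: "\<And>\<omega>. \<omega> \<in> H \<Longrightarrow> S \<omega> \<in> F \<and> (\<exists>t\<in>{\<alpha>..\<gamma>'}. Bp (S \<omega>, t) \<omega> = 0)"
    using first_zero_selection[OF F(1), of \<alpha> \<gamma>'] unfolding H_def by blast
  define \<mu> where "\<mu> = distr (uniform_measure M H) borel S"
  interpret U: prob_space "uniform_measure M H"
    by (rule prob_space_uniform_measure) (use P in auto)
  have Su: "S \<in> borel_measurable (uniform_measure M H)" by simp
  have \<mu>: "prob_space \<mu>" "sets \<mu> = sets borel"
    unfolding \<mu>_def by (auto intro: U.prob_space_distr Su)
  interpret mu: prob_space \<mu> by fact
  \<comment> \<open>The exchange between averages over \<mu> and expectations over paths with a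
    zero; its price is the factor \<open>P\<close>.\<close>
  have int_\<mu>: "(\<integral>\<^sup>+\<omega>. f (S \<omega>) * indicator H \<omega> \<partial>M) = ennreal P * (\<integral>\<^sup>+x. f x \<partial>\<mu>)" if [measurable]: "f \<in> borel_measurable borel" for f
  proof -
    have "(\<integral>\<^sup>+x. f x \<partial>\<mu>) = (\<integral>\<^sup>+\<omega>. f (S \<omega>) * indicator H \<omega> \<partial>M) / ennreal P"
      unfolding \<mu>_def P(1)[symmetric]
      by (subst nn_integral_distr[OF Su]) (auto simp: nn_integral_uniform_measure)
    moreover have "ennreal P * (A / ennreal P) = A" for A
      using mult_divide_eq_ennreal[of "ennreal P" A] P(2)
      by (simp only: ennreal_times_divide mult.commute[of "ennreal P"]) simp
    ultimately show ?thesis by simp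
  qed
  have Fm: "F \<in> sets borel" using F(1) by (simp add: borel_compact)
  have \<mu>F: "emeasure \<mu> F = 1"
  proof -
    have "ennreal P * emeasure \<mu> F = ennreal P * (\<integral>\<^sup>+x. indicator F x \<partial>\<mu>)"
      using Fm \<mu>(2) by simp
    also have "\<dots> = (\<integral>\<^sup>+\<omega>. indicator F (S \<omega>) * indicator H \<omega> \<partial>M)"
      using Fm by (intro int_\<mu>[symmetric]) simp
    also have "\<dots> = (\<integral>\<^sup>+\<omega>. indicator H \<omega> \<partial>M)"
      using SH by (intro nn_integral_cong) (auto simp: indicator_def)
    also have "\<dots> = ennreal P" using P by simp
    finally have "ennreal P * emeasure \<mu> F = ennreal P * 1" by simp
    then show ?thesis using P(2) by (subst (asm) ennreal_mult_cancel_left) auto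
  qed
  have AEF: "AE s in \<mu>. s \<in> F"
    using \<mu>F Fm \<mu>(2) by (intro mu.AE_prob_1) (simp add: mu.emeasure_eq_measure)
  have "F \<noteq> {}" using \<mu>F by auto
  obtain a0 where a0: "a0 \<in> F" "\<And>s. s \<in> F \<Longrightarrow> a0 \<le> s" using compact_attains_inf[OF F(1) \<open>F \<noteq> {}\<close>] by auto
  obtain S0 where S0: "S0 \<in> F" "\<And>s. s \<in> F \<Longrightarrow> s \<le> S0" using compact_attains_sup[OF F(1) \<open>F \<noteq> {}\<close>] by auto
  define a where "a = min a0 \<alpha>"
  have a: "0 < a" "a \<le> \<alpha>" "a \<le> a0" using a0(1) F(2) \<alpha> by (auto simp: a_def)
  have AEa: "AE s in \<mu>. a \<le> s" using AEF
  proof (rule eventually_mono)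
    show "a \<le> s" if "s \<in> F" for s using a0(2)[OF that] a(3) by linarith
  qed
  let ?\<rho> = "strip \<mu> \<alpha> \<gamma>"
  have \<rho>: "finite_measure ?\<rho>" "sets ?\<rho> = sets borel"
    using finite_measure_strip[OF \<mu> \<gamma>(2)] sets_strip[OF \<mu>(2)] by auto
  obtain C where C: "0 \<le> C" "\<And>e. 0 < e \<Longrightarrow> (\<integral>\<^sup>+\<omega>. (occ_total ?\<rho> e \<omega>)\<^sup>2 \<partial>M) \<le>
       ennreal C * (\<integral>\<^sup>+x. (\<integral>\<^sup>+y. slab_kernel CARD('d) e \<bar>x - y\<bar> \<partial>\<mu>) \<partial>\<mu>)"
    using occ_second_moment[OF \<mu> a(1) AEa a(2) \<gamma>(2)] by metis
  define c0 where "c0 = exp (- (1 / 2)) * (2 * pi * max 2 (\<gamma> + S0)) powr (- real CARD('d) / 2)"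
  have c0: "c0 > 0" unfolding c0_def by (auto simp: max_def)
  obtain X :: nat where X: "max S0 \<gamma> \<le> real X" using real_arch_simple by blast
  \<comment> \<open>The solution r of \<open>P * c0\<^sup>2 * r = 32 * C\<close>, where 32 is the 16
    of the maximal inequality times the 2 of the one-sided energy.\<close>
  define L where "L = 32 * C / (P * c0\<^sup>2)"
  have L: "0 \<le> L" using C P c0 by (simp add: L_def)
  have main: "(\<integral>\<^sup>+x. (\<integral>\<^sup>+y. slab_kernel CARD('d) e \<bar>x - y\<bar> \<partial>\<mu>) \<partial>\<mu>) \<le> ennreal (2 * L)" if e: "0 < e" for e
  proof -
    define I where "I = (\<integral>\<^sup>+x. (\<integral>\<^sup>+y. slab_kernel CARD('d) e \<bar>x - y\<bar> \<partial>\<mu>) \<partial>\<mu>)"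
    define g where "g x = (\<integral>\<^sup>+y\<in>{x..}. slab_kernel CARD('d) e (y - x) \<partial>\<mu>)" for x
    have gm [measurable]: "g \<in> borel_measurable borel"
      unfolding g_def[abs_def]
    proof (rule mu.borel_measurable_nn_integral)
      have "(\<lambda>(x, y). slab_kernel CARD('d) e (y - x) * (if x \<le> y then 1 else 0)) \<in> borel_measurable (borel \<Otimes>\<^sub>M borel)" by measurable
      moreover have "(\<lambda>(x, y). slab_kernel CARD('d) e (y - x) * (if x \<le> y then 1 else 0)) = (\<lambda>(x, y). slab_kernel CARD('d) e (y - x) * indicator {x..} y)"
        by (auto simp: fun_eq_iff indicator_def)
      ultimately show "(\<lambda>(x, y). slab_kernel CARD('d) e (y - x) * indicator {x..} y) \<in> borel_measurable (borel \<Otimes>\<^sub>M \<mu>)"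
        using measurable_cong_sets[OF sets_pair_measure_cong[OF refl \<mu>(2)]] by (metis (no_types, lifting))
    qed
    have g\<mu>: "g \<in> borel_measurable \<mu>" using gm \<mu>(2) by (simp cong: measurable_cong_sets)
    define Gv where "Gv = (\<integral>\<^sup>+x. g x \<partial>\<mu>)"
    have I_le: "I \<le> 2 * Gv" unfolding I_def Gv_def g_def by (rule slab_energy_le_one_sided[OF \<mu>])
    \<comment> \<open>Finiteness for fixed \<open>e\<close>, from boundedness of the kernel; it
      legitimises cancelling one factor \<open>r\<close> at the end.\<close>
    have "Gv \<le> (\<integral>\<^sup>+x. (\<integral>\<^sup>+y. ennreal (e powr (- real CARD('d) / 2)) \<partial>\<mu>) \<partial>\<mu>)"
      unfolding Gv_def g_def
    proof (intro nn_integral_mono)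
      fix x y :: real
      show "slab_kernel CARD('d) e (y - x) * indicator {x..} y \<le> ennreal (e powr (- real CARD('d) / 2))"
        using slab_kernel_bound[OF e, of "y - x" "CARD('d)"] by (cases "x \<le> y") auto
    qed
    also have "\<dots> = ennreal (e powr (- real CARD('d) / 2))" by (simp add: mu.emeasure_space_1)
    finally have "Gv < \<top>" by (rule le_less_trans) simp
    then obtain r where r: "Gv = ennreal r" "0 \<le> r" by (cases Gv) auto
    \<comment> \<open>Cauchy-Schwarz passes from the squared energy to the mean square of the
      potential, the quantity that an L2 maximal inequality can control.\<close>
    have "ennreal P * (ennreal (c0\<^sup>2) * Gv\<^sup>2) \<le> ennreal P * (ennreal (c0\<^sup>2) * (\<integral>\<^sup>+x. (g x)\<^sup>2 \<partial>\<mu>))"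
    proof (intro mult_left_mono)
      have "Gv\<^sup>2 = (\<integral>\<^sup>+x. g x * 1 \<partial>\<mu>)\<^sup>2" by (simp add: Gv_def)
      also have "\<dots> \<le> (\<integral>\<^sup>+x. (g x)\<^sup>2 \<partial>\<mu>) * (\<integral>\<^sup>+x. 1\<^sup>2 \<partial>\<mu>)"
        by (rule Cauchy_Schwarz_nn_integral[OF g\<mu>]) simp
      finally show "Gv\<^sup>2 \<le> (\<integral>\<^sup>+x. (g x)\<^sup>2 \<partial>\<mu>)" by (simp add: mu.emeasure_space_1)
    qed auto
    also have "\<dots> = ennreal P * (\<integral>\<^sup>+x. (ennreal c0 * g x)\<^sup>2 \<partial>\<mu>)"
      using g\<mu> c0 by (simp add: power_mult_distrib ennreal_power nn_integral_cmult)
    also have "\<dots> = (\<integral>\<^sup>+\<omega>. (ennreal c0 * g (S \<omega>))\<^sup>2 * indicator H \<omega> \<partial>M)"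
      by (rule int_\<mu>[symmetric]) measurable
    \<comment> \<open>On \<open>H\<close> the point \<open>S \<omega>\<close> belongs to a zero, so
      the potential there is eventually below the grid maximum. The required mesh varies with
      \<omega>; the limit inferior and Fatou's lemma take care of this.\<close>
    also have "\<dots> \<le> (\<integral>\<^sup>+\<omega>. liminf (\<lambda>n. ennreal ((grid_max ?\<rho> e X n \<omega>)\<^sup>2)) \<partial>M)"
    proof (rule nn_integral_mono)
      fix \<omega> assume \<omega>: "\<omega> \<in> space M"
      show "(ennreal c0 * g (S \<omega>))\<^sup>2 * indicator H \<omega> \<le> liminf (\<lambda>n. ennreal ((grid_max ?\<rho> e X n \<omega>)\<^sup>2))"
      proof (cases "\<omega> \<in> H")
        case True
        obtain T where T: "T \<in> {\<alpha>..\<gamma>'}" "Bp (S \<omega>, T) \<omega> = 0" using SH[OF True] by auto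
        have SF: "S \<omega> \<in> F" using SH[OF True] by simp
        have "0 \<le> S \<omega>" "S \<omega> \<le> S0" using SF F(2) S0(2)[OF SF] by (auto simp: less_imp_le)
        then have "\<forall>\<^sub>F n in sequentially. ennreal c0 * g (S \<omega>) \<le> ennreal (grid_max ?\<rho> e X n \<omega>)"
          unfolding c0_def g_def
          by (rule grid_max_lower[OF \<mu> e \<alpha>(1)]) (use T X \<omega> in \<open>auto simp: \<gamma>_def\<close>)
        then have "\<forall>\<^sub>F n in sequentially. (ennreal c0 * g (S \<omega>))\<^sup>2 \<le> ennreal ((grid_max ?\<rho> e X n \<omega>)\<^sup>2)"
        proof (rule eventually_mono)
          fix n assume le: "ennreal c0 * g (S \<omega>) \<le> ennreal (grid_max ?\<rho> e X n \<omega>)"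
          have "0 \<le> grid_max ?\<rho> e X n \<omega>"
            unfolding grid_max_def by (intro running_max_nonneg) simp
          then show "(ennreal c0 * g (S \<omega>))\<^sup>2 \<le> ennreal ((grid_max ?\<rho> e X n \<omega>)\<^sup>2)"
            using power_mono[OF le, of 2] by (simp add: ennreal_power)
        qed
        then show ?thesis using True by (simp add: Liminf_bounded)
      qed simp
    qed
    also have "\<dots> \<le> liminf (\<lambda>n. \<integral>\<^sup>+\<omega>. ennreal ((grid_max ?\<rho> e X n \<omega>)\<^sup>2) \<partial>M)"
    proof (rule nn_integral_liminf)
      fix n
      have "grid_max ?\<rho> e X n \<in> borel_measurable M"
        unfolding grid_max_def
        by (intro running_max_measurable measurable_compose[OF corner_occ_measurable[OF \<rho>]]) simp
      then show "(\<lambda>\<omega>. ennreal ((grid_max ?\<rho> e X n \<omega>)\<^sup>2)) \<in> borel_measurable M" by measurable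
    qed
    also have "\<dots> \<le> 16 * (\<integral>\<^sup>+\<omega>. (occ_total ?\<rho> e \<omega>)\<^sup>2 \<partial>M)"
      unfolding grid_max_def by (intro Liminf_le always_eventually allI corner_occ_maximal[OF \<rho> e]) auto
    also have "\<dots> \<le> 16 * (ennreal C * (2 * Gv))"
    proof (rule mult_left_mono)
      have "ennreal C * I \<le> ennreal C * (2 * Gv)" by (intro mult_left_mono I_le) simp
      then show "(\<integral>\<^sup>+\<omega>. (occ_total ?\<rho> e \<omega>)\<^sup>2 \<partial>M) \<le> ennreal C * (2 * Gv)"
        using C(2)[OF e] unfolding I_def[symmetric] by order
    qed simp
    finally have "ennreal P * (ennreal (c0\<^sup>2) * (ennreal r)\<^sup>2) \<le> 16 * (ennreal C * (2 * ennreal r))" by (simp add: r)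
    moreover have "ennreal P * (ennreal (c0\<^sup>2) * (ennreal r)\<^sup>2) = ennreal (P * (c0\<^sup>2 * r\<^sup>2))"
      using P r by (simp add: ennreal_mult ennreal_power)
    moreover have "16 * (ennreal C * (2 * ennreal r)) = ennreal (16 * (C * (2 * r)))"
      using C(1) r(2) by (simp only: ennreal_mult ennreal_numeral mult_nonneg_nonneg zero_le_numeral)
    ultimately have "ennreal (P * (c0\<^sup>2 * r\<^sup>2)) \<le> ennreal (16 * (C * (2 * r)))" by (simp only:)
    moreover have "0 \<le> 16 * (C * (2 * r))" using C(1) r(2) by simp
    ultimately have "P * (c0\<^sup>2 * r\<^sup>2) \<le> 16 * (C * (2 * r))" by (simp only: ennreal_le_iff)
    \<comment> \<open>Quadratic on the left, linear on the right: this is what bounds the one-sided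
      energy independently of \<open>e\<close>.\<close>
    then have "r * (P * c0\<^sup>2 * r) \<le> r * (32 * C)" by (simp add: power2_eq_square algebra_simps)
    then have "r \<le> L"
      using r(2) P c0 L by (cases "r = 0") (auto simp: L_def field_simps)
    then have "2 * Gv \<le> ennreal (2 * L)" using r L by (simp add: ennreal_mult ennreal_leI mult_left_mono)
    then show ?thesis using I_le unfolding I_def by order
  qed
  have "riesz_energy ((real CARD('d) - 2) / 2) \<mu> < \<top>"
    by (rule riesz_energy_finite_if_slab_bounded[OF \<mu> _ main]) (simp_all add: Suc_leI)
  moreover have "\<mu> \<in> prob_measures_on F" using \<mu> \<mu>F by (simp add: prob_measures_on_def)
  ultimately have "(INF \<mu>\<in>prob_measures_on F. riesz_energy ((real CARD('d) - 2) / 2) \<mu>) < \<top>"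
    by (auto simp: INF_less_iff)
  then show ?thesis unfolding riesz_capacity_def ennreal_inverse_positive by (rule less_imp_neq)
qed

end

theorem theorem1p1:
  fixes M :: "'a measure"
    and B :: "real \<Rightarrow> real \<Rightarrow> 'a \<Rightarrow> real ^ 'd::finite"
    and F :: "real set"
  assumes "brownian_sheet M B"
    and "compact F"
    and "F \<subseteq> {0<..}"
  shows "measure M {\<omega> \<in> space M. \<exists>s\<in>F. \<exists>t>0. B s t \<omega> = 0} > 0
         \<longleftrightarrow> riesz_capacity ((real CARD('d) - 2) / 2) F > 0"
proof -
  interpret sheet M B by unfold_locales fact
  show ?thesis
    using capacity_pos_if_hit_prob_pos[OF assms(2,3)] hit_prob_pos_if_capacity_pos[OF assms(2,3)] by blast
qed

end
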